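(* Let $\Gamma$ be a hyperbolic group, let $X$ be a Gromov-hyperbolic, proper, geodesic metric space and $G=\mathrm{Isom}(X)$, and let $A\subset\Gamma$ be testable. Then $S_A(\Gamma,G)$ is an open set of discontinuity of $X(\Gamma,G)$ for the action of $\mathrm{Out}(\Gamma)$, i.e. it is open, $\mathrm{Out}(\Gamma)$-invariant, and for every compact $R\subset S_A(\Gamma,G)$ the set $\{\phi\in\mathrm{Out}(\Gamma)\mid \phi(R)\cap R\neq\emptyset\}$ is finite.
   Context: Fix a finite generating set $S$; $l_S(\gamma)$ is the translation length of $\gamma$ acting on the Cayley graph $C_S(\Gamma)$. $A$ is testable if it is invariant under all automorphisms of $\Gamma$ and for every sequence $(\phi_n)$ of distinct elements of $\mathrm{Out}(\Gamma)$ there is $a\in A$ with $\limsup_n l_S(\phi_n(a))=\infty$. $G$ has the compact-open topology; $X(\Gamma,G)=\mathrm{Hom}(\Gamma,G)/\mathrm{Inn}(G)$ with the quotient of the topology induced from $G^{|S|}$; $\mathrm{Out}(\Gamma)$ acts via $\varphi\cdot\rho=\rho\circ\varphi^{-1}$. Orbit map $\tau_{\rho,x}$: $\rho$-equivariant, $\gamma\mapsto\rho(\gamma)x$ on vertices, edges to geodesic segments. For infinite order $a$, $L_S(a)$ is the set of geodesics of $C_S(\Gamma)$ between the fixed points $a^\pm\in\partial C_S(\Gamma)$. $\rho$ is $A$-stable if there are $K\geqslant1,C\geqslant0,x\in X$ with $\tau_{\rho,x}(l)$ a $(K,C)$ quasi-geodesic for all $l\in L_S(a)$, all infinite order $a\in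 A$; $S_A(\Gamma,G)$ is the set of conjugacy classes of $A$-stable representations. *)

theory Defs
  imports "HOL-Analysis.Analysis" "HOL-Algebra.Group" "HOL-Algebra.Generated_Groups"
begin

definition word_len :: "('g, 'b) monoid_scheme \<Rightarrow> 'g set \<Rightarrow> 'g \<Rightarrow> nat" where
  "word_len \<Gamma> S g = (LEAST n. \<exists>ws. length ws = n \<and>
      set ws \<subseteq> S \<union> (\<lambda>s. inv\<^bsub>\<Gamma>\<^esub> s) ` S \<and> foldr (\<otimes>\<^bsub>\<Gamma>\<^esub>) ws \<one>\<^bsub>\<Gamma>\<^esub> = g)"

definition word_dist :: "('g, 'b) monoid_scheme \<Rightarrow> 'g set \<Rightarrow> 'g \<Rightarrow> 'g \<Rightarrow> real" where
  "word_dist \<Gamma> S g h = real (word_len \<Gamma> S (inv\<^bsub>\<Gamma>\<^esub> g \<otimes>\<^bsub>\<Gamma>\<^esub> h))"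

text \<open>Translation length of gamma acting by left multiplication on the Cayley graph C_S(Gamma),
  measured on vertices: inf over vertices g of d_S(g, gamma g).\<close>
definition transl_len :: "('g, 'b) monoid_scheme \<Rightarrow> 'g set \<Rightarrow> 'g \<Rightarrow> real" where
  "transl_len \<Gamma> S \<gamma> = (INF g\<in>carrier \<Gamma>. word_dist \<Gamma> S g (\<gamma> \<otimes>\<^bsub>\<Gamma>\<^esub> g))"

definition gromov_hyperbolic_on :: "'a set \<Rightarrow> ('a \<Rightarrow> 'a \<Rightarrow> real) \<Rightarrow> bool" where
  "gromov_hyperbolic_on M d \<longleftrightarrow> (\<exists>\<delta>\<ge>0. \<forall>x\<in>M. \<forall>y\<in>M. \<forall>z\<in>M. \<forall>w\<in>M.
      (d w x + d w z - d x z) / 2 \<ge>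
        min ((d w x + d w y - d x y) / 2) ((d w y + d w z - d y z) / 2) - \<delta>)"

definition hyperbolic_group :: "('g, 'b) monoid_scheme \<Rightarrow> 'g set \<Rightarrow> bool" where
  "hyperbolic_group \<Gamma> S \<longleftrightarrow> group \<Gamma> \<and> finite S \<and> S \<subseteq> carrier \<Gamma> \<and>
     generate \<Gamma> S = carrier \<Gamma> \<and> gromov_hyperbolic_on (carrier \<Gamma>) (word_dist \<Gamma> S)"

definition geodesic_space :: "'x::metric_space set \<Rightarrow> bool" where
  "geodesic_space (U::'x set) \<longleftrightarrow> (\<forall>x y::'x. \<exists>c::real \<Rightarrow> 'x. c 0 = x \<and> c (dist x y) = y \<and>
      (\<forall>s\<in>{0..dist x y}. \<forall>t\<in>{0..dist x y}. dist (c s) (c t) = \<bar>s - t\<bar>))"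

definition proper_space :: "'x::metric_space set \<Rightarrow> bool" where
  "proper_space (U::'x set) \<longleftrightarrow> (\<forall>x::'x. \<forall>r. compact (cball x r))"

definition Isom :: "('x::metric_space \<Rightarrow> 'x) set" where
  "Isom = {f. (\<forall>x y. dist (f x) (f y) = dist x y) \<and> surj f}"

definition compact_open_Isom :: "('x::metric_space \<Rightarrow> 'x) topology" where
  "compact_open_Isom = topology_generated_by
     {{f \<in> Isom. f ` K \<subseteq> U} | K U. compact K \<and> open U}"

definition Hom_Isom :: "('g, 'b) monoid_scheme \<Rightarrow> ('g \<Rightarrow> ('x::metric_space \<Rightarrow> 'x)) set" where
  "Hom_Isom \<Gamma> = {\<rho>. (\<forall>g\<in>carrier \<Gamma>. \<rho> g \<in> Isom) \<and>
      (\<forall>g\<in>carrier \<Gamma>. \<forall>h\<in>carrier \<Gamma>. \<rho> (g \<otimes>\<^bsub>\<Gamma>\<^esub> h) = \<rho> g \<circ> \<rho> h) \<and>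
      (\<forall>g. g \<notin> carrier \<Gamma> \<longrightarrow> \<rho> g = undefined)}"

definition Hom_top :: "('g, 'b) monoid_scheme \<Rightarrow> 'g set \<Rightarrow> ('g \<Rightarrow> ('x::metric_space \<Rightarrow> 'x)) topology" where
  "Hom_top \<Gamma> S = pullback_topology (Hom_Isom \<Gamma>) (\<lambda>\<rho>. restrict \<rho> S)
      (product_topology (\<lambda>s. compact_open_Isom) S)"

definition conj_class :: "('g, 'b) monoid_scheme \<Rightarrow> ('g \<Rightarrow> ('x::metric_space \<Rightarrow> 'x))
     \<Rightarrow> ('g \<Rightarrow> ('x \<Rightarrow> 'x)) set" where
  "conj_class \<Gamma> \<rho> = {\<sigma> \<in> Hom_Isom \<Gamma>. \<exists>h\<in>Isom. \<forall>g\<in>carrier \<Gamma>. \<sigma> g = h \<circ> \<rho> g \<circ> inv_into UNIV h}"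

definition char_space :: "('g, 'b) monoid_scheme \<Rightarrow> ('g \<Rightarrow> ('x::metric_space \<Rightarrow> 'x)) set set" where
  "char_space \<Gamma> = conj_class \<Gamma> ` Hom_Isom \<Gamma>"

definition quotient_top :: "'a topology \<Rightarrow> ('a \<Rightarrow> 'c) \<Rightarrow> 'c topology" where
  "quotient_top T q = topology (\<lambda>U. U \<subseteq> q ` topspace T \<and> openin T {x \<in> topspace T. q x \<in> U})"

definition char_top :: "('g, 'b) monoid_scheme \<Rightarrow> 'g set \<Rightarrow> ('g \<Rightarrow> ('x::metric_space \<Rightarrow> 'x)) set topology" where
  "char_top \<Gamma> S = quotient_top (Hom_top \<Gamma> S) (conj_class \<Gamma>)"

definition outer_equiv :: "('g, 'b) monoid_scheme \<Rightarrow> ('g \<Rightarrow> 'g) \<Rightarrow> ('g \<Rightarrow> 'g) \<Rightarrow> bool" where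
  "outer_equiv \<Gamma> \<phi> \<psi> \<longleftrightarrow> (\<exists>g\<in>carrier \<Gamma>. \<forall>x\<in>carrier \<Gamma>.
      \<phi> x = g \<otimes>\<^bsub>\<Gamma>\<^esub> \<psi> x \<otimes>\<^bsub>\<Gamma>\<^esub> inv\<^bsub>\<Gamma>\<^esub> g)"

definition outer_class :: "('g, 'b) monoid_scheme \<Rightarrow> ('g \<Rightarrow> 'g) \<Rightarrow> ('g \<Rightarrow> 'g) set" where
  "outer_class \<Gamma> \<phi> = {\<psi> \<in> iso \<Gamma> \<Gamma>. outer_equiv \<Gamma> \<psi> \<phi>}"

definition Out :: "('g, 'b) monoid_scheme \<Rightarrow> ('g \<Rightarrow> 'g) set set" where
  "Out \<Gamma> = outer_class \<Gamma> ` iso \<Gamma> \<Gamma>"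

definition out_act :: "('g, 'b) monoid_scheme \<Rightarrow> ('g \<Rightarrow> 'g) set
     \<Rightarrow> ('g \<Rightarrow> ('x::metric_space \<Rightarrow> 'x)) set \<Rightarrow> ('g \<Rightarrow> ('x \<Rightarrow> 'x)) set" where
  "out_act \<Gamma> \<Phi> R = {\<sigma> \<in> Hom_Isom \<Gamma>. \<exists>\<rho>\<in>R. \<exists>\<phi>\<in>\<Phi>.
      \<forall>g\<in>carrier \<Gamma>. \<sigma> g = \<rho> (inv_into (carrier \<Gamma>) \<phi> g)}"

definition testable :: "('g, 'b) monoid_scheme \<Rightarrow> 'g set \<Rightarrow> 'g set \<Rightarrow> bool" where
  "testable \<Gamma> S A \<longleftrightarrow> A \<subseteq> carrier \<Gamma> \<and> (\<forall>\<phi>\<in>iso \<Gamma> \<Gamma>. \<phi> ` A = A) \<and>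
     (\<forall>\<phi>::nat \<Rightarrow> 'g \<Rightarrow> 'g. (\<forall>n. \<phi> n \<in> iso \<Gamma> \<Gamma>) \<and>
        (\<forall>m n. m \<noteq> n \<longrightarrow> outer_class \<Gamma> (\<phi> m) \<noteq> outer_class \<Gamma> (\<phi> n)) \<longrightarrow>
        (\<exists>a\<in>A. limsup (\<lambda>n. ereal (transl_len \<Gamma> S (\<phi> n a))) = \<infinity>))"

definition infinite_order :: "('g, 'b) monoid_scheme \<Rightarrow> 'g \<Rightarrow> bool" where
  "infinite_order \<Gamma> a \<longleftrightarrow> a \<in> carrier \<Gamma> \<and> (\<forall>n::nat. n > 0 \<longrightarrow> a [^]\<^bsub>\<Gamma>\<^esub> n \<noteq> \<one>\<^bsub>\<Gamma>\<^esub>)"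

text \<open>Two sequences converge to the same point of the Gromov boundary:
  Gromov product based at 1 tends to infinity.\<close>
definition same_boundary_limit :: "('g, 'b) monoid_scheme \<Rightarrow> 'g set \<Rightarrow> (nat \<Rightarrow> 'g) \<Rightarrow> (nat \<Rightarrow> 'g) \<Rightarrow> bool" where
  "same_boundary_limit \<Gamma> S u v \<longleftrightarrow> (\<forall>B. \<exists>N. \<forall>m\<ge>N. \<forall>n\<ge>N.
     (word_dist \<Gamma> S \<one>\<^bsub>\<Gamma>\<^esub> (u m) + word_dist \<Gamma> S \<one>\<^bsub>\<Gamma>\<^esub> (v n) - word_dist \<Gamma> S (u m) (v n)) / 2 \<ge> B)"

text \<open>L_S(a): bi-infinite geodesics of the Cayley graph (as sequences of vertices) from a^- to a^+.\<close>
definition geod_lines :: "('g, 'b) monoid_scheme \<Rightarrow> 'g set \<Rightarrow> 'g \<Rightarrow> (int \<Rightarrow> 'g) set" where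
  "geod_lines \<Gamma> S a = {l. (\<forall>n. l n \<in> carrier \<Gamma>) \<and>
      (\<forall>m n. word_dist \<Gamma> S (l m) (l n) = real_of_int \<bar>m - n\<bar>) \<and>
      same_boundary_limit \<Gamma> S (\<lambda>n. l (int n)) (\<lambda>n. a [^]\<^bsub>\<Gamma>\<^esub> n) \<and>
      same_boundary_limit \<Gamma> S (\<lambda>n. l (- int n)) (\<lambda>n. (inv\<^bsub>\<Gamma>\<^esub> a) [^]\<^bsub>\<Gamma>\<^esub> n)}"

text \<open>gamma is the image tau_{rho,x}(l) of the line l under an orbit map:
  vertex l n goes to rho(l n) x, the edge [n,n+1] to a (constant speed) geodesic segment.\<close>
definition orbit_path :: "('g \<Rightarrow> ('x::metric_space \<Rightarrow> 'x)) \<Rightarrow> 'x \<Rightarrow> (int \<Rightarrow> 'g) \<Rightarrow> (real \<Rightarrow> 'x) \<Rightarrow> bool" where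
  "orbit_path \<rho> x l \<gamma> \<longleftrightarrow> (\<forall>n::int. \<gamma> (real_of_int n) = \<rho> (l n) x \<and>
      (\<forall>s\<in>{0..1}. \<forall>t\<in>{0..1}. dist (\<gamma> (real_of_int n + s)) (\<gamma> (real_of_int n + t))
          = \<bar>s - t\<bar> * dist (\<rho> (l n) x) (\<rho> (l (n + 1)) x)))"

definition quasi_geodesic :: "real \<Rightarrow> real \<Rightarrow> (real \<Rightarrow> 'x::metric_space) \<Rightarrow> bool" where
  "quasi_geodesic K C \<gamma> \<longleftrightarrow> (\<forall>s t. \<bar>s - t\<bar> / K - C \<le> dist (\<gamma> s) (\<gamma> t) \<and>
      dist (\<gamma> s) (\<gamma> t) \<le> K * \<bar>s - t\<bar> + C)"

definition A_stable :: "('g, 'b) monoid_scheme \<Rightarrow> 'g set \<Rightarrow> 'g set \<Rightarrow> ('g \<Rightarrow> ('x::metric_space \<Rightarrow> 'x)) \<Rightarrow> bool" where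
  "A_stable \<Gamma> S A \<rho> \<longleftrightarrow> (\<exists>K\<ge>1. \<exists>C\<ge>0. \<exists>x::'x. \<forall>a\<in>A. infinite_order \<Gamma> a \<longrightarrow>
      (\<forall>l\<in>geod_lines \<Gamma> S a. \<forall>\<gamma>. orbit_path \<rho> x l \<gamma> \<longrightarrow> quasi_geodesic K C \<gamma>))"

definition stable_set :: "('g, 'b) monoid_scheme \<Rightarrow> 'g set \<Rightarrow> 'g set \<Rightarrow> ('g \<Rightarrow> ('x::metric_space \<Rightarrow> 'x)) set set" where
  "stable_set \<Gamma> S A = conj_class \<Gamma> ` {\<rho> \<in> Hom_Isom \<Gamma>. A_stable \<Gamma> S A \<rho>}"

end

theory Submission
  imports Defs "HOL-Library.Diagonal_Subsequence"
begin

text \<open>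
  Everything is phrased with Gromov products. Two facts carry the argument: Gromov products
  along a quasi-geodesic are bounded (half of the Morse lemma), and a sequence whose two-step
  distances exceed its one-step distances by more than \<open>2\<delta>\<close> escapes linearly (a direct
  consequence of the four-point condition).

  Openness: by the first fact, for an A-stable representation the orbits of the lines in
  \<open>L_S(a)\<close>, sampled at a large scale N, satisfy the hypothesis of the second with room to spare.
  This is a condition on the elements of word length at most 2N, so it persists for nearby
  representations, with uniform constants.

  Invariance: an automorphism maps a line of \<open>L_S(a)\<close> to a quasi-geodesic, which fellow-travels a
  geodesic line with the same endpoints (a diagonal limit of finite geodesics).

  Discontinuity: by compactness the classes in R have uniform constants. If \<open>\<phi>\<close> moves a class of R
  into R, then comparing growth rates of \<open>\<rho>(\<phi>\<inverse>(a)^n)\<close> bounds the translation length of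
  \<open>\<phi>\<inverse>(a)\<close> in terms of a alone, which contradicts testability for infinitely many classes \<open>\<phi>\<close>.
  It is not necessary to know that elements of infinite order are loxodromic: elements of large
  translation length are, by the second fact, and the others are not a concern.
\<close>

section \<open>Gromov hyperbolic spaces\<close>

text \<open>Stability comes with a multiplicative constant, an additive constant and a basepoint,
  and the difficulty is to control them jointly over a compact set of classes. It is therefore
  reduced to one inequality, a lower bound for the orbit map on vertices; the upper bound is
  automatic, an orbit map being Lipschitz with the displacement of the generators as constant. With
  the two constants and that displacement bounded by one natural number, the stable locus is an
  increasing union of open sets invariant under conjugation, and a compact set lies in one of them.
  The basepoint is never normalised: in the end only linear growth rates of orbits are compared, and
  moving the basepoint changes the distances by a bounded amount. For the same reason constants
  attached to a single group element may depend on it, whereas those attached to lines and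
  quasi-geodesics must be uniform. The action precomposes with inverses, so testability is applied
  to the inverses of the given automorphisms, whose outer classes must be seen to remain
  distinct.\<close>

definition gprod :: "('a \<Rightarrow> 'a \<Rightarrow> real) \<Rightarrow> 'a \<Rightarrow> 'a \<Rightarrow> 'a \<Rightarrow> real" where
  "gprod d w x y = (d w x + d w y - d x y) / 2"

lemma gprod_double: "2 * gprod d w x y = d w x + d w y - d x y"
  unfolding gprod_def by simp

definition qgeod_on :: "('a \<Rightarrow> 'a \<Rightarrow> real) \<Rightarrow> real \<Rightarrow> real \<Rightarrow> real \<Rightarrow> int set \<Rightarrow> (int \<Rightarrow> 'a) \<Rightarrow> bool" where
  "qgeod_on d K C L I y \<longleftrightarrow> (\<forall>i\<in>I. \<forall>j\<in>I. \<bar>real_of_int (i - j)\<bar> / K - C \<le> d (y i) (y j) \<and>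
      d (y i) (y j) \<le> L * \<bar>real_of_int (i - j)\<bar>)"

lemma qgeod_on_subset: "qgeod_on d K C L I y \<Longrightarrow> J \<subseteq> I \<Longrightarrow> qgeod_on d K C L J y"
  unfolding qgeod_on_def by blast

text \<open>Chains of \<open>2 ^ m\<close> steps lose only \<open>m * \<delta>\<close> in Gromov
  products, which leads to an estimate of a length by its own logarithm; this is what turns such an
  estimate into an absolute bound.\<close>

lemma exponential_beats_linear:
  fixes a b :: real
  shows "\<exists>m0. \<forall>m\<ge>m0. a + b * real m \<le> 2 ^ m"
proof -
  have "((\<lambda>m. (a + b * real m) / 2 ^ m) \<longlonglongrightarrow> 0)"
  proof -
    have 1: "(\<lambda>m. a * (1/2::real) ^ m) \<longlonglongrightarrow> a * 0"
      by (intro tendsto_intros LIMSEQ_realpow_zero) auto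
    have 2: "(\<lambda>m. b * (real m * (1/2::real) ^ m)) \<longlonglongrightarrow> b * 0"
      by (intro tendsto_intros powser_times_n_limit_0) auto
    show ?thesis using tendsto_add[OF 1 2] by (simp add: field_simps)
  qed
  then have "eventually (\<lambda>m. (a + b * real m) / 2 ^ m < 1) sequentially"
    by (rule order_tendstoD) simp
  then obtain m0 where "\<And>m. m \<ge> m0 \<Longrightarrow> (a + b * real m) / 2 ^ m < 1"
    unfolding eventually_sequentially by blast
  then show ?thesis by (intro exI[of _ m0]) (force simp: divide_less_eq)
qed

text \<open>Rates are compared up to an arbitrary additive constant \<open>c\<close>, so that
  basepoints and fellow-travelling distances drop out.\<close>

lemma linear_growth_le:
  fixes \<alpha> \<beta> c :: real
  assumes "\<And>n::nat. \<alpha> * real n - c \<le> \<beta> * real n"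
  shows "\<alpha> \<le> \<beta>"
proof (rule ccontr)
  assume "\<not> \<alpha> \<le> \<beta>"
  then obtain n :: nat where "c < real n * (\<alpha> - \<beta>)" using reals_Archimedean3[of "\<alpha> - \<beta>"] by auto
  then show False using assms[of n] by (simp add: algebra_simps)
qed

text \<open>
  Interpolation is exact on the sum of distances but only up to 1 on the position, so that it holds
  both in geodesic spaces and on the vertices of a Cayley graph.
\<close>

locale gromov_space =
  fixes M :: "'a set" and d :: "'a \<Rightarrow> 'a \<Rightarrow> real" and \<delta> :: real
  assumes dist_sym: "x \<in> M \<Longrightarrow> y \<in> M \<Longrightarrow> d x y = d y x"
    and dist_refl: "x \<in> M \<Longrightarrow> d x x = 0"
    and dist_tri: "x \<in> M \<Longrightarrow> y \<in> M \<Longrightarrow> z \<in> M \<Longrightarrow> d x z \<le> d x y + d y z"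
    and delta_nonneg: "0 \<le> \<delta>"
    and hyp: "x \<in> M \<Longrightarrow> y \<in> M \<Longrightarrow> z \<in> M \<Longrightarrow> w \<in> M \<Longrightarrow>
      min (gprod d w x y) (gprod d w y z) - \<delta> \<le> gprod d w x z"
    and interpolate: "x \<in> M \<Longrightarrow> y \<in> M \<Longrightarrow> 0 \<le> t \<Longrightarrow> t \<le> d x y \<Longrightarrow>
      \<exists>z\<in>M. d x z + d z y = d x y \<and> \<bar>d x z - t\<bar> \<le> 1"
begin

lemma dist_nonneg: "x \<in> M \<Longrightarrow> y \<in> M \<Longrightarrow> 0 \<le> d x y"
  using dist_tri[of x y x] dist_sym[of x y] dist_refl[of x] by auto

lemma gprod_commute: "x \<in> M \<Longrightarrow> y \<in> M \<Longrightarrow> gprod d w x y = gprod d w y x"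
  unfolding gprod_def using dist_sym[of x y] by simp

lemma gprod_le: "x \<in> M \<Longrightarrow> y \<in> M \<Longrightarrow> w \<in> M \<Longrightarrow> gprod d w x y \<le> d w x"
  unfolding gprod_def using dist_tri[of w x y] by simp

lemma gprod_nonneg: "x \<in> M \<Longrightarrow> y \<in> M \<Longrightarrow> w \<in> M \<Longrightarrow> 0 \<le> gprod d w x y"
  unfolding gprod_def using dist_tri[of x w y] dist_sym[of x w] by simp

lemma gprod_le_dist_between:
  assumes "x \<in> M" "y \<in> M" "w \<in> M" "p \<in> M" "d x p + d p y = d x y"
  shows "gprod d w x y \<le> d w p"
  unfolding gprod_def using assms dist_tri[of w p x] dist_tri[of w p y] dist_sym[of p x] by simp

lemma gprod_change_base:
  assumes "x \<in> M" "y \<in> M" "w \<in> M" "v \<in> M"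
  shows "gprod d v x y - d v w \<le> gprod d w x y"
  using dist_tri[OF assms(4,3,1)] dist_tri[OF assms(4,3,2)]
    gprod_double[of d v x y] gprod_double[of d w x y] by linarith

section \<open>Consequences of the four-point condition\<close>

lemma four_point:
  assumes "x \<in> M" "y \<in> M" "z \<in> M" "w \<in> M"
  shows "d x z + d w y \<le> max (d x y + d w z) (d w x + d y z) + 2 * \<delta>"
  using hyp[OF assms] gprod_double[of d w x z] gprod_double[of d w x y] gprod_double[of d w y z]
  by linarith

text \<open>The induction is on the stronger claim that each step increases the distance from
  \<open>x 0\<close> by at least \<open>a\<close>. In the four-point inequality for
  \<open>x 0\<close>, \<open>x n\<close>, \<open>x (n+1)\<close>, \<open>x (n+2)\<close> the first
  alternative contradicts the previous increment together with the second hypothesis on steps; the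
  other alternative, with the first hypothesis, is the next increment.\<close>

lemma discrete_local_to_global:
  fixes x :: "nat \<Rightarrow> 'a"
  assumes xM: "\<And>i. x i \<in> M" and a: "0 < a"
    and step: "\<And>i. d (x i) (x (i+1)) + 2 * \<delta> + a \<le> d (x i) (x (i+2))"
      "\<And>i. d (x (i+1)) (x (i+2)) + 2 * \<delta> + a \<le> d (x i) (x (i+2))"
  shows "a * real n \<le> d (x 0) (x n)"
proof -
  have inc: "d (x 0) (x n) + a \<le> d (x 0) (x (Suc n))" for n
  proof (induction n)
    case 0
    show ?case using dist_tri[OF xM xM xM, of 0 2 1] dist_tri[OF xM xM xM, of 0 1 2] step(2)[of 0] delta_nonneg dist_refl[OF xM, of 0]
      by (simp add: numeral_2_eq_2)
  next
    case (Suc n)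
    have "d (x 0) (x (Suc n)) + d (x n) (x (Suc (Suc n))) \<le>
       max (d (x 0) (x n) + d (x (Suc n)) (x (Suc (Suc n)))) (d (x 0) (x (Suc (Suc n))) + d (x n) (x (Suc n))) + 2 * \<delta>"
      using four_point[of "x 0" "x n" "x (Suc n)" "x (Suc (Suc n))"] xM dist_sym[OF xM xM]
      by (simp add: add.commute max.commute)
    then show ?case using Suc step(1)[of n] step(2)[of n] a
      by (auto simp: max_def split: if_splits)
  qed
  show ?thesis
  proof (induction n)
    case (Suc n) then show ?case using inc[of n] by (simp add: algebra_simps)
  qed (simp add: dist_refl xM)
qed

text \<open>Splitting the chain at its midpoint costs one \<open>\<delta>\<close>, so the loss is
  the number of halvings, logarithmic in the length. The hypothesis on
  \<open>gprod d p (z i) (z i)\<close> serves chains that have shrunk to a point.\<close>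

lemma gprod_chain:
  fixes z :: "int \<Rightarrow> 'a"
  assumes "p \<in> M" "\<And>i. i \<in> {s..t} \<Longrightarrow> z i \<in> M"
    "\<And>i. i \<in> {s..t} \<Longrightarrow> c \<le> gprod d p (z i) (z i)"
    "\<And>i. i \<in> {s..<t} \<Longrightarrow> c \<le> gprod d p (z i) (z (i+1))"
    "s \<le> t" "t - s \<le> 2 ^ m"
  shows "c - real m * \<delta> \<le> gprod d p (z s) (z t)"
  using assms(2-)
proof (induction m arbitrary: s t)
  case 0
  then consider "t = s" | "t = s + 1" by force
  then show ?case using 0 by cases auto
next
  case (Suc m)
  define u where "u = (s + t) div 2"
  have u: "s \<le> u" "u \<le> t" "u - s \<le> 2 ^ m" "t - u \<le> 2 ^ Suc m - 2 ^ m"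
    using Suc.prems(4,5) unfolding u_def by auto
  have 1: "c - real m * \<delta> \<le> gprod d p (z s) (z u)"
    by (rule Suc.IH) (use Suc.prems u in auto)
  have 2: "c - real m * \<delta> \<le> gprod d p (z u) (z t)"
    by (rule Suc.IH) (use Suc.prems u in auto)
  have "min (gprod d p (z s) (z u)) (gprod d p (z u) (z t)) - \<delta> \<le> gprod d p (z s) (z t)"
    using Suc.prems u assms(1) by (intro hyp) auto
  then show ?case using 1 2 by (auto simp: algebra_simps min_def split: if_splits)
qed

section \<open>Geodesics stay near quasi-geodesics\<close>

lemma gprod_trans3:
  assumes "x \<in> M" "y \<in> M" "z \<in> M" "v \<in> M" "w \<in> M"
    and "c \<le> gprod d w x y" "c \<le> gprod d w y z" "c \<le> gprod d w z v"
  shows "c - 2 * \<delta> \<le> gprod d w x v"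
  using hyp[of x y z w] hyp[of x z v w] assms delta_nonneg by (auto simp: min_def split: if_splits)

text \<open>At the point of the geodesic at distance \<open>gprod d x w y\<close> from
  \<open>x\<close>, both alternatives of the four-point inequality reduce to
  \<open>gprod d w x y\<close>. The 1 is the interpolation error.\<close>

lemma near_between:
  assumes "x \<in> M" "y \<in> M" "w \<in> M" "p \<in> M" "d x p + d p y = d x y" "\<bar>d x p - gprod d x w y\<bar> \<le> 1"
  shows "d w p \<le> gprod d w x y + 1 + 2 * \<delta>"
  using four_point[of w x p y] assms dist_sym[of w p] dist_sym[of x y] dist_sym[of w y] dist_sym[of x w] dist_sym[of p y]
    gprod_double[of d w x y] gprod_double[of d x w y]
  by linarith

lemma exists_near_between:
  assumes "x \<in> M" "y \<in> M" "w \<in> M"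
  obtains p where "p \<in> M" "d x p + d p y = d x y" "d w p \<le> gprod d w x y + 1 + 2 * \<delta>"
proof -
  have "0 \<le> gprod d x w y" "gprod d x w y \<le> d x y"
    using gprod_nonneg[of w y x] gprod_le[of y w x] gprod_commute[of w y x] assms by auto
  from interpolate[OF assms(1,2) this] obtain p where "p \<in> M" "d x p + d p y = d x y" "\<bar>d x p - gprod d x w y\<bar> \<le> 1"
    by blast
  then show ?thesis using that near_between assms by blast
qed

lemma between_points_both_sides:
  assumes "x \<in> M" "y \<in> M" "p \<in> M" "u \<in> M" "v \<in> M"
    and "d x p + d p y = d x y" "d x u + d u p = d x p" "d p v + d v y = d p y"
  shows "gprod d p u v \<le> 0"
  unfolding gprod_def
  using assms dist_tri[of x u v] dist_tri[of x v y] dist_sym[of u p] by simp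

text \<open>Consecutive points are at most \<open>L\<close> apart and at distance at least
  \<open>c\<close> from \<open>p\<close>, so their Gromov product at \<open>p\<close> is at least
  \<open>c - L\<close>; the rest is the logarithmic chain estimate, in whichever order
  \<open>s\<close> and \<open>t\<close> come.\<close>

lemma chain_along_qgeod:
  assumes yM: "\<And>j. j \<in> {i..k} \<Longrightarrow> y j \<in> M" and "qgeod_on d K C L {i..k} y"
    and "p \<in> M" and far: "\<And>j. j \<in> {i..k} \<Longrightarrow> c \<le> d p (y j)"
    and st: "s \<in> {i..k}" "t \<in> {i..k}" "\<bar>t - s\<bar> \<le> 2 ^ m" and L: "0 \<le> L"
  shows "c - L - real m * \<delta> \<le> gprod d p (y s) (y t)"
proof -
  have *: "c - L - real m * \<delta> \<le> gprod d p (y s) (y t)"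
    if st: "s \<in> {i..k}" "t \<in> {i..k}" "s \<le> t" "t - s \<le> 2 ^ m" for s t
  proof (rule gprod_chain)
    fix j assume "j \<in> {s..t}"
    then show "y j \<in> M" "c - L \<le> gprod d p (y j) (y j)"
      using yM far[of j] dist_refl[of "y j"] L st unfolding gprod_def by auto
  next
    fix j assume j: "j \<in> {s..<t}"
    then have "d (y j) (y (j+1)) \<le> L * \<bar>real_of_int (j - (j + 1))\<bar>"
      using assms(2) st unfolding qgeod_on_def by (meson atLeastAtMost_iff atLeastLessThan_iff order_trans less_imp_le zle_add1_eq_le add1_zle_eq)
    then have "d (y j) (y (j+1)) \<le> L" by simp
    then show "c - L \<le> gprod d p (y j) (y (j+1))"
      using far[of j] far[of "j+1"] j st L unfolding gprod_def by auto
  qed (use st assms in auto)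
  show ?thesis
  proof (cases "s \<le> t")
    case True then show ?thesis using * st by auto
  next
    case False
    then show ?thesis using *[of t s] st gprod_commute[of "y s" "y t" p] yM by auto
  qed
qed

text \<open>
  R is almost the largest distance from the geodesic to the quasi-geodesic, and p almost attains it.
  Go from p about 2R to each side along the geodesic and return to the quasi-geodesic: this joins the
  two points by a chain of at most \<open>2 ^ m\<close> steps that stays R - 1 away from p, whereas their Gromov
  product at p vanishes.
\<close>

lemma geodesic_near_qgeod_aux:
  assumes K: "1 \<le> K" and C: "0 \<le> C" and L: "0 \<le> L"
    and yM: "\<And>j. j \<in> {i..k} \<Longrightarrow> y j \<in> M" and qg: "qgeod_on d K C L {i..k} y" and "i \<le> k"
    and pM: "p \<in> M" and pb: "d (y i) p + d p (y k) = d (y i) (y k)"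
    and far: "\<And>j. j \<in> {i..k} \<Longrightarrow> R - 1 \<le> d p (y j)"
    and near: "\<And>q. q \<in> M \<Longrightarrow> d (y i) q + d q (y k) = d (y i) (y k) \<Longrightarrow> \<exists>j\<in>{i..k}. d q (y j) \<le> R"
    and m: "K * (6 * R + 2 + C) \<le> 2 ^ m"
  shows "R \<le> 1 + L + (real m + 2) * \<delta>"
proof -
  have ik: "y i \<in> M" "y k \<in> M" using yM \<open>i \<le> k\<close> by auto
  have R0: "0 \<le> R" using near[OF pM pb] dist_nonneg[OF pM yM] by force
  have "\<exists>u s. u \<in> M \<and> d (y i) u + d u p = d (y i) p \<and> d p u \<le> 2 * R + 1 \<and> s \<in> {i..k} \<and> d u (y s) \<le> R
      \<and> R - 1 \<le> gprod d p u (y s)"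
  proof (cases "d p (y i) \<le> 2 * R")
    case True
    then show ?thesis using ik \<open>i \<le> k\<close> far[of i] R0 dist_refl[OF ik(1)] dist_sym[of "y i" p] pM
      by (intro exI[of _ "y i"] exI[of _ i]) (auto simp: gprod_def)
  next
    case False
    \<comment> \<open>Going out \<open>2 * R\<close> makes the Gromov product with
      \<open>y s\<close> come out as \<open>R - 1\<close>: allowing for the interpolation error, it
      is at least half of \<open>(2 * R - 1) + (R - 1) - R\<close>.\<close>
    then obtain u where u: "u \<in> M" "d p u + d u (y i) = d p (y i)" "\<bar>d p u - 2 * R\<bar> \<le> 1"
      using interpolate[of p "y i" "2 * R"] pM ik R0 by force
    have ub: "d (y i) u + d u p = d (y i) p" using u dist_sym[of u p] dist_sym[of u "y i"] dist_sym[of p "y i"] ik pM by auto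
    have "d (y i) u + d u (y k) = d (y i) (y k)"
      using ub pb dist_tri[of u p "y k"] dist_tri[of "y i" u "y k"] u ik pM by auto
    then obtain s where "s \<in> {i..k}" "d u (y s) \<le> R" using near u by blast
    then show ?thesis using u ub far[of s]
      by (intro exI[of _ u] exI[of _ s]) (auto simp: gprod_def)
  qed
  then obtain u s where u: "u \<in> M" "d (y i) u + d u p = d (y i) p" "d p u \<le> 2 * R + 1" "s \<in> {i..k}" "d u (y s) \<le> R"
      "R - 1 \<le> gprod d p u (y s)" by blast
  have "\<exists>v t. v \<in> M \<and> d p v + d v (y k) = d p (y k) \<and> d p v \<le> 2 * R + 1 \<and> t \<in> {i..k} \<and> d v (y t) \<le> R
      \<and> R - 1 \<le> gprod d p v (y t)"
  proof (cases "d p (y k) \<le> 2 * R")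
    case True
    then show ?thesis using ik \<open>i \<le> k\<close> far[of k] R0 dist_refl[OF ik(2)] pM
      by (intro exI[of _ "y k"] exI[of _ k]) (auto simp: gprod_def)
  next
    case False
    then obtain v where v: "v \<in> M" "d p v + d v (y k) = d p (y k)" "\<bar>d p v - 2 * R\<bar> \<le> 1"
      using interpolate[of p "y k" "2 * R"] pM ik R0 by force
    have "d (y i) v + d v (y k) = d (y i) (y k)"
      using v pb dist_tri[of "y i" p v] dist_tri[of "y i" v "y k"] ik pM by auto
    then obtain t where "t \<in> {i..k}" "d v (y t) \<le> R" using near v by blast
    then show ?thesis using v far[of t]
      by (intro exI[of _ v] exI[of _ t]) (auto simp: gprod_def)
  qed
  then obtain v t where v: "v \<in> M" "d p v + d v (y k) = d p (y k)" "d p v \<le> 2 * R + 1" "t \<in> {i..k}" "d v (y t) \<le> R"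
      "R - 1 \<le> gprod d p v (y t)" by blast
  have st: "y s \<in> M" "y t \<in> M" using u v yM by auto
  \<comment> \<open>Four legs: \<open>R\<close> from \<open>y s\<close> to \<open>u\<close>, twice
    \<open>2 * R + 1\<close> through \<open>p\<close>, and \<open>R\<close> from \<open>v\<close> to
    \<open>y t\<close>.\<close>
  have "d (y s) (y t) \<le> 6 * R + 2"
    using dist_tri[of "y s" u "y t"] dist_tri[of u v "y t"] dist_tri[of u p v] u v st pM dist_sym[of "y s" u] dist_sym[of u p]
    by auto
  moreover have "\<bar>real_of_int (s - t)\<bar> / K - C \<le> d (y s) (y t)" using qg u v unfolding qgeod_on_def by blast
  ultimately have "\<bar>real_of_int (s - t)\<bar> / K \<le> 6 * R + 2 + C" by linarith
  then have "\<bar>real_of_int (s - t)\<bar> \<le> K * (6 * R + 2 + C)" using K by (simp add: divide_le_eq mult.commute)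
  then have "real_of_int \<bar>t - s\<bar> \<le> real_of_int (2 ^ m)" using m by simp
  then have "\<bar>t - s\<bar> \<le> 2 ^ m" by linarith
  from chain_along_qgeod[OF yM qg pM far u(4) v(4) this L]
  have "R - 1 - L - real m * \<delta> \<le> gprod d p (y s) (y t)" .
  moreover have le_L: "R - 1 - L - real m * \<delta> \<le> R - 1"
    using L mult_nonneg_nonneg[OF of_nat_0_le_iff delta_nonneg, of m] by linarith
  ultimately have "R - 1 - L - real m * \<delta> - 2 * \<delta> \<le> gprod d p u v"
    using u v st pM gprod_commute[of v "y t" p] le_L
    by (intro gprod_trans3[of u "y s" "y t" v p]) (auto intro: order_trans[OF le_L])
  moreover have "gprod d p u v \<le> 0"
    using between_points_both_sides[of "y i" "y k" p u v] ik pM u v pb by auto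
  ultimately show ?thesis by (simp add: algebra_simps)
qed

text \<open>With \<open>2 ^ m\<close> just above \<open>K * (6 * R + 2 + C)\<close>, the auxiliary
  bound says that \<open>R\<close> is at most a constant plus \<open>\<delta>\<close> times a
  logarithm of \<open>R\<close>. If the least such \<open>m\<close> exceeded \<open>m0\<close>, then
  \<open>2 ^ (m - 1)\<close> would already be large enough, against minimality; so \<open>R\<close>
  is at most the value \<open>D\<close> of the bound at \<open>m0\<close>.\<close>

lemma geodesic_near_qgeod:
  assumes K: "1 \<le> K" and C: "0 \<le> C" and L: "0 \<le> L"
  obtains D where "0 \<le> D"
    "\<And>i k y p. i \<le> k \<Longrightarrow> (\<And>j. j \<in> {i..k} \<Longrightarrow> y j \<in> M) \<Longrightarrow> qgeod_on d K C L {i..k} y \<Longrightarrow> p \<in> M \<Longrightarrow>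
        d (y i) p + d p (y k) = d (y i) (y k) \<Longrightarrow> \<exists>j\<in>{i..k}. d p (y j) \<le> D"
proof -
  \<comment> \<open>The \<open>3 * \<delta>\<close> is there because the auxiliary bound
    \<open>(m + 2) * \<delta>\<close> will be used with an exponent one larger than the
    \<open>m\<close> bound here.\<close>
  obtain m0 where m0: "\<And>m. m \<ge> m0 \<Longrightarrow>
      K * (6 * (1 + L + 3 * \<delta>) + 2 + C) + K * 6 * \<delta> * real m \<le> 2 ^ m"
    using exponential_beats_linear by blast
  define D where "D = 1 + L + (real m0 + 2) * \<delta>"
  have D0: "0 \<le> D" unfolding D_def using L delta_nonneg by simp
  show ?thesis
  proof (rule that[OF D0])
    fix i k :: int and y p
    assume ik: "i \<le> k" and yM: "\<And>j. j \<in> {i..k} \<Longrightarrow> y j \<in> M" and qg: "qgeod_on d K C L {i..k} y"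
      and pM: "p \<in> M" and pb: "d (y i) p + d p (y k) = d (y i) (y k)"
    define B where "B = {q \<in> M. d (y i) q + d q (y k) = d (y i) (y k)}"
    define r where "r q = Min ((\<lambda>j. d q (y j)) ` {i..k})" for q
    define R where "R = Sup (r ` B)"
    have r_le: "r q \<le> d q (y j)" if "j \<in> {i..k}" for q j
      unfolding r_def using that by (intro Min_le) auto
    have r_ex: "\<exists>j\<in>{i..k}. r q = d q (y j)" for q
    proof -
      have "r q \<in> (\<lambda>j. d q (y j)) ` {i..k}" unfolding r_def by (rule Min_in) (use ik in auto)
      then show ?thesis by auto
    qed
    have bdd: "bdd_above (r ` B)"
    proof (rule bdd_aboveI2)
      fix q assume "q \<in> B"
      then show "r q \<le> d (y i) (y k)"
        using r_le[of k q] dist_nonneg[of "y i" q] yM[of i] ik unfolding B_def by auto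
    qed
    have pB: "p \<in> B" using pM pb unfolding B_def by simp
    have upper: "r q \<le> R" if "q \<in> B" for q unfolding R_def using that bdd by (rule cSUP_upper)
    have "\<exists>z\<in>r ` B. R - 1 < z" unfolding R_def
      by (subst less_cSup_iff[symmetric]) (use pB bdd in auto)
    then obtain q where q: "q \<in> B" "R - 1 < r q" by auto
    have near: "\<exists>j\<in>{i..k}. d q (y j) \<le> R" if "q \<in> B" for q using r_ex[of q] upper[OF that] by auto
    have bound: "R \<le> 1 + L + (real m + 2) * \<delta>" if "K * (6 * R + 2 + C) \<le> 2 ^ m" for m
      by (rule geodesic_near_qgeod_aux[OF K C L yM qg ik, where p = q])
        (use q near that r_le in \<open>auto simp: B_def intro: order_trans[OF less_imp_le]\<close>)
    obtain m1 :: nat where "K * (6 * R + 2 + C) < 2 ^ m1" using real_arch_pow[of 2] by auto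
    then have ex: "K * (6 * R + 2 + C) \<le> 2 ^ m1" by simp
    define m where "m = (LEAST m. K * (6 * R + 2 + C) \<le> 2 ^ m)"
    have m: "K * (6 * R + 2 + C) \<le> 2 ^ m" unfolding m_def using ex by (rule LeastI)
    have "R \<le> D"
    proof (cases "m \<le> m0")
      case True
      then have "(real m + 2) * \<delta> \<le> (real m0 + 2) * \<delta>"
        using delta_nonneg by (intro mult_right_mono) auto
      then show ?thesis using bound[OF m] unfolding D_def by linarith
    next
      case False
      then obtain m' where m': "m = Suc m'" "m' \<ge> m0" by (cases m) auto
      have "\<not> K * (6 * R + 2 + C) \<le> 2 ^ m'" using m' not_less_Least[of m' "\<lambda>m. K * (6 * R + 2 + C) \<le> 2 ^ m"] unfolding m_def by auto
      moreover have "K * (6 * (1 + L + (real m + 2) * \<delta>) + 2 + C) \<le> 2 ^ m'"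
        using m0[OF m'(2)] m'(1) by (simp add: algebra_simps)
      moreover have "K * (6 * R + 2 + C) \<le> K * (6 * (1 + L + (real m + 2) * \<delta>) + 2 + C)"
        using bound[OF m] K by (intro mult_left_mono) auto
      ultimately show ?thesis by linarith
    qed
    then show "\<exists>j\<in>{i..k}. d p (y j) \<le> D" using near[OF pB] by force
  qed
qed

text \<open>Let \<open>T\<close> be the Gromov product at \<open>p = y j\<close>. The points
  \<open>u\<close>, \<open>v\<close> at distance about \<open>T\<close> from \<open>p\<close> on
  geodesics to the two ends are close together, and each is close to a point of the quasi-geodesic
  on its own side of \<open>j\<close>. Hence \<open>y s\<close> and \<open>y t\<close> are close, so
  are the indices \<open>s\<close> and \<open>t\<close>, and \<open>j\<close> lies between these; so
  \<open>p\<close> is close to \<open>y s\<close>, thus to \<open>u\<close>, and \<open>T\<close> is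
  bounded.\<close>

lemma qgeod_gprod_bounded:
  assumes K: "1 \<le> K" and C: "0 \<le> C" and L: "0 \<le> L"
  obtains D where "0 \<le> D"
    "\<And>i j k y. i \<le> j \<Longrightarrow> j \<le> k \<Longrightarrow> (\<And>m. m \<in> {i..k} \<Longrightarrow> y m \<in> M) \<Longrightarrow> qgeod_on d K C L {i..k} y \<Longrightarrow>
       gprod d (y j) (y i) (y k) \<le> D"
proof -
  obtain D1 where D1: "0 \<le> D1"
    "\<And>i k y p. i \<le> k \<Longrightarrow> (\<And>j. j \<in> {i..k} \<Longrightarrow> y j \<in> M) \<Longrightarrow> qgeod_on d K C L {i..k} y \<Longrightarrow> p \<in> M \<Longrightarrow>
        d (y i) p + d p (y k) = d (y i) (y k) \<Longrightarrow> \<exists>j\<in>{i..k}. d p (y j) \<le> D1"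
    using geodesic_near_qgeod[OF K C L] by metis
  define D where "D = 1 + D1 + L * (K * (2 * D1 + 4 + 4 * \<delta> + C))"
  have "0 \<le> D" unfolding D_def using D1 L K C delta_nonneg by simp
  then show ?thesis
  proof (rule that)
    fix i j k :: int and y
    assume ij: "i \<le> j" and jk: "j \<le> k" and yM: "\<And>m. m \<in> {i..k} \<Longrightarrow> y m \<in> M" and qg: "qgeod_on d K C L {i..k} y"
    define p where "p = y j"
    define T where "T = gprod d p (y i) (y k)"
    have M: "y i \<in> M" "y k \<in> M" "p \<in> M" using yM ij jk unfolding p_def by auto
    have T: "0 \<le> T" "T \<le> d p (y i)" "T \<le> d p (y k)"
      using gprod_nonneg[OF M] gprod_le[OF M] gprod_le[of "y k" "y i" p] gprod_commute[of "y i" "y k" p] M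
      unfolding T_def by auto
    obtain u where u: "u \<in> M" "d p u + d u (y i) = d p (y i)" "\<bar>d p u - T\<bar> \<le> 1"
      using interpolate[OF M(3,1) T(1,2)] by blast
    obtain v where v: "v \<in> M" "d p v + d v (y k) = d p (y k)" "\<bar>d p v - T\<bar> \<le> 1"
      using interpolate[OF M(3,2) T(1,3)] by blast
    have "T - 1 - 2 * \<delta> \<le> gprod d p u v"
    proof (rule gprod_trans3)
      show "T - 1 \<le> gprod d p u (y i)" using u unfolding gprod_def by auto
      show "T - 1 \<le> gprod d p (y k) v" using v dist_sym[of v "y k"] M unfolding gprod_def by auto
      show "T - 1 \<le> gprod d p (y i) (y k)" unfolding T_def by simp
    qed (use M u v in auto)
    \<comment> \<open>Both \<open>d p u\<close> and \<open>d p v\<close> are at most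
      \<open>T + 1\<close>, so \<open>d u v\<close> is at most
      \<open>2 * (T + 1) - 2 * (T - 1 - 2 * \<delta>)\<close>.\<close>
    then have uv: "d u v \<le> 4 + 4 * \<delta>" using u v unfolding gprod_def by auto
    have "\<exists>s\<in>{i..j}. d u (y s) \<le> D1"
    proof (rule D1(2))
      show "d (y i) u + d u (y j) = d (y i) (y j)"
        using u dist_sym[of u p] dist_sym[of u "y i"] dist_sym[of p "y i"] M unfolding p_def by auto
    qed (use ij jk yM u qg in \<open>auto intro: qgeod_on_subset\<close>)
    then obtain s where s: "s \<in> {i..j}" "d u (y s) \<le> D1" by blast
    have "\<exists>t\<in>{j..k}. d v (y t) \<le> D1"
    proof (rule D1(2))
      show "d (y j) v + d v (y k) = d (y j) (y k)"
        using v unfolding p_def by auto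
    qed (use ij jk yM v qg in \<open>auto intro: qgeod_on_subset\<close>)
    then obtain t where t: "t \<in> {j..k}" "d v (y t) \<le> D1" by blast
    have stM: "y s \<in> M" "y t \<in> M" using s t yM ij jk by auto
    have "d (y s) (y t) \<le> 2 * D1 + 4 + 4 * \<delta>"
      using dist_tri[of "y s" u "y t"] dist_tri[of u v "y t"] dist_sym[of u "y s"] uv s t u v stM by auto
    moreover have "\<bar>real_of_int (s - t)\<bar> / K - C \<le> d (y s) (y t)"
      using qg s t ij jk unfolding qgeod_on_def by (meson atLeastAtMost_iff order_trans)
    ultimately have "\<bar>real_of_int (s - t)\<bar> / K \<le> 2 * D1 + 4 + 4 * \<delta> + C" by linarith
    then have st: "\<bar>real_of_int (s - t)\<bar> \<le> K * (2 * D1 + 4 + 4 * \<delta> + C)"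
      using K by (simp add: divide_le_eq mult.commute)
    have "\<bar>real_of_int (j - s)\<bar> \<le> \<bar>real_of_int (s - t)\<bar>" using s t by auto
    then have js: "\<bar>real_of_int (j - s)\<bar> \<le> K * (2 * D1 + 4 + 4 * \<delta> + C)" using st by linarith
    have "d p (y s) \<le> L * \<bar>real_of_int (j - s)\<bar>"
      using qg s ij jk unfolding qgeod_on_def p_def by (meson atLeastAtMost_iff order_trans)
    also have "\<dots> \<le> L * (K * (2 * D1 + 4 + 4 * \<delta> + C))" using js L by (rule mult_left_mono)
    finally have "d p u \<le> L * (K * (2 * D1 + 4 + 4 * \<delta> + C)) + D1"
      using dist_tri[of p "y s" u] s dist_sym[of u "y s"] u stM M by auto
    then show "gprod d (y j) (y i) (y k) \<le> D" using u unfolding D_def T_def p_def by auto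
  qed
qed

end

section \<open>Word metrics and hyperbolic groups\<close>

locale fin_gen_group = group \<Gamma> for \<Gamma> :: "('g, 'b) monoid_scheme" (structure) +
  fixes S :: "'g set"
  assumes finite_S: "finite S" and S_sub: "S \<subseteq> carrier \<Gamma>" and gen_S: "generate \<Gamma> S = carrier \<Gamma>"
begin

abbreviation letters :: "'g set" where "letters \<equiv> S \<union> (\<lambda>s. inv s) ` S"
abbreviation wprod :: "'g list \<Rightarrow> 'g" where "wprod ws \<equiv> foldr (\<otimes>) ws \<one>"
abbreviation len :: "'g \<Rightarrow> nat" where "len \<equiv> word_len \<Gamma> S"
abbreviation dS :: "'g \<Rightarrow> 'g \<Rightarrow> real" where "dS \<equiv> word_dist \<Gamma> S"

lemma letters_closed: "letters \<subseteq> carrier \<Gamma>"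
  using S_sub by auto

lemma letters_inv: "s \<in> letters \<Longrightarrow> inv s \<in> letters"
  using S_sub by auto

lemma wprod_closed: "set ws \<subseteq> letters \<Longrightarrow> wprod ws \<in> carrier \<Gamma>"
  using letters_closed by (induction ws) auto

lemma wprod_append:
  "set us \<subseteq> letters \<Longrightarrow> set vs \<subseteq> letters \<Longrightarrow> wprod (us @ vs) = wprod us \<otimes> wprod vs"
proof (induction us)
  case (Cons a us)
  then show ?case using wprod_closed[of us] wprod_closed[of vs] letters_closed by (auto simp: m_assoc)
qed (auto simp: wprod_closed)

lemma wprod_inv:
  "set us \<subseteq> letters \<Longrightarrow> \<exists>vs. set vs \<subseteq> letters \<and> length vs = length us \<and> wprod vs = inv (wprod us)"
proof (induction us)
  case (Cons a us)
  then obtain vs where vs: "set vs \<subseteq> letters" "length vs = length us" "wprod vs = inv (wprod us)" by auto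
  have a: "a \<in> carrier \<Gamma>" "inv a \<in> letters" using Cons.prems letters_closed letters_inv[of a] by auto
  have "wprod (vs @ [inv a]) = inv (wprod (a # us))"
    using wprod_append[OF vs(1), of "[inv a]"] a vs wprod_closed[of us] Cons.prems
    by (auto simp: inv_mult_group)
  then show ?case using vs a by (intro exI[of _ "vs @ [inv a]"]) auto
qed auto

lemma exists_word: "g \<in> carrier \<Gamma> \<Longrightarrow> \<exists>ws. set ws \<subseteq> letters \<and> wprod ws = g"
  unfolding gen_S[symmetric]
proof (induction rule: generate.induct)
  case one
  show ?case by (rule exI[of _ "[]"]) auto
next
  case (incl h)
  then show ?case using S_sub by (intro exI[of _ "[h]"]) auto
next
  case (inv h)
  then show ?case using S_sub by (intro exI[of _ "[inv h]"]) auto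
next
  case (eng h1 h2)
  then obtain us vs where "set us \<subseteq> letters" "wprod us = h1" "set vs \<subseteq> letters" "wprod vs = h2" by blast
  then show ?case using wprod_append[of us vs] by (intro exI[of _ "us @ vs"]) auto
qed

lemma shortest_word:
  assumes "g \<in> carrier \<Gamma>"
  obtains ws where "set ws \<subseteq> letters" "length ws = len g" "wprod ws = g"
proof -
  have "\<exists>n ws. length ws = n \<and> set ws \<subseteq> letters \<and> wprod ws = g" using exists_word[OF assms] by auto
  from LeastI_ex[OF this] show ?thesis using that unfolding word_len_def by blast
qed

lemma len_wprod_le: "set ws \<subseteq> letters \<Longrightarrow> len (wprod ws) \<le> length ws"
  unfolding word_len_def by (rule Least_le) auto

lemma len_one: "len \<one> = 0"
  using len_wprod_le[of "[]"] by simp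

lemma len_letter: "s \<in> letters \<Longrightarrow> len s \<le> 1"
  using len_wprod_le[of "[s]"] letters_closed by auto

lemma len_mult: "g \<in> carrier \<Gamma> \<Longrightarrow> h \<in> carrier \<Gamma> \<Longrightarrow> len (g \<otimes> h) \<le> len g + len h"
  by (metis shortest_word wprod_append len_wprod_le length_append set_append Un_least)

lemma len_inv: "g \<in> carrier \<Gamma> \<Longrightarrow> len (inv g) = len g"
proof -
  have *: "len (inv g) \<le> len g" if "g \<in> carrier \<Gamma>" for g
    using that by (metis shortest_word wprod_inv len_wprod_le)
  show "g \<in> carrier \<Gamma> \<Longrightarrow> len (inv g) = len g" using *[of g] *[of "inv g"] by simp
qed

lemma mult_inv_cancel:
  assumes "x \<in> carrier \<Gamma>" "y \<in> carrier \<Gamma>"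
  shows "x \<otimes> (inv x \<otimes> y) = y" "inv x \<otimes> (x \<otimes> y) = y"
  using assms by (simp_all add: m_assoc[symmetric])

lemma dS_eq: "dS g h = real (len (inv g \<otimes> h))"
  unfolding word_dist_def ..

lemma dS_refl: "g \<in> carrier \<Gamma> \<Longrightarrow> dS g g = 0"
  by (simp add: dS_eq len_one)

lemma dS_one: "g \<in> carrier \<Gamma> \<Longrightarrow> dS \<one> g = real (len g)"
  by (simp add: dS_eq)

lemma dS_sym: "g \<in> carrier \<Gamma> \<Longrightarrow> h \<in> carrier \<Gamma> \<Longrightarrow> dS g h = dS h g"
  using len_inv[of "inv g \<otimes> h"] by (simp add: dS_eq inv_mult_group)

lemma dS_tri:
  assumes "x \<in> carrier \<Gamma>" "y \<in> carrier \<Gamma>" "z \<in> carrier \<Gamma>"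
  shows "dS x z \<le> dS x y + dS y z"
proof -
  have "inv x \<otimes> z = (inv x \<otimes> y) \<otimes> (inv y \<otimes> z)"
    using assms by (simp add: m_assoc mult_inv_cancel)
  then show ?thesis using len_mult[of "inv x \<otimes> y" "inv y \<otimes> z"] assms unfolding dS_eq by auto
qed

lemma dS_left_mult:
  assumes "x \<in> carrier \<Gamma>" "y \<in> carrier \<Gamma>" "g \<in> carrier \<Gamma>"
  shows "dS (g \<otimes> x) (g \<otimes> y) = dS x y"
proof -
  have "inv (g \<otimes> x) \<otimes> (g \<otimes> y) = inv x \<otimes> y"
    using assms by (simp add: inv_mult_group m_assoc mult_inv_cancel)
  then show ?thesis using assms unfolding dS_eq by simp
qed

lemma dS_nonneg: "0 \<le> dS g h"
  unfolding dS_eq by simp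

lemma finite_ball: "finite {g \<in> carrier \<Gamma>. len g \<le> n}"
proof (rule finite_subset)
  show "{g \<in> carrier \<Gamma>. len g \<le> n} \<subseteq> wprod ` {ws. set ws \<subseteq> letters \<and> length ws \<le> n}"
    by (smt (verit, ccfv_SIG) image_iff mem_Collect_eq shortest_word subsetI)
  show "finite (wprod ` {ws. set ws \<subseteq> letters \<and> length ws \<le> n})"
    using finite_S by (intro finite_imageI finite_lists_length_le) auto
qed

lemma finite_dS_ball:
  assumes "x \<in> carrier \<Gamma>"
  shows "finite {g \<in> carrier \<Gamma>. dS x g \<le> r}"
proof (rule finite_subset)
  show "{g \<in> carrier \<Gamma>. dS x g \<le> r} \<subseteq> (\<lambda>h. x \<otimes> h) ` {g \<in> carrier \<Gamma>. len g \<le> nat \<lceil>r\<rceil>}"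
  proof
    fix g assume g: "g \<in> {g \<in> carrier \<Gamma>. dS x g \<le> r}"
    then have "g = x \<otimes> (inv x \<otimes> g)" using assms by (simp add: m_assoc[symmetric])
    moreover have "len (inv x \<otimes> g) \<le> nat \<lceil>r\<rceil>" using g unfolding dS_eq by simp linarith
    ultimately show "g \<in> (\<lambda>h. x \<otimes> h) ` {g \<in> carrier \<Gamma>. len g \<le> nat \<lceil>r\<rceil>}" using g assms by blast
  qed
qed (simp add: finite_ball)

text \<open>The path runs through the prefixes of a shortest word. Subwords bound the distances from
  above, and since the bounds for three consecutive pieces add up to the distance of the ends, all
  are equalities. Beyond \<open>N\<close> the path stays at \<open>y\<close>.\<close>

lemma exists_geodesic:
  assumes "x \<in> carrier \<Gamma>" "y \<in> carrier \<Gamma>"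
  obtains c :: "nat \<Rightarrow> 'g" and N where "real N = dS x y" "c 0 = x" "c N = y" "\<And>i. c i \<in> carrier \<Gamma>"
    "\<And>i j. i \<le> N \<Longrightarrow> j \<le> N \<Longrightarrow> dS (c i) (c j) = \<bar>real i - real j\<bar>"
proof -
  obtain ws where ws: "set ws \<subseteq> letters" "length ws = len (inv x \<otimes> y)" "wprod ws = inv x \<otimes> y"
    using shortest_word[of "inv x \<otimes> y"] assms by auto
  define N where "N = length ws"
  define c where "c i = x \<otimes> wprod (take i ws)" for i
  have sub: "set (take i ws) \<subseteq> letters" "set (drop i ws) \<subseteq> letters" for i
    using ws(1) set_take_subset[of i ws] set_drop_subset[of i ws] by blast+
  have N: "real N = dS x y" unfolding N_def dS_eq ws ..
  have c0: "c 0 = x" unfolding c_def using assms by simp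
  have cN: "c N = y" unfolding c_def N_def using ws assms by (simp add: m_assoc[symmetric])
  have cc: "c i \<in> carrier \<Gamma>" for i unfolding c_def using assms wprod_closed[OF sub(1)] by simp
  have le: "dS (c i) (c j) \<le> real j - real i" if "i \<le> j" "j \<le> N" for i j
  proof -
    have "take j ws = take i ws @ take (j - i) (drop i ws)"
      using that by (metis take_add le_add_diff_inverse)
    moreover have s: "set (take (j - i) (drop i ws)) \<subseteq> letters"
      using sub(2)[of i] set_take_subset[of "j-i" "drop i ws"] by blast
    ultimately have "wprod (take j ws) = wprod (take i ws) \<otimes> wprod (take (j - i) (drop i ws))"
      using wprod_append sub(1) by metis
    then have "c j = c i \<otimes> wprod (take (j - i) (drop i ws))"
      unfolding c_def using assms wprod_closed[OF s] wprod_closed[OF sub(1)] by (simp add: m_assoc)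
    then have "inv (c i) \<otimes> c j = wprod (take (j - i) (drop i ws))"
      using cc[of i] wprod_closed[OF s] by (simp add: m_assoc[symmetric])
    then have "dS (c i) (c j) \<le> real (length (take (j - i) (drop i ws)))"
      unfolding dS_eq using len_wprod_le[OF s] by simp
    also have "\<dots> = real j - real i" using that unfolding N_def by simp
    finally show ?thesis .
  qed
  have eq: "dS (c i) (c j) = real j - real i" if "i \<le> j" "j \<le> N" for i j
    using le[OF that] le[of 0 i] le[of j N] dS_tri[of "c 0" "c i" "c N"] dS_tri[of "c i" "c j" "c N"] cc that N c0 cN
    by auto
  have "dS (c i) (c j) = \<bar>real i - real j\<bar>" if "i \<le> N" "j \<le> N" for i j
    using eq[of i j] eq[of j i] that dS_sym[OF cc cc, of i j] by (cases "i \<le> j") auto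
  then show ?thesis using that N c0 cN cc by blast
qed

lemma dS_interpolate:
  assumes "x \<in> carrier \<Gamma>" "y \<in> carrier \<Gamma>" "0 \<le> t" "t \<le> dS x y"
  shows "\<exists>z\<in>carrier \<Gamma>. dS x z + dS z y = dS x y \<and> \<bar>dS x z - t\<bar> \<le> 1"
proof -
  obtain c N where c: "real N = dS x y" "c 0 = x" "c N = y" "\<And>i. c i \<in> carrier \<Gamma>"
    "\<And>i j. i \<le> N \<Longrightarrow> j \<le> N \<Longrightarrow> dS (c i) (c j) = \<bar>real i - real j\<bar>"
    using exists_geodesic[OF assms(1,2)] by metis
  define m where "m = nat \<lfloor>t\<rfloor>"
  have m: "m \<le> N" "\<bar>real m - t\<bar> \<le> 1" using assms c(1) unfolding m_def by linarith+
  show ?thesis using c(5)[of 0 m] c(5)[of m N] c m by (intro bexI[of _ "c m"]) auto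
qed

lemma transl_len_le:
  assumes "b \<in> carrier \<Gamma>" "g \<in> carrier \<Gamma>"
  shows "transl_len \<Gamma> S b \<le> dS g (b \<otimes> g)"
  unfolding transl_len_def
  by (intro cINF_lower assms bdd_belowI2[of _ 0]) (simp add: dS_nonneg)

text \<open>Word lengths are natural numbers, so the infimum is a minimum; a vertex of least
  displacement is the starting point for the escape of powers.\<close>

lemma transl_len_attained:
  assumes "b \<in> carrier \<Gamma>"
  obtains g where "g \<in> carrier \<Gamma>" "transl_len \<Gamma> S b = dS g (b \<otimes> g)"
proof -
  define k where "k g = len (inv g \<otimes> (b \<otimes> g))" for g
  obtain g where g: "g \<in> carrier \<Gamma>" "\<And>h. h \<in> carrier \<Gamma> \<Longrightarrow> k g \<le> k h"
    using ex_has_least_nat[of "\<lambda>g. g \<in> carrier \<Gamma>" \<one> k] by auto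
  have "dS g (b \<otimes> g) \<le> transl_len \<Gamma> S b"
    unfolding transl_len_def using g by (intro cINF_greatest) (auto simp: dS_eq k_def)
  then show ?thesis using that g transl_len_le[OF assms g(1)] by force
qed

lemma hom_lipschitz:
  assumes "\<psi> \<in> hom \<Gamma> \<Gamma>"
  obtains L where "1 \<le> L" "\<And>g h. g \<in> carrier \<Gamma> \<Longrightarrow> h \<in> carrier \<Gamma> \<Longrightarrow> dS (\<psi> g) (\<psi> h) \<le> L * dS g h"
proof -
  define L where "L = real (Max (insert 1 ((\<lambda>s. len (\<psi> s)) ` letters)))"
  have fin: "finite (insert 1 ((\<lambda>s. len (\<psi> s)) ` letters))" using finite_S by simp
  have L1: "1 \<le> L" unfolding L_def using Max_ge[OF fin, of 1] by simp
  have L: "real (len (\<psi> s)) \<le> L" if "s \<in> letters" for s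
    unfolding L_def using that by (intro of_nat_mono Max_ge[OF fin]) blast
  have \<psi>c: "\<psi> g \<in> carrier \<Gamma>" if "g \<in> carrier \<Gamma>" for g using assms that by (auto simp: hom_def)
  interpret h: group_hom \<Gamma> \<Gamma> \<psi> using assms by (simp add: group_hom_def group_hom_axioms_def is_group)
  have w: "real (len (\<psi> (wprod ws))) \<le> L * real (length ws)" if "set ws \<subseteq> letters" for ws
    using that
  proof (induction ws)
    case (Cons a ws)
    have "len (\<psi> (wprod (a # ws))) \<le> len (\<psi> a) + len (\<psi> (wprod ws))"
      using Cons.prems letters_closed wprod_closed[of ws] len_mult[of "\<psi> a" "\<psi> (wprod ws)"] \<psi>c by auto
    then have "real (len (\<psi> (wprod (a # ws)))) \<le> real (len (\<psi> a)) + real (len (\<psi> (wprod ws)))" by linarith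
    also have "\<dots> \<le> L + L * real (length ws)"
      using Cons L[of a] by (intro add_mono) auto
    finally show ?case by (simp add: algebra_simps)
  qed (simp add: len_one)
  have "dS (\<psi> g) (\<psi> h) \<le> L * dS g h" if "g \<in> carrier \<Gamma>" "h \<in> carrier \<Gamma>" for g h
  proof -
    have "inv g \<otimes> h \<in> carrier \<Gamma>" using that by simp
    then obtain ws where ws: "set ws \<subseteq> letters" "length ws = len (inv g \<otimes> h)" "wprod ws = inv g \<otimes> h"
      by (rule shortest_word)
    have "\<psi> (inv g \<otimes> h) = inv (\<psi> g) \<otimes> \<psi> h" using that by simp
    then show ?thesis using w[OF ws(1)] ws unfolding dS_eq by simp
  qed
  then show ?thesis using that L1 by blast
qed

end

section \<open>Hyperbolic groups and the growth of powers\<close>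

locale hyp_group = fin_gen_group \<Gamma> S for \<Gamma> :: "('g, 'b) monoid_scheme" (structure) and S +
  fixes \<delta> :: real
  assumes \<delta>_nonneg: "0 \<le> \<delta>"
    and hyp_dS: "x \<in> carrier \<Gamma> \<Longrightarrow> y \<in> carrier \<Gamma> \<Longrightarrow> z \<in> carrier \<Gamma> \<Longrightarrow> w \<in> carrier \<Gamma> \<Longrightarrow>
      min (gprod dS w x y) (gprod dS w y z) - \<delta> \<le> gprod dS w x z"

sublocale hyp_group \<subseteq> gromov_space "carrier \<Gamma>" "word_dist \<Gamma> S" \<delta>
  by unfold_locales (auto intro: dS_sym dS_refl dS_tri \<delta>_nonneg hyp_dS dS_interpolate)

context hyp_group
begin

text \<open>
  For g realising the translation length, the Gromov product of g and \<open>b\<^sup>2g\<close> at \<open>bg\<close> is small: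
  otherwise b would move the midpoint m of g and \<open>bg\<close> by less than it moves g.
\<close>

lemma powers_escape:
  assumes b: "b \<in> carrier \<Gamma>" and large: "6 * \<delta> + 3 < transl_len \<Gamma> S b"
  obtains B where "\<And>n::nat. (transl_len \<Gamma> S b - (6 * \<delta> + 3)) * real n - B \<le> dS \<one> (b [^] n)"
proof -
  define l where "l = transl_len \<Gamma> S b"
  obtain g where g: "g \<in> carrier \<Gamma>" "l = dS g (b \<otimes> g)" using transl_len_attained[OF b] unfolding l_def by metis
  define x where "x n = b [^] n \<otimes> g" for n :: nat
  have xc: "x n \<in> carrier \<Gamma>" for n unfolding x_def using b g by simp
  have bx: "b \<otimes> x n = x (Suc n)" for n
    unfolding x_def using b g by (metis m_assoc nat_pow_Suc2 nat_pow_closed)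
  have x1: "dS (x n) (x (Suc n)) = l" for n
    unfolding x_def using dS_left_mult[of g "b \<otimes> g" "b [^] n"] b g by (simp add: m_assoc)
  have x2: "2 * l - 4 * \<delta> - 3 \<le> dS (x n) (x (n + 2))" for n
  proof -
    let ?y = "x (Suc n)" and ?z = "x (Suc (Suc n))"
    have l0: "0 \<le> l / 2" "l / 2 \<le> dS ?y (x n)" using x1[of n] dS_nonneg dS_sym[OF xc xc, of n "Suc n"] by (auto simp: l_def[symmetric])
    obtain m where m: "m \<in> carrier \<Gamma>" "dS ?y m + dS m (x n) = dS ?y (x n)" "\<bar>dS ?y m - l / 2\<bar> \<le> 1"
      using dS_interpolate[OF xc xc l0] by blast
    have bm: "b \<otimes> m \<in> carrier \<Gamma>" using b m by simp
    have e1: "dS ?z (b \<otimes> m) = dS ?y m" "dS (b \<otimes> m) ?y = dS m (x n)"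
      unfolding bx[symmetric, of "Suc n"] using dS_left_mult[OF xc m(1) b] bx[of n] dS_left_mult[OF m(1) xc b, of n]
      by simp_all
    have far: "l \<le> dS m (b \<otimes> m)" unfolding l_def by (rule transl_len_le[OF b m(1)])
    define T where "T = gprod dS ?y (x n) ?z"
    have lt: "dS (x n) ?y = l" "dS ?y ?z = l" "dS ?y (x n) = l" "dS ?z ?y = l"
      using x1[of n] x1[of "Suc n"] dS_sym[OF xc xc, of n "Suc n"] dS_sym[OF xc xc, of "Suc n" "Suc (Suc n)"] by auto
    show ?thesis
    proof (rule ccontr)
      assume "\<not> ?thesis"
      then have "2 * \<delta> + 3/2 < T" unfolding T_def using gprod_double[of dS ?y "x n" ?z] lt by simp
      moreover have "gprod dS ?y m (x n) = dS ?y m" using m unfolding gprod_def by simp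
      moreover have "gprod dS ?y ?z (b \<otimes> m) = dS ?y (b \<otimes> m)"
        using e1 m lt dS_sym[OF bm xc, of "Suc n"] gprod_double[of dS ?y ?z "b \<otimes> m"] by linarith
      moreover have "dS ?y (b \<otimes> m) = l - dS ?y m" using e1 m lt dS_sym[OF bm xc, of "Suc n"] by simp
      moreover have "6 * \<delta> + 3 < l" using large l_def by simp
      \<comment> \<open>The chain runs from \<open>m\<close> to \<open>x n\<close>, to
        \<open>?z\<close>, to \<open>b \<otimes> m\<close>. The outer two products are the distances
        of \<open>m\<close> and of its image from \<open>?y\<close>, since these points lie on
        geodesics issuing from \<open>?y\<close>; they add up to \<open>l\<close>, and each is at
        least \<open>l / 2 - 1\<close>.\<close>
      ultimately have "min T (l / 2 - 1) - 2 * \<delta> \<le> gprod dS ?y m (b \<otimes> m)"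
        using m by (intro gprod_trans3[of m "x n" ?z "b \<otimes> m" ?y]) (auto simp: xc bm T_def[symmetric])
      moreover have "gprod dS ?y m (b \<otimes> m) \<le> 0"
        using far gprod_double[of dS ?y m "b \<otimes> m"] \<open>dS ?y (b \<otimes> m) = l - dS ?y m\<close> by simp
      ultimately show False using \<open>2 * \<delta> + 3/2 < T\<close> \<open>6 * \<delta> + 3 < l\<close> \<delta>_nonneg by linarith
    qed
  qed
  \<comment> \<open>Subtracting the step length \<open>l\<close> and \<open>2 * \<delta>\<close>
    from \<open>2 * l - 4 * \<delta> - 3\<close> leaves \<open>l - (6 * \<delta> + 3)\<close>: this
    is the origin of the threshold in the statement.\<close>
  have "(l - (6 * \<delta> + 3)) * real n \<le> dS (x 0) (x n)" for n
  proof (rule discrete_local_to_global)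
    show "dS (x i) (x (i + 1)) + 2 * \<delta> + (l - (6 * \<delta> + 3)) \<le> dS (x i) (x (i + 2))" for i
      using x2[of i] x1[of i] by simp
    show "dS (x (i + 1)) (x (i + 2)) + 2 * \<delta> + (l - (6 * \<delta> + 3)) \<le> dS (x i) (x (i + 2))" for i
      using x2[of i] x1[of "i + 1"] by simp
  qed (use xc large l_def in auto)
  moreover have "dS (x 0) (x n) \<le> 2 * dS \<one> g + dS \<one> (b [^] n)" for n
    using dS_tri[of g \<one> "x n"] dS_tri[of \<one> "b [^] n" "x n"] dS_left_mult[of \<one> g "b [^] n"] b g xc[of n] dS_sym[of \<one> g]
    unfolding x_def by auto
  ultimately have "(l - (6 * \<delta> + 3)) * real n - 2 * dS \<one> g \<le> dS \<one> (b [^] n)" for n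
    by (smt (verit))
  then show ?thesis using that unfolding l_def by blast
qed

end

section \<open>Geodesic lines fellow-travelling quasi-geodesics\<close>

lemma finite_range_constant_subseq:
  fixes a :: "nat \<Rightarrow> 'b"
  assumes "finite (range a)"
  shows "\<exists>r::nat \<Rightarrow> nat. strict_mono r \<and> (\<forall>i j. a (r i) = a (r j))"
proof -
  obtain n0 where "infinite {n \<in> UNIV. a n = a n0}"
    using pigeonhole_infinite[OF infinite_UNIV_nat assms] by blast
  then have inf: "infinite {n. a n = a n0}" by simp
  show ?thesis
    using strict_mono_enumerate[OF inf] enumerate_in_set[OF inf] by (intro exI[of _ "enumerate {n. a n = a n0}"]) auto
qed

text \<open>Coordinates are enumerated by \<open>to_nat\<close>, and the refinement with number k
  makes the coordinate with number k constant, which is possible because it takes finitely many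
  values. Along the diagonal sequence the coordinate \<open>t\<close> is constant from index
  \<open>Suc (to_nat t)\<close> on.\<close>

lemma diagonal_pointwise_limit:
  fixes g :: "nat \<Rightarrow> 'i::countable \<Rightarrow> 'a"
  assumes "\<And>t. finite (range (\<lambda>n. g n t))"
  obtains r :: "nat \<Rightarrow> nat" and l where "strict_mono r" "\<And>t. \<forall>\<^sub>F k in sequentially. g (r k) t = l t"
proof -
  define P where "P k s \<longleftrightarrow> (\<forall>i j. g (s i) (from_nat k) = g (s j) (from_nat k))" for k and s :: "nat \<Rightarrow> nat"
  have PD: "P k s \<Longrightarrow> g (s i) (from_nat k) = g (s j) (from_nat k)" for k s i j
    unfolding P_def by blast
  interpret subseqs P
  proof
    fix n and s :: "nat \<Rightarrow> nat"
    have "finite (range (\<lambda>i. g (s i) (from_nat n)))"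
      by (rule finite_subset[OF _ assms[of "from_nat n"]]) auto
    then have "\<exists>r::nat \<Rightarrow> nat. strict_mono r \<and> (\<forall>i j. g (s (r i)) (from_nat n) = g (s (r j)) (from_nat n))"
      by (rule finite_range_constant_subseq)
    then show "\<exists>r. strict_mono r \<and> P n (s \<circ> r)" unfolding P_def o_def .
  qed
  define l where "l t = g (diagseq (Suc (to_nat t))) t" for t
  have "\<forall>\<^sub>F k in sequentially. g (diagseq k) t = l t" for t
    unfolding eventually_sequentially
  proof (intro exI allI impI)
    fix k assume k: "Suc (to_nat t) \<le> k"
    have "P (to_nat t) (diagseq \<circ> ((+) (Suc (to_nat t))))" by (rule diagseq_holds) (auto simp: P_def)
    from PD[OF this, of "k - Suc (to_nat t)" 0]
    show "g (diagseq k) t = l t" using k unfolding l_def by simp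
  qed
  then show ?thesis using that[OF subseq_diagseq] by blast
qed

context hyp_group
begin

lemma same_boundary_limit_iff:
  "same_boundary_limit \<Gamma> S u v \<longleftrightarrow> (\<forall>B. \<exists>N. \<forall>m\<ge>N. \<forall>n\<ge>N. B \<le> gprod dS \<one> (u m) (v n))"
  unfolding same_boundary_limit_def gprod_def ..

lemma same_boundary_limit_trans:
  assumes uv: "same_boundary_limit \<Gamma> S u v" and vw: "same_boundary_limit \<Gamma> S v w"
    and c: "\<And>n. u n \<in> carrier \<Gamma>" "\<And>n. v n \<in> carrier \<Gamma>" "\<And>n. w n \<in> carrier \<Gamma>"
  shows "same_boundary_limit \<Gamma> S u w"
  unfolding same_boundary_limit_iff
proof
  fix B
  obtain N1 where N1: "\<And>m n. m \<ge> N1 \<Longrightarrow> n \<ge> N1 \<Longrightarrow> B + \<delta> \<le> gprod dS \<one> (u m) (v n)"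
    using uv unfolding same_boundary_limit_iff by blast
  obtain N2 where N2: "\<And>m n. m \<ge> N2 \<Longrightarrow> n \<ge> N2 \<Longrightarrow> B + \<delta> \<le> gprod dS \<one> (v m) (w n)"
    using vw unfolding same_boundary_limit_iff by blast
  show "\<exists>N. \<forall>m\<ge>N. \<forall>n\<ge>N. B \<le> gprod dS \<one> (u m) (w n)"
  proof (intro exI[of _ "max N1 N2"] allI impI)
    fix m n assume "max N1 N2 \<le> m" "max N1 N2 \<le> n"
    then show "B \<le> gprod dS \<one> (u m) (w n)"
      using N1[of m "max N1 N2"] N2[of "max N1 N2" n] hyp_dS[OF c(1) c(2) c(3) one_closed, of m "max N1 N2" n] by auto
  qed
qed

text \<open>For \<open>n\<close> chosen after \<open>t\<close> and \<open>m\<close>, both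
  \<open>l t\<close> and \<open>f m\<close> have a large Gromov product with \<open>f n\<close> seen
  from \<open>f 0\<close>: \<open>l t\<close> because it lies far out on a geodesic from a point
  near \<open>f 0\<close> to \<open>f n\<close>, and \<open>f m\<close> because the Gromov product
  at \<open>f m\<close> is bounded while \<open>f m\<close> is far from \<open>f 0\<close>.
  Hyperbolicity joins the two.\<close>

lemma geodesic_limit_same_boundary:
  fixes f l :: "nat \<Rightarrow> 'g"
  assumes fc: "\<And>n. f n \<in> carrier \<Gamma>" and lc: "\<And>n. l n \<in> carrier \<Gamma>" and K: "1 \<le> K"
    and approx: "\<And>t n0. \<exists>n\<ge>n0. \<exists>a\<in>carrier \<Gamma>. dS (f 0) a \<le> D \<and> dS a (l t) = real t \<and>
       dS a (l t) + dS (l t) (f n) = dS a (f n)"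
    and f1: "\<And>m n. m \<le> n \<Longrightarrow> gprod dS (f m) (f 0) (f n) \<le> D0"
    and f2: "\<And>m. real m / K - C \<le> dS (f 0) (f m)"
  shows "same_boundary_limit \<Gamma> S l f"
  unfolding same_boundary_limit_iff
proof
  fix B
  \<comment> \<open>\<open>E\<close> anticipates the change of base to \<open>\<one>\<close> and one
    loss of \<open>\<delta>\<close>; \<open>N\<close> makes \<open>t\<close> at least
    \<open>E + D\<close> and \<open>m / K\<close> at least \<open>E + C + D0\<close>.\<close>
  define E where "E = B + dS \<one> (f 0) + \<delta>"
  define N where "N = nat \<lceil>max (E + D) (K * (E + C + D0))\<rceil>"
  show "\<exists>N. \<forall>m\<ge>N. \<forall>n\<ge>N. B \<le> gprod dS \<one> (l m) (f n)"
  proof (intro exI[of _ N] allI impI)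
    fix t m assume tm: "N \<le> t" "N \<le> m"
    have N: "E + D \<le> real N" "K * (E + C + D0) \<le> real N" unfolding N_def by linarith+
    obtain n a where n: "n \<ge> m" "a \<in> carrier \<Gamma>" "dS (f 0) a \<le> D" "dS a (l t) = real t"
       "dS a (l t) + dS (l t) (f n) = dS a (f n)" using approx by blast
    have "gprod dS a (l t) (f n) = real t" using n(4,5) unfolding gprod_def by simp
    then have 1: "E \<le> gprod dS (f 0) (l t) (f n)"
      using gprod_change_base[OF lc fc fc n(2), of t n 0] dS_sym[OF fc n(2), of 0] n(3) N(1) tm by simp
    have "(E + C + D0) * K \<le> real m" using N(2) tm by (simp add: mult.commute)
    then have "E + C + D0 \<le> real m / K" using K by (simp add: le_divide_eq)
    moreover have "gprod dS (f 0) (f n) (f m) + gprod dS (f m) (f 0) (f n) = dS (f 0) (f m)"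
      using gprod_double[of dS "f 0" "f n" "f m"] gprod_double[of dS "f m" "f 0" "f n"]
        dS_sym[OF fc fc, of m 0] dS_sym[OF fc fc, of m n] by linarith
    ultimately have 2: "E \<le> gprod dS (f 0) (f n) (f m)" using f1[OF n(1)] f2[of m] by linarith
    have "E - \<delta> \<le> gprod dS (f 0) (l t) (f m)" using hyp_dS[of "l t" "f n" "f m" "f 0"] lc fc 1 2 by auto
    then show "B \<le> gprod dS \<one> (l t) (f m)"
      using gprod_change_base[of "l t" "f m" \<one> "f 0"] lc fc dS_sym[OF fc one_closed, of 0] unfolding E_def by auto
  qed
qed

text \<open>The geodesic between \<open>f (- int n)\<close> and \<open>f (int n)\<close> is
  parametrised so that \<open>g 0\<close> is its vertex close to \<open>f 0\<close>; for different
  \<open>n\<close> these vertices lie in one ball, as a limit requires. Outside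
  \<open>{lo..hi}\<close> it is held constant, which keeps the bound on
  \<open>dS (g 0) (g t)\<close> valid for all \<open>t\<close>. The margin
  \<open>1 + 2 * \<delta>\<close> in the hypothesis is the loss of
  \<open>near_between\<close>.\<close>

lemma finite_approximating_geodesic:
  assumes fc: "\<And>i. f i \<in> carrier \<Gamma>"
    and D0: "\<And>m. \<bar>m\<bar> \<le> int n \<Longrightarrow> gprod dS (f m) (f (- int n)) (f (int n)) \<le> D - 1 - 2 * \<delta>"
  obtains g :: "int \<Rightarrow> 'g" and lo hi :: int where "lo \<le> 0" "0 \<le> hi"
    "g lo = f (- int n)" "g hi = f (int n)" "\<And>t. g t \<in> carrier \<Gamma>"
    "\<And>s t. s \<in> {lo..hi} \<Longrightarrow> t \<in> {lo..hi} \<Longrightarrow> dS (g s) (g t) = \<bar>real_of_int (s - t)\<bar>"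
    "\<And>t. dS (g 0) (g t) \<le> \<bar>real_of_int t\<bar>" "dS (f 0) (g 0) \<le> D"
    "\<And>m. \<bar>m\<bar> \<le> int n \<Longrightarrow> \<exists>t\<in>{lo..hi}. dS (f m) (g t) \<le> D"
proof -
  let ?x = "f (- int n)" and ?y = "f (int n)"
  obtain c N where c: "real N = dS ?x ?y" "c 0 = ?x" "c N = ?y" "\<And>i. c i \<in> carrier \<Gamma>"
    "\<And>i j. i \<le> N \<Longrightarrow> j \<le> N \<Longrightarrow> dS (c i) (c j) = \<bar>real i - real j\<bar>"
    using exists_geodesic[OF fc fc, of "- int n" "int n"] by metis
  have near: "\<exists>t\<le>N. dS (f m) (c t) \<le> D" if "\<bar>m\<bar> \<le> int n" for m
  proof -
    define G where "G = gprod dS ?x (f m) ?y"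
    have G: "0 \<le> G" "G \<le> real N"
      using gprod_nonneg[OF fc fc fc] gprod_le[OF fc fc fc] gprod_commute[OF fc fc] c(1) unfolding G_def by metis+
    define t where "t = nat \<lfloor>G\<rfloor>"
    have t: "t \<le> N" "\<bar>real t - G\<bar> \<le> 1" using G unfolding t_def by linarith+
    have "dS (f m) (c t) \<le> gprod dS (f m) ?x ?y + 1 + 2 * \<delta>"
      using near_between[OF fc fc fc c(4), of "- int n" t "int n" m] c(5)[of 0 t] c(5)[of t N] c(1,2,3) t
      unfolding G_def by auto
    then show ?thesis using D0[OF that] t by (intro exI[of _ t]) auto
  qed
  obtain j where j: "j \<le> N" "dS (f 0) (c j) \<le> D" using near[of 0] by auto
  define g where "g t = c (nat (max 0 (min (int N) (int j + t))))" for t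
  define lo hi where "lo = - int j" and "hi = int N - int j"
  have gt: "dS (g s) (g t) = \<bar>real_of_int (s - t)\<bar>" if "s \<in> {lo..hi}" "t \<in> {lo..hi}" for s t
  proof -
    have "nat (max 0 (min (int N) (int j + u))) = nat (int j + u)" "nat (int j + u) \<le> N"
      "real (nat (int j + u)) = real j + real_of_int u" if "u \<in> {lo..hi}" for u
      using that unfolding lo_def hi_def by auto
    then show ?thesis using that c(5)[of "nat (int j + s)" "nat (int j + t)"] unfolding g_def by simp
  qed
  show ?thesis
  proof (rule that)
    show "lo \<le> 0" "0 \<le> hi" "g lo = ?x" "g hi = ?y" "\<And>t. g t \<in> carrier \<Gamma>"
      using j c unfolding lo_def hi_def g_def by auto
    show "\<And>s t. s \<in> {lo..hi} \<Longrightarrow> t \<in> {lo..hi} \<Longrightarrow> dS (g s) (g t) = \<bar>real_of_int (s - t)\<bar>" by (rule gt)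
    show "dS (f 0) (g 0) \<le> D" using j unfolding g_def by simp
    show "dS (g 0) (g t) \<le> \<bar>real_of_int t\<bar>" for t
    proof -
      define k where "k = nat (max 0 (min (int N) (int j + t)))"
      have "k \<le> N" "\<bar>real j - real k\<bar> \<le> \<bar>real_of_int t\<bar>" using j unfolding k_def by linarith+
      then show ?thesis using c(5)[of j k] j unfolding g_def k_def by simp
    qed
    fix m assume "\<bar>m\<bar> \<le> int n"
    then obtain t where t: "t \<le> N" "dS (f m) (c t) \<le> D" using near by blast
    then show "\<exists>t\<in>{lo..hi}. dS (f m) (g t) \<le> D"
      by (intro bexI[of _ "int t - int j"]) (auto simp: g_def lo_def hi_def)
  qed
qed

text \<open>Each coordinate of the approximating geodesics ranges over a finite ball around
  \<open>f 0\<close>, so a subsequence converges pointwise. Every finite piece of the limit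
  \<open>l\<close> coincides with a piece of some \<open>g n\<close> with \<open>n\<close>
  arbitrarily large, and each claim about \<open>l\<close> is read off there. \<open>D\<close>
  depends only on the constants of the quasi-geodesic, not on \<open>f\<close>.\<close>

lemma qgeod_fellow_travels_line:
  assumes K: "1 \<le> K" and C: "0 \<le> C" and L: "0 \<le> L"
  obtains D where "0 \<le> D"
    "\<And>f. (\<And>i. f i \<in> carrier \<Gamma>) \<Longrightarrow> qgeod_on dS K C L UNIV f \<Longrightarrow>
      \<exists>l. (\<forall>n. l n \<in> carrier \<Gamma>) \<and> (\<forall>m n. dS (l m) (l n) = real_of_int \<bar>m - n\<bar>) \<and>
        (\<forall>m. \<exists>t. dS (f m) (l t) \<le> D) \<and>
        same_boundary_limit \<Gamma> S (\<lambda>n. l (int n)) (\<lambda>n. f (int n)) \<and>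
        same_boundary_limit \<Gamma> S (\<lambda>n. l (- int n)) (\<lambda>n. f (- int n))"
proof -
  obtain D0 where D0: "0 \<le> D0"
    "\<And>i j k y. i \<le> j \<Longrightarrow> j \<le> k \<Longrightarrow> (\<And>m. m \<in> {i..k} \<Longrightarrow> y m \<in> carrier \<Gamma>) \<Longrightarrow>
       qgeod_on dS K C L {i..k} y \<Longrightarrow> gprod dS (y j) (y i) (y k) \<le> D0"
    using qgeod_gprod_bounded[OF K C L] by metis
  define D where "D = D0 + 1 + 2 * \<delta>"
  have "0 \<le> D" unfolding D_def using D0(1) \<delta>_nonneg by simp
  then show ?thesis
  proof (rule that)
    fix f :: "int \<Rightarrow> 'g" assume fc: "\<And>i. f i \<in> carrier \<Gamma>" and qg: "qgeod_on dS K C L UNIV f"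
    have gp: "gprod dS (f j) (f i) (f k) \<le> D0" if "i \<le> j" "j \<le> k" for i j k
      using D0(2)[OF that fc qgeod_on_subset[OF qg]] by auto
    have lower: "\<bar>real_of_int (i - j)\<bar> / K - C \<le> dS (f i) (f j)"
      and upper: "dS (f i) (f j) \<le> L * \<bar>real_of_int (i - j)\<bar>" for i j
      using qg unfolding qgeod_on_def by auto
    define P where "P n g lo hi \<longleftrightarrow> lo \<le> (0::int) \<and> (0::int) \<le> hi \<and> g lo = f (- int n) \<and> g hi = f (int n) \<and>
      (\<forall>t. g t \<in> carrier \<Gamma>) \<and>
      (\<forall>s t. s \<in> {lo..hi} \<longrightarrow> t \<in> {lo..hi} \<longrightarrow> dS (g s) (g t) = \<bar>real_of_int (s - t)\<bar>) \<and>
      (\<forall>t. dS (g 0) (g t) \<le> \<bar>real_of_int t\<bar>) \<and> dS (f 0) (g 0) \<le> D \<and>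
      (\<forall>m. \<bar>m\<bar> \<le> int n \<longrightarrow> (\<exists>t\<in>{lo..hi}. dS (f m) (g t) \<le> D))" for n g lo hi
    have "\<exists>g lo hi. P n g lo hi" for n
    proof -
      have "gprod dS (f m) (f (- int n)) (f (int n)) \<le> D - 1 - 2 * \<delta>" if "\<bar>m\<bar> \<le> int n" for m
        using gp[of "- int n" m "int n"] that unfolding D_def by auto
      from finite_approximating_geodesic[of f, OF fc this] show ?thesis unfolding P_def by metis
    qed
    then obtain g lo hi where "\<And>n. P n (g n) (lo n) (hi n)" by metis
    then have g: "\<And>n. lo n \<le> 0" "\<And>n. 0 \<le> hi n" "\<And>n. g n (lo n) = f (- int n)" "\<And>n. g n (hi n) = f (int n)"
       "\<And>n t. g n t \<in> carrier \<Gamma>"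
       "\<And>n s t. s \<in> {lo n..hi n} \<Longrightarrow> t \<in> {lo n..hi n} \<Longrightarrow> dS (g n s) (g n t) = \<bar>real_of_int (s - t)\<bar>"
       "\<And>n t. dS (g n 0) (g n t) \<le> \<bar>real_of_int t\<bar>" "\<And>n. dS (f 0) (g n 0) \<le> D"
       "\<And>n m. \<bar>m\<bar> \<le> int n \<Longrightarrow> \<exists>t\<in>{lo n..hi n}. dS (f m) (g n t) \<le> D"
      unfolding P_def by (simp_all del: atLeastAtMost_iff)
    have hi_large: "real n / K - C - D \<le> real_of_int (hi n)" for n
      using lower[of 0 "int n"] g(6)[of 0 n "hi n"] g(1)[of n] g(2)[of n] g(4)[of n] g(8)[of n]
        dS_tri[of "f 0" "g n 0" "f (int n)"] fc g(5) by auto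
    have lo_large: "real n / K - C - D \<le> - real_of_int (lo n)" for n
      using lower[of 0 "- int n"] g(6)[of 0 n "lo n"] g(1)[of n] g(2)[of n] g(3)[of n] g(8)[of n]
        dS_tri[of "f 0" "g n 0" "f (- int n)"] fc g(5) by auto
    have "finite (range (\<lambda>n. g n t))" for t
    proof (rule finite_subset)
      show "range (\<lambda>n. g n t) \<subseteq> {h \<in> carrier \<Gamma>. dS (f 0) h \<le> D + \<bar>real_of_int t\<bar>}"
      proof (clarify, intro conjI g(5))
        fix n show "dS (f 0) (g n t) \<le> D + \<bar>real_of_int t\<bar>"
          using g(7)[of n t] g(8)[of n] dS_tri[of "f 0" "g n 0" "g n t"] fc g(5) by (smt (verit))
      qed
    qed (rule finite_dS_ball[OF fc])
    then obtain r l where r: "strict_mono r" and l: "\<And>t. \<forall>\<^sub>F k in sequentially. g (r k) t = l t"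
      using diagonal_pointwise_limit[of g] by metis
    have window: "\<exists>n\<ge>n0. \<forall>t\<in>T. g n t = l t \<and> t \<in> {lo n..hi n}" if "finite T" for T n0
    proof -
      define b where "b = Max (insert 0 (abs ` T))"
      have b: "\<bar>t\<bar> \<le> b" if "t \<in> T" for t unfolding b_def using \<open>finite T\<close> that by (intro Max_ge) auto
      \<comment> \<open>From \<open>n1\<close> on, \<open>{lo n..hi n}\<close> contains
        \<open>{- b..b}\<close>, because both of its ends move away linearly, at rate
        \<open>1 / K\<close>.\<close>
      define n1 where "n1 = nat \<lceil>K * (real_of_int b + C + D)\<rceil>"
      have "\<forall>\<^sub>F k in sequentially. \<forall>t\<in>T. g (r k) t = l t"
        using that l by (intro eventually_ball_finite) auto
      then obtain k0 where k0: "\<And>k. k \<ge> k0 \<Longrightarrow> \<forall>t\<in>T. g (r k) t = l t" unfolding eventually_sequentially by blast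
      define n where "n = r (k0 + n0 + n1)"
      have n: "n \<ge> k0 + n0 + n1" unfolding n_def using r seq_suble by blast
      have "K * (real_of_int b + C + D) \<le> real n1" unfolding n1_def by linarith
      then have "(real_of_int b + C + D) * K \<le> real n" using n by (simp add: mult.commute)
      then have "real_of_int b + C + D \<le> real n / K" using K by (simp add: le_divide_eq)
      then have "b \<le> hi n" "b \<le> - lo n" using hi_large[of n] lo_large[of n] by linarith+
      then have "t \<in> {lo n..hi n}" if "t \<in> T" for t using b[OF that] by auto
      then show ?thesis using k0[of "k0 + n0 + n1"] n unfolding n_def by (intro exI[of _ "r (k0 + n0 + n1)"]) auto
    qed
    have lc: "l t \<in> carrier \<Gamma>" for t
    proof -
      obtain n where "g n t = l t" using window[of "{t}" 0] by auto
      then show ?thesis using g(5) by metis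
    qed
    have lgeo: "dS (l s) (l t) = real_of_int \<bar>s - t\<bar>" for s t
    proof -
      obtain n where "g n s = l s" "g n t = l t" "s \<in> {lo n..hi n}" "t \<in> {lo n..hi n}"
        using window[of "{s, t}" 0] by auto
      then show ?thesis using g(6)[of s n t] by simp
    qed
    have lnear: "\<exists>t. dS (f m) (l t) \<le> D" for m
    proof -
      \<comment> \<open>A vertex of \<open>g n\<close> within \<open>D\<close> of \<open>f m\<close>
        has a parameter of size at most \<open>D + L * \<bar>m\<bar> + D\<close>, whatever
        \<open>n\<close> is, so a fixed window catches it.\<close>
      define b where "b = \<lceil>2 * D + L * \<bar>real_of_int m\<bar>\<rceil>"
      obtain n where n: "n \<ge> nat \<bar>m\<bar>" "\<And>t. t \<in> {-b..b} \<Longrightarrow> g n t = l t" using window[of "{-b..b}"] by blast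
      then obtain t where t: "t \<in> {lo n..hi n}" "dS (f m) (g n t) \<le> D" using g(9)[of m n] by force
      have "\<bar>real_of_int t\<bar> = dS (g n 0) (g n t)" using g(6)[of 0 n t] g(1,2)[of n] t by auto
      also have "\<dots> \<le> 2 * D + L * \<bar>real_of_int m\<bar>"
        using dS_tri[of "g n 0" "f m" "g n t"] dS_tri[of "g n 0" "f 0" "f m"] fc g(5) g(8)[of n] t upper[of 0 m]
          dS_sym[OF g(5) fc, of n 0 0] by auto
      finally have "t \<in> {-b..b}" unfolding b_def by (auto simp: abs_le_iff) linarith+
      then show ?thesis using n t by metis
    qed
    have pos: "same_boundary_limit \<Gamma> S (\<lambda>n. l (int n)) (\<lambda>n. f (int n))"
    proof (rule geodesic_limit_same_boundary[OF fc lc K, where D = D and C = C])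
      fix t n0
      obtain n where n: "n \<ge> n0" "g n (int t) = l (int t)" "int t \<in> {lo n..hi n}"
        using window[of "{int t}" n0] by auto
      show "\<exists>n\<ge>n0. \<exists>a\<in>carrier \<Gamma>. dS (f (int 0)) a \<le> D \<and> dS a (l (int t)) = real t \<and>
          dS a (l (int t)) + dS (l (int t)) (f (int n)) = dS a (f (int n))"
      proof (intro exI conjI bexI)
        show "dS (g n 0) (l (int t)) = real t" "dS (g n 0) (l (int t)) + dS (l (int t)) (f (int n)) = dS (g n 0) (f (int n))"
          using n g(1,2,4)[of n] g(6)[of 0 n "int t"] g(6)[of 0 n "hi n"] g(6)[of "int t" n "hi n"] by auto
      qed (use n g(5,8) in auto)
    next
      show "gprod dS (f (int m)) (f (int 0)) (f (int n)) \<le> D0" if "m \<le> n" for m n using gp[of 0 "int m" "int n"] that by simp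
      show "real m / K - C \<le> dS (f (int 0)) (f (int m))" for m using lower[of 0 "int m"] by simp
    qed
    have neg: "same_boundary_limit \<Gamma> S (\<lambda>n. l (- int n)) (\<lambda>n. f (- int n))"
    proof (rule geodesic_limit_same_boundary[OF fc lc K, where D = D and C = C])
      fix t n0
      obtain n where n: "n \<ge> n0" "g n (- int t) = l (- int t)" "- int t \<in> {lo n..hi n}"
        using window[of "{- int t}" n0] by auto
      show "\<exists>n\<ge>n0. \<exists>a\<in>carrier \<Gamma>. dS (f (- int 0)) a \<le> D \<and> dS a (l (- int t)) = real t \<and>
          dS a (l (- int t)) + dS (l (- int t)) (f (- int n)) = dS a (f (- int n))"
      proof (intro exI conjI bexI)
        show "dS (g n 0) (l (- int t)) = real t" "dS (g n 0) (l (- int t)) + dS (l (- int t)) (f (- int n)) = dS (g n 0) (f (- int n))"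
          using n g(1,2,3)[of n] g(6)[of 0 n "- int t"] g(6)[of 0 n "lo n"] g(6)[of "- int t" n "lo n"] by auto
      qed (use n g(5,8) in auto)
    next
      show "gprod dS (f (- int m)) (f (- int 0)) (f (- int n)) \<le> D0" if "m \<le> n" for m n
        using gp[of "- int n" "- int m" 0] that gprod_commute[of "f (- int n)" "f 0"] fc by simp
      show "real m / K - C \<le> dS (f (- int 0)) (f (- int m))" for m using lower[of 0 "- int m"] by simp
    qed
    show "\<exists>l. (\<forall>n. l n \<in> carrier \<Gamma>) \<and> (\<forall>m n. dS (l m) (l n) = real_of_int \<bar>m - n\<bar>) \<and>
        (\<forall>m. \<exists>t. dS (f m) (l t) \<le> D) \<and>
        same_boundary_limit \<Gamma> S (\<lambda>n. l (int n)) (\<lambda>n. f (int n)) \<and>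
        same_boundary_limit \<Gamma> S (\<lambda>n. l (- int n)) (\<lambda>n. f (- int n))"
      using lc lgeo lnear pos neg by blast
  qed
qed

section \<open>Automorphisms acting on lines and boundary limits\<close>

lemma iso_closed: "\<psi> \<in> iso \<Gamma> \<Gamma> \<Longrightarrow> g \<in> carrier \<Gamma> \<Longrightarrow> \<psi> g \<in> carrier \<Gamma>"
  by (auto simp: iso_def hom_def)

lemma iso_inv_into:
  assumes "\<psi> \<in> iso \<Gamma> \<Gamma>"
  shows "g \<in> carrier \<Gamma> \<Longrightarrow> inv_into (carrier \<Gamma>) \<psi> (\<psi> g) = g"
    and "g \<in> carrier \<Gamma> \<Longrightarrow> \<psi> (inv_into (carrier \<Gamma>) \<psi> g) = g"
  using assms by (auto simp: iso_def bij_betw_def inv_into_f_f f_inv_into_f)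

lemma iso_quasi_isometry:
  assumes "\<psi> \<in> iso \<Gamma> \<Gamma>"
  obtains K where "1 \<le> K"
    "\<And>g h. g \<in> carrier \<Gamma> \<Longrightarrow> h \<in> carrier \<Gamma> \<Longrightarrow> dS g h \<le> K * dS (\<psi> g) (\<psi> h)"
    "\<And>g h. g \<in> carrier \<Gamma> \<Longrightarrow> h \<in> carrier \<Gamma> \<Longrightarrow> dS (\<psi> g) (\<psi> h) \<le> K * dS g h"
proof -
  have "\<psi> \<in> hom \<Gamma> \<Gamma>" "inv_into (carrier \<Gamma>) \<psi> \<in> hom \<Gamma> \<Gamma>"
    using assms iso_set_sym[OF assms] by (auto simp: iso_def)
  then obtain L L' where L: "1 \<le> L" "\<And>g h. g \<in> carrier \<Gamma> \<Longrightarrow> h \<in> carrier \<Gamma> \<Longrightarrow> dS (\<psi> g) (\<psi> h) \<le> L * dS g h"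
    and L': "1 \<le> L'" "\<And>g h. g \<in> carrier \<Gamma> \<Longrightarrow> h \<in> carrier \<Gamma> \<Longrightarrow>
      dS (inv_into (carrier \<Gamma>) \<psi> g) (inv_into (carrier \<Gamma>) \<psi> h) \<le> L' * dS g h"
    by (metis hom_lipschitz)
  show ?thesis
  proof (rule that[of "max L L'"])
    fix g h assume gh: "g \<in> carrier \<Gamma>" "h \<in> carrier \<Gamma>"
    have "dS g h \<le> L' * dS (\<psi> g) (\<psi> h)"
      using L'(2)[of "\<psi> g" "\<psi> h"] gh iso_closed[OF assms] iso_inv_into[OF assms] by simp
    also have "\<dots> \<le> max L L' * dS (\<psi> g) (\<psi> h)" by (intro mult_right_mono) (auto simp: dS_nonneg)
    finally show "dS g h \<le> max L L' * dS (\<psi> g) (\<psi> h)" .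
    have "dS (\<psi> g) (\<psi> h) \<le> L * dS g h" using L(2) gh by blast
    also have "\<dots> \<le> max L L' * dS g h" by (intro mult_right_mono) (auto simp: dS_nonneg)
    finally show "dS (\<psi> g) (\<psi> h) \<le> max L L' * dS g h" .
  qed (use L in auto)
qed

lemma qgeod_iso_image:
  assumes K: "1 \<le> K"
    "\<And>g h. g \<in> carrier \<Gamma> \<Longrightarrow> h \<in> carrier \<Gamma> \<Longrightarrow> dS g h \<le> K * dS (\<psi> g) (\<psi> h)"
    "\<And>g h. g \<in> carrier \<Gamma> \<Longrightarrow> h \<in> carrier \<Gamma> \<Longrightarrow> dS (\<psi> g) (\<psi> h) \<le> K * dS g h"
    and y: "\<And>i. i \<in> I \<Longrightarrow> y i \<in> carrier \<Gamma>" "\<And>i j. i \<in> I \<Longrightarrow> j \<in> I \<Longrightarrow> dS (y i) (y j) = \<bar>real_of_int (i - j)\<bar>"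
  shows "qgeod_on dS K 0 K I (\<lambda>i. \<psi> (y i))"
  unfolding qgeod_on_def
proof (intro ballI)
  fix i j assume ij: "i \<in> I" "j \<in> I"
  have "\<bar>real_of_int (i - j)\<bar> \<le> dS (\<psi> (y i)) (\<psi> (y j)) * K"
    using K(2)[OF y(1) y(1), OF ij] y(2)[OF ij] by (simp add: mult.commute)
  then have "\<bar>real_of_int (i - j)\<bar> / K \<le> dS (\<psi> (y i)) (\<psi> (y j))" using K(1) by (simp add: divide_le_eq)
  then show "\<bar>real_of_int (i - j)\<bar> / K - 0 \<le> dS (\<psi> (y i)) (\<psi> (y j)) \<and>
      dS (\<psi> (y i)) (\<psi> (y j)) \<le> K * \<bar>real_of_int (i - j)\<bar>"
    using K(3)[OF y(1) y(1), OF ij] y(2)[OF ij] by simp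
qed

text \<open>\<open>main\<close> compares the products. A geodesic from \<open>g\<close> to
  \<open>h\<close> is mapped to a quasi-geodesic, and a point \<open>p\<close> of a geodesic between
  the images, whose distance from \<open>\<one>\<close> is at most their Gromov product up to a
  constant, is close to some \<open>\<psi> (c (nat j))\<close>. Pulling back bounds the distance
  from \<open>\<one>\<close> to \<open>c (nat j)\<close>, which dominates
  \<open>gprod dS \<one> g h\<close>.\<close>

lemma same_boundary_limit_iso:
  assumes \<psi>: "\<psi> \<in> iso \<Gamma> \<Gamma>" and c: "\<And>n. u n \<in> carrier \<Gamma>" "\<And>n. v n \<in> carrier \<Gamma>"
    and uv: "same_boundary_limit \<Gamma> S u v"
  shows "same_boundary_limit \<Gamma> S (\<lambda>n. \<psi> (u n)) (\<lambda>n. \<psi> (v n))"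
proof -
  obtain K where K: "1 \<le> K"
    "\<And>g h. g \<in> carrier \<Gamma> \<Longrightarrow> h \<in> carrier \<Gamma> \<Longrightarrow> dS g h \<le> K * dS (\<psi> g) (\<psi> h)"
    "\<And>g h. g \<in> carrier \<Gamma> \<Longrightarrow> h \<in> carrier \<Gamma> \<Longrightarrow> dS (\<psi> g) (\<psi> h) \<le> K * dS g h"
    using iso_quasi_isometry[OF \<psi>] by metis
  have K0: "0 \<le> K" using K(1) by simp
  have \<psi>1: "\<psi> \<one> = \<one>" using \<psi> hom_one[of \<psi> \<Gamma> \<Gamma>] by (simp add: iso_def is_group)
  note \<psi>c = iso_closed[OF \<psi>]
  obtain D where D: "0 \<le> D"
    "\<And>i k y p. i \<le> k \<Longrightarrow> (\<And>j. j \<in> {i..k} \<Longrightarrow> y j \<in> carrier \<Gamma>) \<Longrightarrow> qgeod_on dS K 0 K {i..k} y \<Longrightarrow> p \<in> carrier \<Gamma> \<Longrightarrow>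
        dS (y i) p + dS p (y k) = dS (y i) (y k) \<Longrightarrow> \<exists>j\<in>{i..k}. dS p (y j) \<le> D"
    using geodesic_near_qgeod[OF K(1) order_refl K0] by metis
  have main: "gprod dS \<one> g h \<le> K * (gprod dS \<one> (\<psi> g) (\<psi> h) + 1 + 2 * \<delta> + D)"
    if gh: "g \<in> carrier \<Gamma>" "h \<in> carrier \<Gamma>" for g h
  proof -
    obtain c N where c: "real N = dS g h" "c 0 = g" "c N = h" "\<And>i. c i \<in> carrier \<Gamma>"
      "\<And>i j. i \<le> N \<Longrightarrow> j \<le> N \<Longrightarrow> dS (c i) (c j) = \<bar>real i - real j\<bar>"
      using exists_geodesic[OF gh] by metis
    obtain p where p: "p \<in> carrier \<Gamma>" "dS (\<psi> g) p + dS p (\<psi> h) = dS (\<psi> g) (\<psi> h)"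
        "dS \<one> p \<le> gprod dS \<one> (\<psi> g) (\<psi> h) + 1 + 2 * \<delta>"
      using exists_near_between[OF \<psi>c \<psi>c one_closed, OF gh] by metis
    have "qgeod_on dS K 0 K {0..int N} (\<lambda>i. \<psi> (c (nat i)))"
      by (rule qgeod_iso_image[OF K]) (use c in auto)
    then have "\<exists>j\<in>{0..int N}. dS p (\<psi> (c (nat j))) \<le> D"
      by (intro D(2)) (use c p \<psi>c in auto)
    then obtain j where j: "j \<in> {0..int N}" "dS p (\<psi> (c (nat j))) \<le> D" by blast
    have "gprod dS \<one> g h \<le> dS \<one> (c (nat j))"
      using gprod_le_dist_between[OF gh one_closed c(4), of "nat j"] c(5)[of 0 "nat j"] c(5)[of "nat j" N] c(1,2,3) j by auto
    also have "\<dots> \<le> K * dS \<one> (\<psi> (c (nat j)))" using K(2)[OF one_closed c(4), of "nat j"] \<psi>1 by simp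
    also have "\<dots> \<le> K * (gprod dS \<one> (\<psi> g) (\<psi> h) + 1 + 2 * \<delta> + D)"
      using p j dS_tri[of \<one> p "\<psi> (c (nat j))"] \<psi>c[OF c(4)] K0 by (intro mult_left_mono) auto
    finally show ?thesis .
  qed
  show ?thesis unfolding same_boundary_limit_iff
  proof
    fix B
    obtain N where N: "\<And>m n. m \<ge> N \<Longrightarrow> n \<ge> N \<Longrightarrow> K * (B + 1 + 2 * \<delta> + D) \<le> gprod dS \<one> (u m) (v n)"
      using uv unfolding same_boundary_limit_iff by blast
    show "\<exists>N. \<forall>m\<ge>N. \<forall>n\<ge>N. B \<le> gprod dS \<one> (\<psi> (u m)) (\<psi> (v n))"
    proof (intro exI[of _ N] allI impI)
      fix m n assume "m \<ge> N" "n \<ge> N"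
      then have "K * (B + 1 + 2 * \<delta> + D) \<le> K * (gprod dS \<one> (\<psi> (u m)) (\<psi> (v n)) + 1 + 2 * \<delta> + D)"
        using N main[OF c(1) c(2)] by (meson order_trans)
      then show "B \<le> gprod dS \<one> (\<psi> (u m)) (\<psi> (v n))" using K(1) by simp
    qed
  qed
qed

text \<open>The distance \<open>D\<close> depends on \<open>\<psi>\<close> alone, not on
  \<open>a\<close> or \<open>l\<close>, as is required for stability constants common to all of
  \<open>A\<close>. The image of a line is a quasi-geodesic, and its ends are transported by
  \<open>same_boundary_limit_iso\<close>.\<close>

lemma geod_line_iso:
  assumes \<psi>: "\<psi> \<in> iso \<Gamma> \<Gamma>"
  obtains D where "0 \<le> D"
    "\<And>a l. a \<in> carrier \<Gamma> \<Longrightarrow> l \<in> geod_lines \<Gamma> S a \<Longrightarrow>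
      \<exists>l'\<in>geod_lines \<Gamma> S (\<psi> a). \<forall>m. \<exists>t. dS (\<psi> (l m)) (l' t) \<le> D"
proof -
  obtain K where K: "1 \<le> K"
    "\<And>g h. g \<in> carrier \<Gamma> \<Longrightarrow> h \<in> carrier \<Gamma> \<Longrightarrow> dS g h \<le> K * dS (\<psi> g) (\<psi> h)"
    "\<And>g h. g \<in> carrier \<Gamma> \<Longrightarrow> h \<in> carrier \<Gamma> \<Longrightarrow> dS (\<psi> g) (\<psi> h) \<le> K * dS g h"
    using iso_quasi_isometry[OF \<psi>] by metis
  have K0: "0 \<le> K" using K(1) by simp
  obtain D where D: "0 \<le> D" "\<And>f. (\<And>i. f i \<in> carrier \<Gamma>) \<Longrightarrow> qgeod_on dS K 0 K UNIV f \<Longrightarrow>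
      \<exists>l. (\<forall>n. l n \<in> carrier \<Gamma>) \<and> (\<forall>m n. dS (l m) (l n) = real_of_int \<bar>m - n\<bar>) \<and>
        (\<forall>m. \<exists>t. dS (f m) (l t) \<le> D) \<and>
        same_boundary_limit \<Gamma> S (\<lambda>n. l (int n)) (\<lambda>n. f (int n)) \<and>
        same_boundary_limit \<Gamma> S (\<lambda>n. l (- int n)) (\<lambda>n. f (- int n))"
    using qgeod_fellow_travels_line[OF K(1) order_refl K0] by metis
  interpret h: group_hom \<Gamma> \<Gamma> \<psi>
    using \<psi> by (simp add: iso_def group_hom_def group_hom_axioms_def is_group)
  show ?thesis
  proof (rule that[OF D(1)])
    fix a l assume a: "a \<in> carrier \<Gamma>" and l: "l \<in> geod_lines \<Gamma> S a"
    have lc: "l n \<in> carrier \<Gamma>" and ld: "dS (l m) (l n) = real_of_int \<bar>m - n\<bar>" for m n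
      using l unfolding geod_lines_def by auto
    have lb: "same_boundary_limit \<Gamma> S (\<lambda>n. l (int n)) (\<lambda>n. a [^] n)"
       "same_boundary_limit \<Gamma> S (\<lambda>n. l (- int n)) (\<lambda>n. (inv a) [^] n)"
      using l unfolding geod_lines_def by auto
    have "qgeod_on dS K 0 K UNIV (\<lambda>i. \<psi> (l i))"
      by (rule qgeod_iso_image[OF K]) (auto simp: lc ld)
    from D(2)[OF _ this] obtain l' where l': "\<And>n. l' n \<in> carrier \<Gamma>" "\<And>m n. dS (l' m) (l' n) = real_of_int \<bar>m - n\<bar>"
        "\<And>m. \<exists>t. dS (\<psi> (l m)) (l' t) \<le> D"
        "same_boundary_limit \<Gamma> S (\<lambda>n. l' (int n)) (\<lambda>n. \<psi> (l (int n)))"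
        "same_boundary_limit \<Gamma> S (\<lambda>n. l' (- int n)) (\<lambda>n. \<psi> (l (- int n)))"
      using lc by auto
    have "same_boundary_limit \<Gamma> S (\<lambda>n. l' (int n)) (\<lambda>n. \<psi> (a [^] n))"
      by (rule same_boundary_limit_trans[OF l'(4) same_boundary_limit_iso[OF \<psi> _ _ lb(1)]]) (use a lc l' in auto)
    moreover have "same_boundary_limit \<Gamma> S (\<lambda>n. l' (- int n)) (\<lambda>n. \<psi> ((inv a) [^] n))"
      by (rule same_boundary_limit_trans[OF l'(5) same_boundary_limit_iso[OF \<psi> _ _ lb(2)]]) (use a lc l' in auto)
    ultimately have "l' \<in> geod_lines \<Gamma> S (\<psi> a)"
      using l' a unfolding geod_lines_def by (simp add: h.hom_nat_pow)
    then show "\<exists>l'\<in>geod_lines \<Gamma> S (\<psi> a). \<forall>m. \<exists>t. dS (\<psi> (l m)) (l' t) \<le> D" using l'(3) by blast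
  qed
qed

lemma dS_one_pow_le:
  assumes b: "b \<in> carrier \<Gamma>"
  shows "dS \<one> (b [^] (n::nat)) \<le> real (len b) * real n"
proof (induction n)
  case (Suc n)
  have "dS \<one> (b [^] Suc n) \<le> dS \<one> (b [^] n) + dS (b [^] n) (b [^] n \<otimes> b)"
    using dS_tri[of \<one> "b [^] n" "b [^] Suc n"] b by simp
  also have "dS (b [^] n) (b [^] n \<otimes> b) = real (len b)"
    using dS_left_mult[of \<one> b "b [^] n"] b by (simp add: dS_one)
  finally show ?case using Suc by (simp add: algebra_simps)
qed (simp add: dS_refl)

text \<open>Linear escape makes the integer powers of \<open>b\<close> a quasi-geodesic, and the
  line that it fellow-travels has the ends of the powers of \<open>b\<close> and of its inverse.
  Here \<open>D\<close> may depend on \<open>b\<close>, since it will only enter a growth rate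
  additively.\<close>

lemma escaping_powers_line:
  assumes b: "b \<in> carrier \<Gamma>" and \<alpha>: "0 < \<alpha>" and esc: "\<And>n::nat. \<alpha> * real n - B \<le> dS \<one> (b [^] n)"
  obtains l D where "l \<in> geod_lines \<Gamma> S b" "0 \<le> D" "\<And>n::nat. \<exists>t. dS (b [^] n) (l t) \<le> D"
proof -
  define f where "f i = b [^] i" for i :: int
  have fc: "f i \<in> carrier \<Gamma>" for i unfolding f_def using b by simp
  define K where "K = max 1 (1 / \<alpha>)"
  have K: "1 \<le> K" unfolding K_def by simp
  have fd: "dS (f i) (f j) = dS \<one> (b [^] nat \<bar>i - j\<bar>)" for i j
  proof -
    have *: "dS (f i) (f j) = dS \<one> (b [^] nat \<bar>i - j\<bar>)" if "i \<le> j" for i j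
    proof -
      have "f j = f i \<otimes> b [^] (j - i)" unfolding f_def using b by (simp add: int_pow_mult[symmetric])
      also have "b [^] (j - i) = b [^] nat \<bar>i - j\<bar>" using that by (simp add: int_pow_int[symmetric])
      finally show ?thesis using dS_left_mult[OF one_closed _ fc, of "b [^] nat \<bar>i - j\<bar>" i] b fc by simp
    qed
    show ?thesis using *[of i j] *[of j i] dS_sym[OF fc fc, of i j] by (cases "i \<le> j") (auto simp: abs_minus_commute)
  qed
  have "qgeod_on dS K (max 0 B) (real (len b)) UNIV f"
    unfolding qgeod_on_def
  proof (intro ballI)
    fix i j :: int
    define n where "n = nat \<bar>i - j\<bar>"
    have n: "\<bar>real_of_int (i - j)\<bar> = real n" unfolding n_def by simp
    have "real n / K \<le> \<alpha> * real n"
    proof -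
      have "1 / K \<le> \<alpha>" using \<alpha> K unfolding K_def by (auto simp: divide_le_eq max_def field_simps)
      then have "1 / K * real n \<le> \<alpha> * real n" by (intro mult_right_mono) auto
      then show ?thesis by simp
    qed
    then show "\<bar>real_of_int (i - j)\<bar> / K - max 0 B \<le> dS (f i) (f j) \<and> dS (f i) (f j) \<le> real (len b) * \<bar>real_of_int (i - j)\<bar>"
      using dS_one_pow_le[OF b, of n] esc[of n] n fd[of i j] unfolding n_def[symmetric] by auto
  qed
  then obtain D l where D: "0 \<le> D" and l: "\<And>n. l n \<in> carrier \<Gamma>" "\<And>m n. dS (l m) (l n) = real_of_int \<bar>m - n\<bar>"
        "\<And>m. \<exists>t. dS (f m) (l t) \<le> D"
        "same_boundary_limit \<Gamma> S (\<lambda>n. l (int n)) (\<lambda>n. f (int n))"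
        "same_boundary_limit \<Gamma> S (\<lambda>n. l (- int n)) (\<lambda>n. f (- int n))"
    using qgeod_fellow_travels_line[OF K, of "max 0 B" "real (len b)"] fc
    by (metis max.cobounded1 of_nat_0_le_iff)
  have "f (int n) = b [^] n" "f (- int n) = (inv b) [^] n" for n
    unfolding f_def using b by (simp_all add: int_pow_int int_pow_neg_int nat_pow_inv)
  then have "l \<in> geod_lines \<Gamma> S b" using l unfolding geod_lines_def by simp
  moreover have "\<exists>t. dS (b [^] n) (l t) \<le> D" for n :: nat
    using l(3)[of "int n"] \<open>f (int n) = b [^] n\<close> by simp
  ultimately show ?thesis using that D by blast
qed

end

section \<open>Representations into the isometry group\<close>

lemma Isom_dist: "h \<in> Isom \<Longrightarrow> dist (h x) (h y) = dist x y"
  and Isom_surj: "h \<in> Isom \<Longrightarrow> surj h"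
  unfolding Isom_def by auto

lemma Isom_inj: "h \<in> Isom \<Longrightarrow> inj h"
  unfolding inj_def by (metis Isom_dist dist_eq_0_iff)

lemma Isom_inverse:
  assumes "h \<in> Isom"
  shows "inv_into UNIV h (h x) = x" "h (inv_into UNIV h x) = x" "inv_into UNIV h \<in> Isom"
proof -
  have bij: "bij h" using Isom_inj[OF assms] Isom_surj[OF assms] by (simp add: bij_def)
  show 1: "inv_into UNIV h (h x) = x" "h (inv_into UNIV h x) = x" for x
    using bij by (simp_all add: bij_is_inj bij_is_surj inv_f_f surj_f_inv_f)
  have "dist (inv_into UNIV h x) (inv_into UNIV h y) = dist x y" for x y
    using Isom_dist[OF assms, of "inv_into UNIV h x" "inv_into UNIV h y"] 1 by simp
  then show "inv_into UNIV h \<in> Isom"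
    unfolding Isom_def using bij by (simp add: bij_is_inj inj_imp_surj_inv)
qed

lemma Isom_comp: "h \<in> Isom \<Longrightarrow> k \<in> Isom \<Longrightarrow> h \<circ> k \<in> Isom"
  using comp_surj[of k h] unfolding Isom_def by (auto simp: comp_def)

lemma Isom_id: "(\<lambda>x. x) \<in> Isom"
  unfolding Isom_def by auto

text \<open>Conjugation becomes an intertwining relation, free of \<open>inv_into\<close>, which is
  easier to invert and to combine.\<close>

lemma conj_class_iff:
  "\<sigma> \<in> conj_class \<Gamma> \<rho> \<longleftrightarrow> \<sigma> \<in> Hom_Isom \<Gamma> \<and> (\<exists>h\<in>Isom. \<forall>g\<in>carrier \<Gamma>. \<forall>x. \<sigma> g (h x) = h (\<rho> g x))"
proof -
  have "(\<sigma> g = h \<circ> \<rho> g \<circ> inv_into UNIV h) \<longleftrightarrow> (\<forall>x. \<sigma> g (h x) = h (\<rho> g x))" if "h \<in> Isom" for h g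
    using Isom_inverse[OF that] by (auto simp: fun_eq_iff) metis
  then show ?thesis unfolding conj_class_def by auto
qed

lemma conj_class_refl: "\<rho> \<in> Hom_Isom \<Gamma> \<Longrightarrow> \<rho> \<in> conj_class \<Gamma> \<rho>"
  unfolding conj_class_iff using Isom_id by auto

lemma conj_class_sym:
  assumes "\<sigma> \<in> conj_class \<Gamma> \<rho>" "\<rho> \<in> Hom_Isom \<Gamma>"
  shows "\<rho> \<in> conj_class \<Gamma> \<sigma>"
proof -
  obtain h where h: "h \<in> Isom" "\<forall>g\<in>carrier \<Gamma>. \<forall>x. \<sigma> g (h x) = h (\<rho> g x)" using assms unfolding conj_class_iff by auto
  have "\<rho> g (inv_into UNIV h x) = inv_into UNIV h (\<sigma> g x)" if "g \<in> carrier \<Gamma>" for g x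
    using h(2) that Isom_inverse[OF h(1)] by metis
  then show ?thesis unfolding conj_class_iff using assms(2) Isom_inverse(3)[OF h(1)] by auto
qed

section \<open>The topologies on isometries, representations and classes\<close>

lemma openin_quotient_top:
  "openin (quotient_top T q) U \<longleftrightarrow> U \<subseteq> q ` topspace T \<and> openin T {x \<in> topspace T. q x \<in> U}"
proof -
  have "istopology (\<lambda>U. U \<subseteq> q ` topspace T \<and> openin T {x \<in> topspace T. q x \<in> U})"
    unfolding istopology_def
  proof (rule conjI; intro allI impI)
    fix U V assume "U \<subseteq> q ` topspace T \<and> openin T {x \<in> topspace T. q x \<in> U}"
       "V \<subseteq> q ` topspace T \<and> openin T {x \<in> topspace T. q x \<in> V}"
    moreover have "{x \<in> topspace T. q x \<in> U \<inter> V} = {x \<in> topspace T. q x \<in> U} \<inter> {x \<in> topspace T. q x \<in> V}" by auto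
    ultimately show "U \<inter> V \<subseteq> q ` topspace T \<and> openin T {x \<in> topspace T. q x \<in> U \<inter> V}" by auto
  next
    fix \<K> assume "\<forall>K\<in>\<K>. K \<subseteq> q ` topspace T \<and> openin T {x \<in> topspace T. q x \<in> K}"
    moreover have "{x \<in> topspace T. q x \<in> \<Union>\<K>} = (\<Union>K\<in>\<K>. {x \<in> topspace T. q x \<in> K})" by auto
    ultimately show "\<Union>\<K> \<subseteq> q ` topspace T \<and> openin T {x \<in> topspace T. q x \<in> \<Union>\<K>}" by auto
  qed
  then show ?thesis unfolding quotient_top_def by (simp add: topology_inverse')
qed

lemma topspace_compact_open_Isom: "topspace (compact_open_Isom :: ('x::metric_space \<Rightarrow> 'x) topology) = Isom"
proof -
  have "Isom \<in> {{f \<in> Isom. f ` K \<subseteq> U} | K (U::'x set). compact K \<and> open U}"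
    by (intro CollectI exI[of _ "{}"]) auto
  then have "\<Union>{{f \<in> Isom. f ` K \<subseteq> U} | K (U::'x set). compact K \<and> open U} = Isom" by blast
  then show ?thesis unfolding compact_open_Isom_def topology_generated_by_topspace .
qed

text \<open>A singleton is compact, so evaluation at a point is continuous. Finitely many such
  conditions on the generators will control a representation on any ball of the group.\<close>

lemma openin_compact_open_Isom_point:
  "open U \<Longrightarrow> openin compact_open_Isom {f \<in> Isom. f x \<in> (U :: 'x::metric_space set)}"
  unfolding compact_open_Isom_def
  by (intro topology_generated_by_Basis CollectI exI[of _ "{x}"] exI[of _ U]) auto

lemma topspace_Hom_top:
  assumes "S \<subseteq> carrier \<Gamma>"
  shows "topspace (Hom_top \<Gamma> S) = Hom_Isom \<Gamma>"
  using assms unfolding Hom_top_def topspace_pullback_topology topspace_product_topology topspace_compact_open_Isom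
  by (auto simp: Hom_Isom_def subset_iff)

lemma openin_Hom_top_point:
  assumes S: "S \<subseteq> carrier \<Gamma>" and s: "s \<in> S" and U: "open U"
  shows "openin (Hom_top \<Gamma> S) {\<sigma> \<in> Hom_Isom \<Gamma>. \<sigma> s x \<in> (U :: 'x::metric_space set)}"
proof -
  let ?P = "product_topology (\<lambda>s. compact_open_Isom :: ('x \<Rightarrow> 'x) topology) S"
  let ?V = "{f \<in> Isom. f x \<in> U}"
  have "openin ?P {r \<in> topspace ?P. r s \<in> ?V}"
    using continuous_map_product_projection[OF s] openin_compact_open_Isom_point[OF U]
    by (rule openin_continuous_map_preimage)
  moreover have "{\<sigma> \<in> Hom_Isom \<Gamma>. \<sigma> s x \<in> U} = (\<lambda>\<rho>. restrict \<rho> S) -` {r \<in> topspace ?P. r s \<in> ?V} \<inter> Hom_Isom \<Gamma>"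
    using S s unfolding topspace_product_topology topspace_compact_open_Isom
    by (auto simp: Hom_Isom_def)
  ultimately show ?thesis unfolding Hom_top_def openin_pullback_topology by blast
qed

text \<open>Basic neighbourhoods are given by finitely many test points; conjugating by an isometry
  only moves the centre and the test points and leaves \<open>\<epsilon>\<close> unchanged.\<close>

definition rep_nbhd :: "('g, 'b) monoid_scheme \<Rightarrow> 'g set \<Rightarrow> ('g \<Rightarrow> ('x::metric_space \<Rightarrow> 'x)) \<Rightarrow> 'x set \<Rightarrow> real
    \<Rightarrow> ('g \<Rightarrow> ('x \<Rightarrow> 'x)) set" where
  "rep_nbhd \<Gamma> S \<rho> F \<epsilon> = {\<sigma> \<in> Hom_Isom \<Gamma>. \<forall>s\<in>S. \<forall>y\<in>F. dist (\<sigma> s y) (\<rho> s y) < \<epsilon>}"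

lemma openin_rep_nbhd:
  assumes "S \<subseteq> carrier \<Gamma>" "finite S" "finite F"
  shows "openin (Hom_top \<Gamma> S) (rep_nbhd \<Gamma> S \<rho> F \<epsilon>)"
proof -
  have "openin (Hom_top \<Gamma> S) {\<sigma> \<in> Hom_Isom \<Gamma>. dist (\<sigma> (fst p) (snd p)) (\<rho> (fst p) (snd p)) < \<epsilon>}" if "p \<in> S \<times> F" for p
    using openin_Hom_top_point[of S \<Gamma> "fst p" "ball (\<rho> (fst p) (snd p)) \<epsilon>" "snd p"] that assms
    by (auto simp: dist_commute)
  then have "openin (Hom_top \<Gamma> S) (topspace (Hom_top \<Gamma> S) \<inter>
      (\<Inter>p\<in>S \<times> F. {\<sigma> \<in> Hom_Isom \<Gamma>. dist (\<sigma> (fst p) (snd p)) (\<rho> (fst p) (snd p)) < \<epsilon>}))"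
    using assms by (intro openin_Int_Inter) auto
  moreover have "topspace (Hom_top \<Gamma> S) \<inter> (\<Inter>p\<in>S \<times> F. {\<sigma> \<in> Hom_Isom \<Gamma>. dist (\<sigma> (fst p) (snd p)) (\<rho> (fst p) (snd p)) < \<epsilon>})
      = rep_nbhd \<Gamma> S \<rho> F \<epsilon>"
    unfolding topspace_Hom_top[OF assms(1)] rep_nbhd_def by auto
  ultimately show ?thesis by simp
qed

section \<open>Orbit maps and the discrete form of stability\<close>

lemma rep_dist: "\<rho> \<in> Hom_Isom \<Gamma> \<Longrightarrow> g \<in> carrier \<Gamma> \<Longrightarrow> dist (\<rho> g x) (\<rho> g y) = dist x y"
  unfolding Hom_Isom_def by (auto simp: Isom_dist)

lemma rep_mult: "\<rho> \<in> Hom_Isom \<Gamma> \<Longrightarrow> g \<in> carrier \<Gamma> \<Longrightarrow> h \<in> carrier \<Gamma> \<Longrightarrow> \<rho> (g \<otimes>\<^bsub>\<Gamma>\<^esub> h) x = \<rho> g (\<rho> h x)"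
  unfolding Hom_Isom_def by auto

definition conj_rep :: "('g, 'b) monoid_scheme \<Rightarrow> ('x::metric_space \<Rightarrow> 'x) \<Rightarrow> ('g \<Rightarrow> ('x \<Rightarrow> 'x)) \<Rightarrow> 'g \<Rightarrow> ('x \<Rightarrow> 'x)" where
  "conj_rep \<Gamma> h \<rho> = (\<lambda>g. if g \<in> carrier \<Gamma> then h \<circ> \<rho> g \<circ> inv_into UNIV h else undefined)"

text \<open>Stability with its constants exposed, so that uniformity can be tracked. Distances are
  sampled at vertices, and only the lower bound is recorded, because the displacement of the
  generators supplies the upper one.\<close>

definition stable_with :: "('g, 'b) monoid_scheme \<Rightarrow> 'g set \<Rightarrow> 'g set \<Rightarrow> ('g \<Rightarrow> ('x::metric_space \<Rightarrow> 'x)) \<Rightarrow> real \<Rightarrow> real \<Rightarrow> 'x \<Rightarrow> bool" where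
  "stable_with \<Gamma> S A \<rho> K C x \<longleftrightarrow> (\<forall>a\<in>A. infinite_order \<Gamma> a \<longrightarrow> (\<forall>l\<in>geod_lines \<Gamma> S a. \<forall>m n.
      real_of_int \<bar>m - n\<bar> / K - C \<le> dist (\<rho> (l m) x) (\<rho> (l n) x)))"

text \<open>\<open>A_stable\<close> constrains all orbit paths of a line, so it yields inequalities
  between vertices only once such a path is known to exist.\<close>

lemma exists_orbit_path:
  assumes "geodesic_space (UNIV :: 'x::metric_space set)"
  obtains \<gamma> :: "real \<Rightarrow> 'x::metric_space" where "orbit_path \<rho> x l \<gamma>"
proof -
  obtain c :: "'x \<Rightarrow> 'x \<Rightarrow> real \<Rightarrow> 'x" where c: "\<And>x y. c x y 0 = x" "\<And>x y. c x y (dist x y) = y"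
      "\<And>x y s t. s \<in> {0..dist x y} \<Longrightarrow> t \<in> {0..dist x y} \<Longrightarrow> dist (c x y s) (c x y t) = \<bar>s - t\<bar>"
    using assms unfolding geodesic_space_def by metis
  define y where "y n = \<rho> (l n) x" for n
  define \<gamma> where "\<gamma> t = c (y \<lfloor>t\<rfloor>) (y (\<lfloor>t\<rfloor> + 1)) (frac t * dist (y \<lfloor>t\<rfloor>) (y (\<lfloor>t\<rfloor> + 1)))" for t
  have \<gamma>: "\<gamma> (real_of_int n + s) = c (y n) (y (n + 1)) (s * dist (y n) (y (n + 1)))" if "s \<in> {0..1}" for n s
  \<comment> \<open>At \<open>s = 1\<close> the floor has moved on to the next segment, whose
    starting point is the end of the present one.\<close>
  proof (cases "s = 1")
    case True
    then have "\<gamma> (real_of_int n + s) = \<gamma> (real_of_int (n + 1))" by simp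
    also have "\<dots> = y (n + 1)" unfolding \<gamma>_def floor_of_int frac_of_int using c(1) by simp
    finally show ?thesis using True c(2) by simp
  next
    case False
    then have "\<lfloor>real_of_int n + s\<rfloor> = n" using that by (intro floor_unique) auto
    then show ?thesis unfolding \<gamma>_def frac_def by simp
  qed
  have "orbit_path \<rho> x l \<gamma>" unfolding orbit_path_def
  proof (intro allI conjI ballI)
    fix n show "\<gamma> (real_of_int n) = \<rho> (l n) x" using \<gamma>[of 0 n] c(1) unfolding y_def by simp
    fix s t :: real assume st: "s \<in> {0..1}" "t \<in> {0..1}"
    let ?d = "dist (y n) (y (n + 1))"
    have "dist (\<gamma> (real_of_int n + s)) (\<gamma> (real_of_int n + t)) = \<bar>s * ?d - t * ?d\<bar>"
      unfolding \<gamma>[OF st(1)] \<gamma>[OF st(2)] using st by (intro c(3)) (auto intro: mult_left_le_one_le)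
    also have "\<dots> = \<bar>s - t\<bar> * ?d" by (simp add: left_diff_distrib[symmetric] abs_mult)
    finally show "dist (\<gamma> (real_of_int n + s)) (\<gamma> (real_of_int n + t)) = \<bar>s - t\<bar> * dist (\<rho> (l n) x) (\<rho> (l (n + 1)) x)"
      unfolding y_def .
  qed
  then show ?thesis by (rule that)
qed

context fin_gen_group
begin

lemma rep_one: "\<rho> \<in> Hom_Isom \<Gamma> \<Longrightarrow> \<rho> \<one> x = x"
  using rep_dist[of \<rho> \<Gamma> \<one> "\<rho> \<one> x" x] rep_mult[of \<rho> \<Gamma> \<one> \<one> x] by simp

lemma rep_inv: "\<rho> \<in> Hom_Isom \<Gamma> \<Longrightarrow> g \<in> carrier \<Gamma> \<Longrightarrow> \<rho> g (\<rho> (inv g) x) = x"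
  using rep_mult[of \<rho> \<Gamma> g "inv g" x] rep_one[of \<rho> x] by simp

lemma rep_dist_left: "\<rho> \<in> Hom_Isom \<Gamma> \<Longrightarrow> g \<in> carrier \<Gamma> \<Longrightarrow> h \<in> carrier \<Gamma> \<Longrightarrow>
    dist (\<rho> g x) (\<rho> h x) = dist x (\<rho> (inv g \<otimes> h) x)"
  using rep_dist[of \<rho> \<Gamma> g x "\<rho> (inv g \<otimes> h) x"] rep_mult[of \<rho> \<Gamma> g "inv g \<otimes> h" x]
  by (simp add: mult_inv_cancel)

lemma rep_lipschitz:
  assumes \<rho>: "\<rho> \<in> Hom_Isom \<Gamma>" and M: "0 \<le> M" "\<And>s. s \<in> S \<Longrightarrow> dist x (\<rho> s x) \<le> M"
    and gh: "g \<in> carrier \<Gamma>" "h \<in> carrier \<Gamma>"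
  shows "dist (\<rho> g x) (\<rho> h x) \<le> M * dS g h"
proof -
  have letter: "dist x (\<rho> s x) \<le> M" if s: "s \<in> letters" for s
  proof (cases "s \<in> S")
    case False
    then obtain t where t: "t \<in> S" "s = inv t" using s by auto
    then have "t \<in> carrier \<Gamma>" using S_sub by auto
    then have "dist x (\<rho> s x) = dist (\<rho> t x) x"
      using rep_dist[OF \<rho>, of t x "\<rho> (inv t) x"] rep_inv[OF \<rho>, of t x] t by simp
    then show ?thesis using M(2)[OF t(1)] by (simp add: dist_commute)
  qed (rule M(2))
  have w: "dist x (\<rho> (wprod ws) x) \<le> M * real (length ws)" if "set ws \<subseteq> letters" for ws
    using that
  proof (induction ws)
    case (Cons a ws)
    have c: "a \<in> carrier \<Gamma>" "wprod ws \<in> carrier \<Gamma>" using Cons.prems letters_closed wprod_closed[of ws] by auto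
    have "dist x (\<rho> (wprod (a # ws)) x) \<le> dist x (\<rho> a x) + dist (\<rho> a x) (\<rho> a (\<rho> (wprod ws) x))"
      using rep_mult[OF \<rho> c, of x] dist_triangle[of x "\<rho> a (\<rho> (wprod ws) x)" "\<rho> a x"] by simp
    also have "\<dots> \<le> M + M * real (length ws)"
      using Cons letter[of a] rep_dist[OF \<rho> c(1)] by (intro add_mono) auto
    finally show ?case by (simp add: algebra_simps)
  qed (simp add: rep_one[OF \<rho>])
  have "inv g \<otimes> h \<in> carrier \<Gamma>" using gh by simp
  then obtain ws where ws: "set ws \<subseteq> letters" "length ws = len (inv g \<otimes> h)" "wprod ws = inv g \<otimes> h"
    by (rule shortest_word)
  show ?thesis using w[OF ws(1)] ws rep_dist_left[OF \<rho> gh, of x] unfolding dS_eq by simp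
qed

text \<open>A sum instead of a maximum, which also covers an empty \<open>S\<close>.\<close>

lemma rep_displacement_bound:
  fixes \<rho> :: "'g \<Rightarrow> ('x::metric_space \<Rightarrow> 'x)"
  obtains M where "0 \<le> M" "\<And>s. s \<in> S \<Longrightarrow> dist x (\<rho> s x) \<le> M"
proof
  show "0 \<le> (\<Sum>s\<in>S. dist x (\<rho> s x))" by (intro sum_nonneg) auto
  show "dist x (\<rho> s x) \<le> (\<Sum>s\<in>S. dist x (\<rho> s x))" if "s \<in> S" for s
    using that finite_S by (intro member_le_sum) auto
qed

lemma geod_lines_closed: "l \<in> geod_lines \<Gamma> S a \<Longrightarrow> l n \<in> carrier \<Gamma>"
  and geod_lines_dist: "l \<in> geod_lines \<Gamma> S a \<Longrightarrow> dS (l m) (l n) = real_of_int \<bar>m - n\<bar>"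
  unfolding geod_lines_def by auto

text \<open>Integer times of an orbit path give the inequality for vertices. Conversely, with
  \<open>M\<close> bounding the displacement of the generators, each point of an orbit path is
  within \<open>M\<close> of the vertex at the floor of its time, so distances change by at most
  \<open>2 * M\<close> and index differences by at most 1.\<close>

lemma A_stable_iff:
  fixes \<rho> :: "'g \<Rightarrow> ('x::metric_space \<Rightarrow> 'x)"
  assumes \<rho>: "\<rho> \<in> Hom_Isom \<Gamma>" and X: "geodesic_space (UNIV :: 'x set)"
  shows "A_stable \<Gamma> S A \<rho> \<longleftrightarrow> (\<exists>K\<ge>1. \<exists>C\<ge>0. \<exists>x. stable_with \<Gamma> S A \<rho> K C x)"
proof
  assume "A_stable \<Gamma> S A \<rho>"
  then obtain K C x where K: "K \<ge> 1" "C \<ge> 0" and st: "\<And>a l \<gamma>. a \<in> A \<Longrightarrow> infinite_order \<Gamma> a \<Longrightarrow>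
      l \<in> geod_lines \<Gamma> S a \<Longrightarrow> orbit_path \<rho> x l \<gamma> \<Longrightarrow> quasi_geodesic K C \<gamma>"
    unfolding A_stable_def by blast
  have "real_of_int \<bar>m - n\<bar> / K - C \<le> dist (\<rho> (l m) x) (\<rho> (l n) x)"
    if "a \<in> A" "infinite_order \<Gamma> a" "l \<in> geod_lines \<Gamma> S a" for a l m n
  proof -
    obtain \<gamma> where \<gamma>: "orbit_path \<rho> x l \<gamma>" using exists_orbit_path[OF X] by metis
    have "\<bar>real_of_int m - real_of_int n\<bar> / K - C \<le> dist (\<gamma> (real_of_int m)) (\<gamma> (real_of_int n))"
      using st[OF that \<gamma>] unfolding quasi_geodesic_def by blast
    then show ?thesis using \<gamma> unfolding orbit_path_def by simp
  qed
  then show "\<exists>K\<ge>1. \<exists>C\<ge>0. \<exists>x. stable_with \<Gamma> S A \<rho> K C x" unfolding stable_with_def using K by blast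
next
  assume "\<exists>K\<ge>1. \<exists>C\<ge>0. \<exists>x. stable_with \<Gamma> S A \<rho> K C x"
  then obtain K C x where K: "K \<ge> 1" "C \<ge> 0" and st: "stable_with \<Gamma> S A \<rho> K C x" by blast
  obtain M where M: "0 \<le> M" "\<And>s. s \<in> S \<Longrightarrow> dist x (\<rho> s x) \<le> M" using rep_displacement_bound by metis
  \<comment> \<open>The lower bound uses up \<open>C + 2 * M + 1 / K\<close>, the upper one
    \<open>2 * M\<close> and another \<open>M\<close> for the index error; \<open>C'\<close> covers
    both.\<close>
  define K' C' where "K' = max K M" and "C' = C + 3 * M + 1 / K"
  have K0: "0 < K" using K by simp
  have "quasi_geodesic K' C' \<gamma>"
    if "a \<in> A" "infinite_order \<Gamma> a" and l: "l \<in> geod_lines \<Gamma> S a" and \<gamma>: "orbit_path \<rho> x l \<gamma>" for a l \<gamma>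
    unfolding quasi_geodesic_def
  proof (intro allI)
    fix s t :: real
    let ?m = "\<lfloor>s\<rfloor>" and ?n = "\<lfloor>t\<rfloor>"
    have near: "dist (\<gamma> u) (\<rho> (l \<lfloor>u\<rfloor>) x) \<le> M" for u
    proof -
      have f: "frac u \<in> {0..1}" using frac_ge_0 frac_lt_1[of u] by simp
      have "dist (\<gamma> (real_of_int \<lfloor>u\<rfloor> + frac u)) (\<gamma> (real_of_int \<lfloor>u\<rfloor> + 0)) = \<bar>frac u - 0\<bar> * dist (\<rho> (l \<lfloor>u\<rfloor>) x) (\<rho> (l (\<lfloor>u\<rfloor> + 1)) x)"
        using \<gamma> f unfolding orbit_path_def by (meson atLeastAtMost_iff order_refl zero_le_one)
      also have "\<dots> \<le> dist (\<rho> (l \<lfloor>u\<rfloor>) x) (\<rho> (l (\<lfloor>u\<rfloor> + 1)) x)"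
        using f by (intro mult_left_le_one_le) auto
      also have "\<dots> \<le> M * 1"
        using rep_lipschitz[where x = x, OF \<rho> M geod_lines_closed[OF l] geod_lines_closed[OF l], of "\<lfloor>u\<rfloor>" "\<lfloor>u\<rfloor> + 1"]
          geod_lines_dist[OF l, of "\<lfloor>u\<rfloor>" "\<lfloor>u\<rfloor> + 1"] by simp
      finally show ?thesis using \<gamma> unfolding orbit_path_def by (simp add: frac_def)
    qed
    let ?d = "dist (\<rho> (l ?m) x) (\<rho> (l ?n) x)" and ?k = "real_of_int \<bar>?m - ?n\<bar>"
    have d: "\<bar>dist (\<gamma> s) (\<gamma> t) - ?d\<bar> \<le> 2 * M"
      using near[of s] near[of t] dist_triangle[of "\<gamma> s" "\<gamma> t" "\<rho> (l ?m) x"]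
        dist_triangle[of "\<rho> (l ?m) x" "\<gamma> t" "\<rho> (l ?n) x"] dist_triangle[of "\<rho> (l ?m) x" "\<rho> (l ?n) x" "\<gamma> s"]
        dist_triangle[of "\<gamma> s" "\<rho> (l ?n) x" "\<gamma> t"]
      unfolding abs_le_iff by (simp add: dist_commute)
    have k: "\<bar>s - t\<bar> \<le> ?k + 1" "?k \<le> \<bar>s - t\<bar> + 1" by linarith+
    have "?k / K - C \<le> ?d" using st that unfolding stable_with_def by blast
    moreover have "\<bar>s - t\<bar> / K \<le> ?k / K + 1 / K"
      using k(1) K0 by (simp add: add_divide_distrib[symmetric] divide_right_mono)
    moreover have "\<bar>s - t\<bar> / K' \<le> \<bar>s - t\<bar> / K"
      unfolding K'_def using K0 by (intro divide_left_mono) auto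
    ultimately have 1: "\<bar>s - t\<bar> / K' - C' \<le> dist (\<gamma> s) (\<gamma> t)" using d M(1) unfolding C'_def by linarith
    have "?d \<le> M * ?k"
      using rep_lipschitz[where x = x, OF \<rho> M geod_lines_closed[OF l] geod_lines_closed[OF l], of ?m ?n] geod_lines_dist[OF l, of ?m ?n] by simp
    also have "\<dots> \<le> M * (\<bar>s - t\<bar> + 1)" using k(2) M(1) by (intro mult_left_mono)
    finally have "?d \<le> M * \<bar>s - t\<bar> + M" by (simp add: algebra_simps)
    moreover have "M * \<bar>s - t\<bar> \<le> K' * \<bar>s - t\<bar>" unfolding K'_def by (intro mult_right_mono) auto
    moreover have "0 \<le> 1 / K" using K0 by simp
    ultimately have "dist (\<gamma> s) (\<gamma> t) \<le> K' * \<bar>s - t\<bar> + C'" using d K(2) unfolding C'_def by linarith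
    with 1 show "\<bar>s - t\<bar> / K' - C' \<le> dist (\<gamma> s) (\<gamma> t) \<and> dist (\<gamma> s) (\<gamma> t) \<le> K' * \<bar>s - t\<bar> + C'" by blast
  qed
  moreover have "K' \<ge> 1" "C' \<ge> 0" unfolding K'_def C'_def using K M(1) K0 by auto
  ultimately show "A_stable \<Gamma> S A \<rho>" unfolding A_stable_def by blast
qed

lemma stable_with_mono:
  assumes "stable_with \<Gamma> S A \<rho> K C x" "0 < K" "K \<le> K'" "C \<le> C'"
  shows "stable_with \<Gamma> S A \<rho> K' C' x"
  unfolding stable_with_def
proof (intro ballI impI allI)
  fix a l and m n :: int
  assume *: "a \<in> A" "infinite_order \<Gamma> a" "l \<in> geod_lines \<Gamma> S a"
  have "real_of_int \<bar>m - n\<bar> / K' \<le> real_of_int \<bar>m - n\<bar> / K"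
    using assms by (intro divide_left_mono) auto
  moreover have "real_of_int \<bar>m - n\<bar> / K - C \<le> dist (\<rho> (l m) x) (\<rho> (l n) x)"
    using assms * unfolding stable_with_def by blast
  ultimately show "real_of_int \<bar>m - n\<bar> / K' - C' \<le> dist (\<rho> (l m) x) (\<rho> (l n) x)" using assms(4) by linarith
qed

lemma stable_with_conj:
  assumes "stable_with \<Gamma> S A \<rho> K C x" "h \<in> Isom" "\<And>g x. g \<in> carrier \<Gamma> \<Longrightarrow> \<sigma> g (h x) = h (\<rho> g x)"
  shows "stable_with \<Gamma> S A \<sigma> K C (h x)"
  using assms(1) unfolding stable_with_def by (simp add: assms(3) geod_lines_closed Isom_dist[OF assms(2)])

lemma conj_rep:
  assumes \<rho>: "\<rho> \<in> Hom_Isom \<Gamma>" and h: "h \<in> Isom"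
  shows "conj_rep \<Gamma> h \<rho> \<in> Hom_Isom \<Gamma>" and "g \<in> carrier \<Gamma> \<Longrightarrow> conj_rep \<Gamma> h \<rho> g (h x) = h (\<rho> g x)"
proof -
  have "\<rho> g \<in> Isom" if "g \<in> carrier \<Gamma>" for g using \<rho> that unfolding Hom_Isom_def by auto
  moreover have "\<rho> (g \<otimes> k) = \<rho> g \<circ> \<rho> k" if "g \<in> carrier \<Gamma>" "k \<in> carrier \<Gamma>" for g k
    using \<rho> that unfolding Hom_Isom_def by auto
  ultimately show "conj_rep \<Gamma> h \<rho> \<in> Hom_Isom \<Gamma>"
    using h Isom_inverse[OF h] unfolding Hom_Isom_def conj_rep_def
    by (auto intro!: Isom_comp simp: fun_eq_iff)
  show "g \<in> carrier \<Gamma> \<Longrightarrow> conj_rep \<Gamma> h \<rho> g (h x) = h (\<rho> g x)"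
    unfolding conj_rep_def using Isom_inverse[OF h] by simp
qed

lemma rep_nbhd_conj:
  assumes "\<tau> \<in> rep_nbhd \<Gamma> S \<rho> F \<epsilon>" and h: "h \<in> Isom" and "\<sigma> \<in> Hom_Isom \<Gamma>"
    and "\<And>g x. g \<in> carrier \<Gamma> \<Longrightarrow> \<sigma> g (h x) = h (\<tau> g x)"
    and "\<And>g x. g \<in> carrier \<Gamma> \<Longrightarrow> \<rho>' g (h x) = h (\<rho> g x)"
  shows "\<sigma> \<in> rep_nbhd \<Gamma> S \<rho>' (h ` F) \<epsilon>"
  using assms S_sub unfolding rep_nbhd_def by (auto simp: Isom_dist[OF h] subset_iff)

text \<open>Telescoping along a shortest word: isometries propagate earlier errors unchanged, so
  each letter adds at most \<open>\<epsilon>\<close>. The test points are the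
  \<open>\<rho>\<close>-orbit of \<open>x\<close> over the ball, because the error of a letter is
  measured at a point of that orbit.\<close>

lemma rep_nbhd_close_on_ball:
  fixes \<rho> :: "'g \<Rightarrow> ('x::metric_space \<Rightarrow> 'x)"
  assumes \<rho>: "\<rho> \<in> Hom_Isom \<Gamma>"
  obtains F \<epsilon> where "finite F" "0 < \<epsilon>"
    "\<And>\<sigma> g. \<sigma> \<in> rep_nbhd \<Gamma> S \<rho> F \<epsilon> \<Longrightarrow> g \<in> carrier \<Gamma> \<Longrightarrow> len g \<le> n \<Longrightarrow> dist (\<sigma> g x) (\<rho> g x) \<le> 1"
proof -
  define F where "F = (\<lambda>g. \<rho> g x) ` {g \<in> carrier \<Gamma>. len g \<le> n}"
  define \<epsilon> where "\<epsilon> = 1 / real (Suc n)"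
  have \<epsilon>: "0 < \<epsilon>" unfolding \<epsilon>_def by simp
  have "finite F" unfolding F_def using finite_ball by simp
  moreover note \<epsilon>
  moreover have "dist (\<sigma> g x) (\<rho> g x) \<le> 1" if nb: "\<sigma> \<in> rep_nbhd \<Gamma> S \<rho> F \<epsilon>" "g \<in> carrier \<Gamma>" "len g \<le> n" for \<sigma> g
  proof -
    have \<sigma>: "\<sigma> \<in> Hom_Isom \<Gamma>" and close: "\<And>s h. s \<in> S \<Longrightarrow> h \<in> carrier \<Gamma> \<Longrightarrow> len h \<le> n \<Longrightarrow>
        dist (\<sigma> s (\<rho> h x)) (\<rho> s (\<rho> h x)) \<le> \<epsilon>"
      using nb(1) unfolding rep_nbhd_def F_def by (auto intro: less_imp_le)
    have w: "dist (\<sigma> (wprod ws) x) (\<rho> (wprod ws) x) \<le> \<epsilon> * real (length ws)" if "set ws \<subseteq> letters" "length ws \<le> n" for ws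
      using that
    proof (induction ws)
      case (Cons a ws)
      have c: "a \<in> carrier \<Gamma>" "wprod ws \<in> carrier \<Gamma>" using Cons.prems letters_closed wprod_closed[of ws] by auto
      define y where "y = \<rho> (wprod ws) x"
      have "dist (\<sigma> a y) (\<rho> a y) \<le> \<epsilon>"
      proof (cases "a \<in> S")
        case True
        then show ?thesis unfolding y_def using close c len_wprod_le[of ws] Cons.prems by auto
      next
        case False
        then obtain s where s: "s \<in> S" "a = inv s" using Cons.prems by auto
        then have sc: "s \<in> carrier \<Gamma>" using S_sub by auto
        have z: "\<rho> a y = \<rho> (wprod (a # ws)) x" unfolding y_def using rep_mult[OF \<rho> c] by simp
        \<comment> \<open>For an inverse letter the error is moved through the isometry
          \<open>\<sigma> s\<close> and becomes the error of \<open>s\<close> at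
          \<open>\<rho> a y\<close>, again a test point because the longer word still has length at
          most \<open>n\<close>.\<close>
        have "dist (\<sigma> a y) (\<rho> a y) = dist (\<sigma> s (\<sigma> a y)) (\<sigma> s (\<rho> a y))" using rep_dist[OF \<sigma> sc] by simp
        also have "\<dots> = dist (\<rho> s (\<rho> a y)) (\<sigma> s (\<rho> a y))"
          using rep_inv[OF \<sigma> sc] rep_inv[OF \<rho> sc] s by simp
        also have "\<dots> \<le> \<epsilon>"
          unfolding z using close[OF s(1) wprod_closed[OF Cons.prems(1)]] len_wprod_le[OF Cons.prems(1)] Cons.prems(2)
          by (simp add: dist_commute)
        finally show ?thesis .
      qed
      moreover have "dist (\<sigma> a (\<sigma> (wprod ws) x)) (\<sigma> a y) \<le> \<epsilon> * real (length ws)"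
        unfolding y_def using Cons rep_dist[OF \<sigma> c(1)] by simp
      ultimately have "dist (\<sigma> a (\<sigma> (wprod ws) x)) (\<rho> a y) \<le> \<epsilon> * real (length ws) + \<epsilon>"
        using dist_triangle[of "\<sigma> a (\<sigma> (wprod ws) x)" "\<rho> a y" "\<sigma> a y"] by linarith
      then show ?case using rep_mult[OF \<rho> c] rep_mult[OF \<sigma> c] unfolding y_def by (simp add: algebra_simps)
    qed (simp add: rep_one[OF \<rho>] rep_one[OF \<sigma>])
    obtain ws where ws: "set ws \<subseteq> letters" "length ws = len g" "wprod ws = g"
      using nb(2) by (rule shortest_word)
    have "dist (\<sigma> g x) (\<rho> g x) \<le> \<epsilon> * real (len g)" using w[OF ws(1)] ws nb(3) by simp
    also have "\<dots> \<le> \<epsilon> * real (Suc n)" using nb(3) \<epsilon> by (intro mult_left_mono) auto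
    finally show ?thesis unfolding \<epsilon>_def by simp
  qed
  ultimately show ?thesis using that by blast
qed

end

section \<open>Stability under perturbation and under automorphisms\<close>

lemma gromov_space_UNIV:
  assumes "gromov_hyperbolic_on (UNIV :: 'x::metric_space set) dist" "geodesic_space (UNIV :: 'x set)"
  obtains \<delta> where "gromov_space (UNIV :: 'x set) dist \<delta>"
proof -
  obtain \<delta> where \<delta>: "0 \<le> \<delta>" "\<And>x y z w :: 'x. min (gprod dist w x y) (gprod dist w y z) - \<delta> \<le> gprod dist w x z"
    using assms(1) unfolding gromov_hyperbolic_on_def gprod_def by auto
  have "gromov_space (UNIV :: 'x set) dist \<delta>"
  proof
    fix x y :: 'x and t assume t: "0 \<le> t" "t \<le> dist x y"
    obtain c where c: "c 0 = x" "c (dist x y) = y" "\<And>s t. s\<in>{0..dist x y} \<Longrightarrow> t\<in>{0..dist x y} \<Longrightarrow> dist (c s) (c t) = \<bar>s - t\<bar>"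
      using assms(2) unfolding geodesic_space_def by blast
    show "\<exists>z\<in>UNIV. dist x z + dist z y = dist x y \<and> \<bar>dist x z - t\<bar> \<le> 1"
      using c(3)[of 0 t] c(3)[of t "dist x y"] c(1,2) t by (intro bexI[of _ "c t"]) auto
  qed (use \<delta> in \<open>auto simp: dist_commute dist_triangle\<close>)
  then show ?thesis by (rule that)
qed

context fin_gen_group
begin

lemma stable_with_qgeod:
  assumes "\<rho> \<in> Hom_Isom \<Gamma>" "stable_with \<Gamma> S A \<rho> K C x" "0 \<le> M" "\<And>s. s \<in> S \<Longrightarrow> dist x (\<rho> s x) \<le> M"
    and "a \<in> A" "infinite_order \<Gamma> a" "l \<in> geod_lines \<Gamma> S a"
  shows "qgeod_on dist K C M I (\<lambda>n. \<rho> (l n) x)"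
  using assms(2,5,6,7) rep_lipschitz[where x = x, OF assms(1,3,4) geod_lines_closed[OF assms(7)] geod_lines_closed[OF assms(7)]]
    geod_lines_dist[OF assms(7)]
  unfolding qgeod_on_def stable_with_def by simp

text \<open>The bound \<open>D\<close> on Gromov products turns the quasi-geodesic lower bound into
  an excess of two-step over one-step distances that grows with the step length \<open>N\<close>.
  Once a perturbation keeps enough of it, the new orbit advances by at least 1 every
  \<open>N\<close> indices, which is why the new multiplicative constant is
  \<open>N\<close>.\<close>

lemma stable_with_nbhd:
  fixes \<rho> :: "'g \<Rightarrow> ('x::metric_space \<Rightarrow> 'x)"
  assumes "gromov_hyperbolic_on (UNIV :: 'x set) dist" "geodesic_space (UNIV :: 'x set)"
    and \<rho>: "\<rho> \<in> Hom_Isom \<Gamma>" and K: "1 \<le> K" and C: "0 \<le> C" and st: "stable_with \<Gamma> S A \<rho> K C x"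
  obtains F \<epsilon> K' C' M' where "finite F" "0 < \<epsilon>" "1 \<le> K'" "0 \<le> C'" "0 \<le> M'"
    "\<And>\<sigma>. \<sigma> \<in> rep_nbhd \<Gamma> S \<rho> F \<epsilon> \<Longrightarrow> stable_with \<Gamma> S A \<sigma> K' C' x \<and> (\<forall>s\<in>S. dist x (\<sigma> s x) \<le> M')"
proof -
  obtain \<delta> where "gromov_space (UNIV :: 'x set) dist \<delta>" using gromov_space_UNIV assms(1,2) by metis
  then interpret X: gromov_space "UNIV :: 'x set" dist \<delta> .
  obtain M where M: "0 \<le> M" "\<And>s. s \<in> S \<Longrightarrow> dist x (\<rho> s x) \<le> M" using rep_displacement_bound by metis
  obtain D where D: "0 \<le> D"
    "\<And>i j k (y :: int \<Rightarrow> 'x). i \<le> j \<Longrightarrow> j \<le> k \<Longrightarrow> qgeod_on dist K C M {i..k} y \<Longrightarrow>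
       gprod dist (y j) (y i) (y k) \<le> D"
    using X.qgeod_gprod_bounded[OF K C M(1)] by (metis UNIV_I)
  \<comment> \<open>The excess is at least \<open>real N / K - C - 2 * D\<close>. Passing to
    \<open>\<sigma>\<close> changes the two distances compared by at most 1 each, so asking for
    \<open>2 * \<delta> + 3\<close> leaves \<open>2 * \<delta> + 1\<close>, the hypothesis of
    \<open>discrete_local_to_global\<close> with \<open>a = 1\<close>.\<close>
  define N where "N = nat \<lceil>K * (C + 2 * D + 2 * \<delta> + 3)\<rceil>"
  have "1 * 3 \<le> K * (C + 2 * D + 2 * \<delta> + 3)" using K C D(1) X.delta_nonneg by (intro mult_mono) auto
  then have N1: "1 \<le> N" unfolding N_def by linarith
  have "(C + 2 * D + 2 * \<delta> + 3) * K \<le> real N" unfolding N_def by (simp add: mult.commute) linarith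
  then have NK: "C + 2 * D + 2 * \<delta> + 3 \<le> real N / K" using K by (simp add: le_divide_eq)
  obtain F \<epsilon> where F: "finite F" "0 < \<epsilon>" and close:
    "\<And>\<sigma> g. \<sigma> \<in> rep_nbhd \<Gamma> S \<rho> F \<epsilon> \<Longrightarrow> g \<in> carrier \<Gamma> \<Longrightarrow> len g \<le> 2 * N \<Longrightarrow> dist (\<sigma> g x) (\<rho> g x) \<le> 1"
    using rep_nbhd_close_on_ball[OF \<rho>] by metis
  \<comment> \<open>Sampling leaves a remainder of fewer than \<open>N\<close> indices, over which
    the perturbed orbit moves by at most \<open>(M + 1) * N\<close>; the 1 comes from rounding
    \<open>(n - m) / N\<close> down.\<close>
  define C' where "C' = 1 + (M + 1) * real N"
  have main: "stable_with \<Gamma> S A \<sigma> (real N) C' x \<and> (\<forall>s\<in>S. dist x (\<sigma> s x) \<le> M + 1)" if nb: "\<sigma> \<in> rep_nbhd \<Gamma> S \<rho> F \<epsilon>" for \<sigma>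
  proof
    have \<sigma>: "\<sigma> \<in> Hom_Isom \<Gamma>" using nb unfolding rep_nbhd_def by simp
    show M': "\<forall>s\<in>S. dist x (\<sigma> s x) \<le> M + 1"
    proof
      fix s assume s: "s \<in> S"
      have "dist (\<sigma> s x) (\<rho> s x) \<le> 1" using s S_sub len_letter[of s] N1 by (intro close[OF nb]) auto
      then show "dist x (\<sigma> s x) \<le> M + 1"
        using M(2)[OF s] dist_triangle[of x "\<sigma> s x" "\<rho> s x"] by (simp add: dist_commute)
    qed
    show "stable_with \<Gamma> S A \<sigma> (real N) C' x" unfolding stable_with_def
    proof (intro ballI impI allI)
      fix a l and m n :: int
      assume a: "a \<in> A" "infinite_order \<Gamma> a" and l: "l \<in> geod_lines \<Gamma> S a"
      define y z where "y i = \<rho> (l i) x" and "z i = \<sigma> (l i) x" for i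
      have qg: "qgeod_on dist K C M I y" for I
        unfolding y_def by (rule stable_with_qgeod[OF \<rho> st M a l])
      have lowy: "\<bar>real_of_int (i - j)\<bar> / K - C \<le> dist (y i) (y j)" for i j
        using qg[of UNIV] unfolding qgeod_on_def by blast
      have yz: "\<bar>dist (z i) (z j) - dist (y i) (y j)\<bar> \<le> 1" if "\<bar>i - j\<bar> \<le> 2 * int N" for i j
      proof -
        \<comment> \<open>Equivariance reduces both distances to the displacement of
          \<open>x\<close> by one element \<open>g\<close> of length at most \<open>2 * N\<close>,
          so a single neighbourhood serves all lines of all \<open>a\<close>.\<close>
        define g where "g = inv (l i) \<otimes> l j"
        have lc: "l i \<in> carrier \<Gamma>" "l j \<in> carrier \<Gamma>" using geod_lines_closed[OF l] by auto
        have g: "g \<in> carrier \<Gamma>" unfolding g_def using lc by simp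
        have "real (len g) = real_of_int \<bar>i - j\<bar>" using geod_lines_dist[OF l, of i j] unfolding dS_eq g_def .
        then have "len g \<le> 2 * N" using that by linarith
        from close[OF nb g this] show ?thesis
          unfolding y_def z_def rep_dist_left[OF \<rho> lc] rep_dist_left[OF \<sigma> lc] g_def[symmetric]
          using dist_triangle[of x "\<sigma> g x" "\<rho> g x"] dist_triangle[of x "\<rho> g x" "\<sigma> g x"]
          by (simp add: dist_commute abs_le_iff)
      qed
      have step: "real k \<le> dist (z m) (z (m + int k * int N))" for m k
      proof -
        define w where "w i = z (m + int i * int N)" for i
        have *: "max (dist (w i) (w (i+1))) (dist (w (i+1)) (w (i+2))) + 2 * \<delta> + 1 \<le> dist (w i) (w (i+2))" for i
        proof -
          define p where "p = m + int i * int N"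
          have w: "w i = z p" "w (i+1) = z (p + int N)" "w (i+2) = z (p + 2 * int N)"
            unfolding w_def p_def by (simp_all add: algebra_simps)
          have "gprod dist (y (p + int N)) (y p) (y (p + 2 * int N)) \<le> D"
            by (rule D(2)) (use qg in auto)
          then have "dist (y p) (y (p + int N)) + dist (y (p + int N)) (y (p + 2 * int N)) - 2 * D \<le> dist (y p) (y (p + 2 * int N))"
            using gprod_double[of dist "y (p + int N)" "y p" "y (p + 2 * int N)"] by (simp add: dist_commute)
          moreover have "real N / K - C \<le> dist (y p) (y (p + int N))"
              "real N / K - C \<le> dist (y (p + int N)) (y (p + 2 * int N))"
            using lowy[of p "p + int N"] lowy[of "p + int N" "p + 2 * int N"] by simp_all
          ultimately show ?thesis unfolding w
            using yz[of p "p + int N"] yz[of "p + int N" "p + 2 * int N"] yz[of p "p + 2 * int N"] NK by (auto simp: abs_le_iff max_def)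
        qed
        have "1 * real k \<le> dist (w 0) (w k)"
        proof (rule X.discrete_local_to_global)
          show "dist (w i) (w (i+1)) + 2 * \<delta> + 1 \<le> dist (w i) (w (i+2))" for i using *[of i] by simp
          show "dist (w (i+1)) (w (i+2)) + 2 * \<delta> + 1 \<le> dist (w i) (w (i+2))" for i using *[of i] by simp
        qed auto
        then show ?thesis unfolding w_def by simp
      qed
      have bound: "real_of_int (n - m) / real N - C' \<le> dist (z m) (z n)" if "m \<le> n" for m n
      proof -
        define k where "k = nat ((n - m) div int N)"
        define r where "r = (n - m) mod int N"
        have r: "0 \<le> r" "r < int N" unfolding r_def using N1 by auto
        have n: "n = m + int k * int N + r"
          unfolding k_def r_def using that N1 by (simp add: pos_imp_zdiv_nonneg_iff)
        have "dist (z (m + int k * int N)) (z n) \<le> (M + 1) * real_of_int r"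
          using rep_lipschitz[where x = x, OF \<sigma> _ _ geod_lines_closed[OF l] geod_lines_closed[OF l], of "M + 1" "m + int k * int N" n] M(1) M' r
            geod_lines_dist[OF l, of "m + int k * int N" n] n unfolding z_def by simp
        also have "\<dots> \<le> (M + 1) * real N" using r M(1) by (intro mult_left_mono) auto
        finally have "real k - (M + 1) * real N \<le> dist (z m) (z n)"
          using step[of k m] dist_triangle[of "z m" "z (m + int k * int N)" "z n"] by (simp add: dist_commute)
        moreover have "real_of_int (n - m) / real N \<le> real k + 1"
        proof -
          have "real_of_int (n - m) = real k * real N + real_of_int r" using n by simp
          also have "\<dots> \<le> (real k + 1) * real N" using r by (simp add: algebra_simps)
          finally show ?thesis using N1 by (simp add: divide_le_eq)
        qed
        ultimately show ?thesis unfolding C'_def by linarith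
      qed
      show "real_of_int \<bar>m - n\<bar> / real N - C' \<le> dist (\<sigma> (l m) x) (\<sigma> (l n) x)"
        using bound[of m n] bound[of n m] unfolding z_def by (cases "m \<le> n") (auto simp: dist_commute)
    qed
  qed
  have "1 \<le> real N" "0 \<le> C'" "0 \<le> M + 1" unfolding C'_def using N1 M(1) by auto
  then show ?thesis using that[OF F] main by blast
qed

end

context hyp_group
begin

text \<open>The image under \<open>\<psi>\<close> of a line of \<open>a\<close> is replaced by the
  line of \<open>\<psi> a\<close> that it fellow-travels, where stability of \<open>\<rho>\<close>
  applies; \<open>Q\<close> accounts for the distortion of indices.\<close>

lemma stable_with_iso:
  assumes \<rho>: "\<rho> \<in> Hom_Isom \<Gamma>" and K: "1 \<le> K" and C: "0 \<le> C" and st: "stable_with \<Gamma> S A \<rho> K C x"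
    and \<psi>: "\<psi> \<in> iso \<Gamma> \<Gamma>" and A: "\<psi> ` A = A"
    and \<sigma>: "\<And>g. g \<in> carrier \<Gamma> \<Longrightarrow> \<sigma> g = \<rho> (\<psi> g)"
  obtains K' C' where "1 \<le> K'" "0 \<le> C'" "stable_with \<Gamma> S A \<sigma> K' C' x"
proof -
  obtain M where M: "0 \<le> M" "\<And>s. s \<in> S \<Longrightarrow> dist x (\<rho> s x) \<le> M" using rep_displacement_bound by metis
  obtain Q where Q: "1 \<le> Q"
    "\<And>g h. g \<in> carrier \<Gamma> \<Longrightarrow> h \<in> carrier \<Gamma> \<Longrightarrow> dS g h \<le> Q * dS (\<psi> g) (\<psi> h)"
    using iso_quasi_isometry[OF \<psi>] by metis
  obtain D where D: "0 \<le> D"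
    "\<And>a l. a \<in> carrier \<Gamma> \<Longrightarrow> l \<in> geod_lines \<Gamma> S a \<Longrightarrow>
      \<exists>l'\<in>geod_lines \<Gamma> S (\<psi> a). \<forall>m. \<exists>t. dS (\<psi> (l m)) (l' t) \<le> D"
    using geod_line_iso[OF \<psi>] by metis
  interpret h: group_hom \<Gamma> \<Gamma> \<psi>
    using \<psi> by (simp add: iso_def group_hom_def group_hom_axioms_def is_group)
  \<comment> \<open>\<open>2 * M * D\<close> pays for exchanging both orbit points with points on
    the line of \<open>\<psi> a\<close>, and \<open>2 * D / K\<close> for the same exchange in the
    group.\<close>
  define C' where "C' = C + 2 * M * D + 2 * D / K"
  have "stable_with \<Gamma> S A \<sigma> (K * Q) C' x" unfolding stable_with_def
  proof (intro ballI impI allI)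
    fix a l and m n :: int
    assume a: "a \<in> A" "infinite_order \<Gamma> a" and l: "l \<in> geod_lines \<Gamma> S a"
    have ac: "a \<in> carrier \<Gamma>" using a(2) unfolding infinite_order_def by simp
    have \<psi>a: "\<psi> a \<in> A" using a(1) A by blast
    have inf: "infinite_order \<Gamma> (\<psi> a)"
      unfolding infinite_order_def
    proof (intro conjI allI impI)
      show "\<psi> a \<in> carrier \<Gamma>" using ac by simp
      fix k :: nat assume k: "0 < k"
      have "a [^] k \<noteq> \<one>" using a(2) k unfolding infinite_order_def by simp
      then have "\<psi> (a [^] k) \<noteq> \<psi> \<one>" using iso_inv_into(1)[OF \<psi>, of "a [^] k"] iso_inv_into(1)[OF \<psi>, of \<one>] ac by force
      then show "\<psi> a [^] k \<noteq> \<one>" using ac by (simp add: h.hom_nat_pow)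
    qed
    obtain l' where l': "l' \<in> geod_lines \<Gamma> S (\<psi> a)" "\<And>m. \<exists>t. dS (\<psi> (l m)) (l' t) \<le> D" using D(2)[OF ac l] by blast
    obtain s t where s: "dS (\<psi> (l m)) (l' s) \<le> D" and t: "dS (\<psi> (l n)) (l' t) \<le> D" using l'(2) by metis
    note lc = geod_lines_closed[OF l]
    note lc' = geod_lines_closed[OF l'(1)]
    have \<psi>c: "\<psi> (l i) \<in> carrier \<Gamma>" for i using lc by simp
    have near: "dist (\<rho> (\<psi> (l i)) x) (\<rho> (l' u) x) \<le> M * D" if "dS (\<psi> (l i)) (l' u) \<le> D" for i u
      using rep_lipschitz[where x = x, OF \<rho> M \<psi>c lc'] that M(1) by (meson mult_left_mono order_trans)
    have "real_of_int \<bar>m - n\<bar> \<le> Q * dS (\<psi> (l m)) (\<psi> (l n))"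
      using Q(2)[OF lc lc] geod_lines_dist[OF l] by metis
    then have "real_of_int \<bar>m - n\<bar> / Q \<le> dS (\<psi> (l m)) (\<psi> (l n))"
      using Q(1) by (simp add: divide_le_eq mult.commute)
    also have "\<dots> \<le> dS (l' s) (l' t) + 2 * D"
      using dS_tri[of "\<psi> (l m)" "l' s" "\<psi> (l n)"] dS_tri[of "l' s" "l' t" "\<psi> (l n)"] dS_sym[of "\<psi> (l n)" "l' t"] s t \<psi>c lc' by auto
    also have "dS (l' s) (l' t) = real_of_int \<bar>s - t\<bar>" by (rule geod_lines_dist[OF l'(1)])
    finally have "(real_of_int \<bar>m - n\<bar> / Q) / K \<le> (real_of_int \<bar>s - t\<bar> + 2 * D) / K"
      using K by (intro divide_right_mono) auto
    then have "real_of_int \<bar>m - n\<bar> / (K * Q) \<le> real_of_int \<bar>s - t\<bar> / K + 2 * D / K"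
      by (simp add: add_divide_distrib mult.commute)
    moreover have "real_of_int \<bar>s - t\<bar> / K - C \<le> dist (\<rho> (l' s) x) (\<rho> (l' t) x)"
      using st \<psi>a inf l'(1) unfolding stable_with_def by blast
    moreover have "dist (\<rho> (l' s) x) (\<rho> (l' t) x) \<le> dist (\<rho> (\<psi> (l m)) x) (\<rho> (\<psi> (l n)) x) + 2 * (M * D)"
      using near[OF s] near[OF t] dist_triangle[of "\<rho> (l' s) x" "\<rho> (l' t) x" "\<rho> (\<psi> (l m)) x"]
        dist_triangle[of "\<rho> (\<psi> (l m)) x" "\<rho> (l' t) x" "\<rho> (\<psi> (l n)) x"] by (simp add: dist_commute)
    ultimately show "real_of_int \<bar>m - n\<bar> / (K * Q) - C' \<le> dist (\<sigma> (l m) x) (\<sigma> (l n) x)"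
      unfolding C'_def using \<sigma>[OF lc, of m] \<sigma>[OF lc, of n] by simp
  qed
  moreover have "1 * 1 \<le> K * Q" using K Q(1) by (intro mult_mono) auto
  moreover have "0 \<le> C'" unfolding C'_def using C M(1) D(1) K by simp
  ultimately show ?thesis using that by simp
qed

text \<open>Stability along the line that follows the powers of \<open>b\<close> carries over to the
  powers with the same factor \<open>K\<close>; the distance between line and powers is absorbed by
  the additive \<open>E\<close>, which may depend on \<open>b\<close>.\<close>

lemma stable_with_escaping_powers:
  assumes \<rho>: "\<rho> \<in> Hom_Isom \<Gamma>" and K: "1 \<le> K" and st: "stable_with \<Gamma> S A \<rho> K C x"
    and b: "b \<in> A" "b \<in> carrier \<Gamma>" and \<alpha>: "0 < \<alpha>" and esc: "\<And>n::nat. \<alpha> * real n - B \<le> dS \<one> (b [^] n)"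
  obtains E where "\<And>n::nat. dS \<one> (b [^] n) / K - E \<le> dist x (\<rho> (b [^] n) x)"
proof -
  \<comment> \<open>If \<open>b\<close> had finite order, arbitrarily high powers would return to
    \<open>\<one>\<close>, against escape.\<close>
  have inf: "infinite_order \<Gamma> b" unfolding infinite_order_def
  proof (intro conjI allI impI notI b(2))
    fix n :: nat assume n: "0 < n" "b [^] n = \<one>"
    define k where "k = nat \<lceil>B / \<alpha>\<rceil> + 1"
    have "B / \<alpha> < real k" unfolding k_def by linarith
    then have "B < \<alpha> * real k" using \<alpha> by (simp add: divide_less_eq mult.commute)
    also have "\<dots> \<le> \<alpha> * real (n * k)" using \<alpha> n(1) by (intro mult_left_mono of_nat_mono) auto
    finally have "0 < dS \<one> (b [^] (n * k))" using esc[of "n * k"] by linarith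
    moreover have "b [^] (n * k) = \<one>" using nat_pow_pow[OF b(2), of n k] n(2) by simp
    ultimately show False by (simp add: dS_refl)
  qed
  obtain M where M: "0 \<le> M" "\<And>s. s \<in> S \<Longrightarrow> dist x (\<rho> s x) \<le> M" using rep_displacement_bound by metis
  obtain l D where l: "l \<in> geod_lines \<Gamma> S b" and D: "0 \<le> D" "\<And>n::nat. \<exists>t. dS (b [^] n) (l t) \<le> D"
    using escaping_powers_line[OF b(2) \<alpha> esc] by metis
  note lc = geod_lines_closed[OF l]
  have bc: "b [^] n \<in> carrier \<Gamma>" for n :: nat using b(2) by simp
  obtain t0 where t0: "dS \<one> (l t0) \<le> D" using D(2)[of 0] by auto
  have "dS \<one> (b [^] n) / K - (2 * D / K + C + 2 * (M * D)) \<le> dist x (\<rho> (b [^] n) x)" for n :: nat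
  proof -
    obtain t where t: "dS (b [^] n) (l t) \<le> D" using D(2) by blast
    have near: "dist (\<rho> g x) (\<rho> (l u) x) \<le> M * D" if "dS g (l u) \<le> D" "g \<in> carrier \<Gamma>" for g u
      using rep_lipschitz[where x = x, OF \<rho> M that(2) lc] that M(1) by (meson mult_left_mono order_trans)
    have "dS \<one> (b [^] n) \<le> dS (l t0) (l t) + 2 * D"
      using dS_tri[of \<one> "l t0" "b [^] n"] dS_tri[of "l t0" "l t" "b [^] n"] dS_sym[of "b [^] n" "l t"] t0 t bc[of n] lc by auto
    also have "dS (l t0) (l t) = real_of_int \<bar>t0 - t\<bar>" by (rule geod_lines_dist[OF l])
    finally have "dS \<one> (b [^] n) / K \<le> (real_of_int \<bar>t0 - t\<bar> + 2 * D) / K"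
      using K by (intro divide_right_mono) auto
    then have "dS \<one> (b [^] n) / K \<le> real_of_int \<bar>t0 - t\<bar> / K + 2 * D / K" by (simp add: add_divide_distrib)
    moreover have "real_of_int \<bar>t0 - t\<bar> / K - C \<le> dist (\<rho> (l t0) x) (\<rho> (l t) x)"
      using st b(1) inf l unfolding stable_with_def by blast
    moreover have "dist (\<rho> (l t0) x) (\<rho> (l t) x) \<le> dist x (\<rho> (b [^] n) x) + 2 * (M * D)"
      using near[OF t bc] near[OF t0 one_closed] rep_one[OF \<rho>, of x]
        dist_triangle[of "\<rho> (l t0) x" "\<rho> (l t) x" x]
        dist_triangle[of x "\<rho> (l t) x" "\<rho> (b [^] n) x"] by (simp add: dist_commute)
    ultimately show ?thesis by linarith
  qed
  then show ?thesis using that by blast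
qed

end

section \<open>The action of the outer automorphism group\<close>

text \<open>One index bounds both constants and the displacement of the generators, so the sets
  increase with \<open>k\<close> and compactness can select one of them. \<open>Suc k\<close> keeps
  the factor at least 1, and leaving the basepoint free makes the set invariant under
  conjugation.\<close>

definition tame_reps :: "('g, 'b) monoid_scheme \<Rightarrow> 'g set \<Rightarrow> 'g set \<Rightarrow> nat \<Rightarrow> ('g \<Rightarrow> ('x::metric_space \<Rightarrow> 'x)) set" where
  "tame_reps \<Gamma> S A k = {\<sigma> \<in> Hom_Isom \<Gamma>. \<exists>x. stable_with \<Gamma> S A \<sigma> (real (Suc k)) (real (Suc k)) x \<and>
      (\<forall>s\<in>S. dist x (\<sigma> s x) \<le> real (Suc k))}"

text \<open>
  Defined through the neighbourhoods rather than as a topological interior, which makes invariance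
  under conjugation immediate.
\<close>

definition tame_interior :: "('g, 'b) monoid_scheme \<Rightarrow> 'g set \<Rightarrow> 'g set \<Rightarrow> nat \<Rightarrow> ('g \<Rightarrow> ('x::metric_space \<Rightarrow> 'x)) set" where
  "tame_interior \<Gamma> S A k = \<Union>{W. \<exists>\<rho> F \<epsilon>. \<rho> \<in> Hom_Isom \<Gamma> \<and> finite F \<and> 0 < \<epsilon> \<and> W = rep_nbhd \<Gamma> S \<rho> F \<epsilon> \<and>
      W \<subseteq> tame_reps \<Gamma> S A k}"

lemma tame_interior_subset: "tame_interior \<Gamma> S A k \<subseteq> tame_reps \<Gamma> S A k"
  unfolding tame_interior_def by blast

lemma tame_interior_Hom: "tame_interior \<Gamma> S A k \<subseteq> Hom_Isom \<Gamma>"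
  using tame_interior_subset unfolding tame_reps_def by blast

context fin_gen_group
begin

lemma tame_reps_mono:
  assumes "k \<le> k'"
  shows "tame_reps \<Gamma> S A k \<subseteq> tame_reps \<Gamma> S A k'"
  unfolding tame_reps_def using assms by (auto intro!: exI intro: stable_with_mono order_trans)

lemma tame_interior_mono:
  assumes "k \<le> k'"
  shows "tame_interior \<Gamma> S A k \<subseteq> tame_interior \<Gamma> S A k'"
  unfolding tame_interior_def using tame_reps_mono[OF assms] by (intro Union_mono) blast

lemma openin_tame_interior: "openin (Hom_top \<Gamma> S) (tame_interior \<Gamma> S A k)"
  unfolding tame_interior_def using openin_rep_nbhd[OF S_sub finite_S] by (intro openin_Union) auto

lemma tame_reps_conj:
  assumes \<rho>: "\<rho> \<in> tame_reps \<Gamma> S A k" and "\<sigma> \<in> conj_class \<Gamma> \<rho>"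
  shows "\<sigma> \<in> tame_reps \<Gamma> S A k"
proof -
  obtain h where \<sigma>: "\<sigma> \<in> Hom_Isom \<Gamma>" and h: "h \<in> Isom" "\<And>g x. g \<in> carrier \<Gamma> \<Longrightarrow> \<sigma> g (h x) = h (\<rho> g x)"
    using assms(2) unfolding conj_class_iff by blast
  obtain x where x: "stable_with \<Gamma> S A \<rho> (real (Suc k)) (real (Suc k)) x" "\<forall>s\<in>S. dist x (\<rho> s x) \<le> real (Suc k)"
    using \<rho> unfolding tame_reps_def by blast
  have "\<forall>s\<in>S. dist (h x) (\<sigma> s (h x)) \<le> real (Suc k)"
    using x(2) h(2) S_sub Isom_dist[OF h(1)] by (metis subsetD)
  moreover have "stable_with \<Gamma> S A \<sigma> (real (Suc k)) (real (Suc k)) (h x)"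
    by (rule stable_with_conj[where \<rho> = \<rho> and h = h, OF x(1) h])
  ultimately show ?thesis unfolding tame_reps_def using \<sigma> by blast
qed

text \<open>Conjugation by \<open>h\<close> carries a basic neighbourhood to the one with conjugated
  centre and moved test points. That the latter still lies in \<open>tame_reps\<close> is seen by
  conjugating its elements back.\<close>

lemma tame_interior_conj:
  fixes \<sigma> :: "'g \<Rightarrow> ('x::metric_space \<Rightarrow> 'x)"
  assumes "\<tau> \<in> tame_interior \<Gamma> S A k" "\<sigma> \<in> conj_class \<Gamma> \<tau>"
  shows "\<sigma> \<in> tame_interior \<Gamma> S A k"
proof -
  obtain \<rho> F \<epsilon> where \<rho>: "\<rho> \<in> Hom_Isom \<Gamma>" "finite F" "0 < \<epsilon>" "\<tau> \<in> rep_nbhd \<Gamma> S \<rho> F \<epsilon>"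
      and sub: "rep_nbhd \<Gamma> S \<rho> F \<epsilon> \<subseteq> tame_reps \<Gamma> S A k"
    using assms(1) unfolding tame_interior_def by blast
  obtain h where \<sigma>: "\<sigma> \<in> Hom_Isom \<Gamma>" and h: "h \<in> Isom" "\<And>g x. g \<in> carrier \<Gamma> \<Longrightarrow> \<sigma> g (h x) = h (\<tau> g x)"
    using assms(2) unfolding conj_class_iff by blast
  define h' where "h' = inv_into UNIV h"
  have h': "h' \<in> Isom" "\<And>x. h' (h x) = x" "\<And>x. h (h' x) = x" unfolding h'_def using Isom_inverse[OF h(1)] by auto
  define \<rho>' where "\<rho>' = conj_rep \<Gamma> h \<rho>"
  have \<rho>': "\<rho>' \<in> Hom_Isom \<Gamma>" "\<And>g x. g \<in> carrier \<Gamma> \<Longrightarrow> \<rho>' g (h x) = h (\<rho> g x)"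
    unfolding \<rho>'_def using conj_rep[OF \<rho>(1) h(1)] by auto
  have "\<sigma> \<in> rep_nbhd \<Gamma> S \<rho>' (h ` F) \<epsilon>"
    by (rule rep_nbhd_conj[where \<tau> = \<tau> and h = h and \<rho> = \<rho>, OF \<rho>(4) h(1) \<sigma> h(2) \<rho>'(2)])
  moreover have "rep_nbhd \<Gamma> S \<rho>' (h ` F) \<epsilon> \<subseteq> tame_reps \<Gamma> S A k"
  proof
    fix \<sigma>' assume \<sigma>': "\<sigma>' \<in> rep_nbhd \<Gamma> S \<rho>' (h ` F) \<epsilon>"
    then have \<sigma>'H: "\<sigma>' \<in> Hom_Isom \<Gamma>" unfolding rep_nbhd_def by simp
    define \<tau>' where "\<tau>' = conj_rep \<Gamma> h' \<sigma>'"
    have \<tau>': "\<tau>' \<in> Hom_Isom \<Gamma>" "\<And>g x. g \<in> carrier \<Gamma> \<Longrightarrow> \<tau>' g (h' x) = h' (\<sigma>' g x)"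
      unfolding \<tau>'_def using conj_rep[OF \<sigma>'H h'(1)] by auto
    have rel: "\<rho> g (h' x) = h' (\<rho>' g x)" if "g \<in> carrier \<Gamma>" for g x
      using \<rho>'(2)[OF that, of "h' x"] h' by simp
    have "\<tau>' \<in> rep_nbhd \<Gamma> S \<rho> (h' ` h ` F) \<epsilon>"
      by (rule rep_nbhd_conj[where \<tau> = \<sigma>' and h = h' and \<rho> = \<rho>' and \<rho>' = \<rho>, OF \<sigma>' h'(1) \<tau>'(1) \<tau>'(2) rel])
    then have "\<tau>' \<in> tame_reps \<Gamma> S A k" using sub h'(2) by (auto simp: image_image)
    moreover have "\<tau>' \<in> conj_class \<Gamma> \<sigma>'" unfolding conj_class_iff using \<tau>' h'(1) by blast
    ultimately show "\<sigma>' \<in> tame_reps \<Gamma> S A k"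
      using tame_reps_conj conj_class_sym[OF _ \<sigma>'H] by blast
  qed
  moreover have "finite (h ` F)" using \<rho>(2) by simp
  ultimately show ?thesis unfolding tame_interior_def using \<rho>'(1) \<rho>(3)
    by (intro UnionI[where X = "rep_nbhd \<Gamma> S \<rho>' (h ` F) \<epsilon>"] CollectI exI conjI) auto
qed

text \<open>The set is a union of conjugacy classes, hence the full preimage of its image in the
  quotient.\<close>

lemma openin_char_top_tame:
  "openin (char_top \<Gamma> S) (conj_class \<Gamma> ` (tame_interior \<Gamma> S A k :: ('g \<Rightarrow> ('x::metric_space \<Rightarrow> 'x)) set))"
proof -
  let ?V = "tame_interior \<Gamma> S A k :: ('g \<Rightarrow> ('x \<Rightarrow> 'x)) set"
  have "{\<rho> \<in> Hom_Isom \<Gamma>. conj_class \<Gamma> \<rho> \<in> conj_class \<Gamma> ` ?V} = ?V"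
    using tame_interior_conj tame_interior_Hom conj_class_refl by blast
  then show ?thesis
    unfolding char_top_def openin_quotient_top topspace_Hom_top[OF S_sub]
    using openin_tame_interior[of A k] image_mono[OF tame_interior_Hom[of \<Gamma> S A k], of "conj_class \<Gamma>"]
    by simp
qed

text \<open>From left to right this is the perturbation result: its three constants hold on a whole
  neighbourhood, and \<open>k\<close> is taken above all of them.\<close>

lemma A_stable_iff_tame_interior:
  fixes \<rho> :: "'g \<Rightarrow> ('x::metric_space \<Rightarrow> 'x)"
  assumes hyp: "gromov_hyperbolic_on (UNIV :: 'x set) dist" and X: "geodesic_space (UNIV :: 'x set)"
    and \<rho>: "\<rho> \<in> Hom_Isom \<Gamma>"
  shows "A_stable \<Gamma> S A \<rho> \<longleftrightarrow> (\<exists>k. \<rho> \<in> tame_interior \<Gamma> S A k)"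
proof
  assume "A_stable \<Gamma> S A \<rho>"
  then obtain K C x where K: "1 \<le> K" "0 \<le> C" "stable_with \<Gamma> S A \<rho> K C x" using A_stable_iff[OF \<rho> X] by blast
  obtain F \<epsilon> K' C' M' where F: "finite F" "0 < \<epsilon>" "1 \<le> K'" "0 \<le> C'" "0 \<le> M'"
    and nb: "\<And>\<sigma>. \<sigma> \<in> rep_nbhd \<Gamma> S \<rho> F \<epsilon> \<Longrightarrow> stable_with \<Gamma> S A \<sigma> K' C' x \<and> (\<forall>s\<in>S. dist x (\<sigma> s x) \<le> M')"
    using stable_with_nbhd[OF hyp X \<rho> K] by metis
  define k where "k = nat \<lceil>max K' (max C' M')\<rceil>"
  have k: "K' \<le> real (Suc k)" "C' \<le> real (Suc k)" "M' \<le> real (Suc k)" unfolding k_def by linarith+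
  have "rep_nbhd \<Gamma> S \<rho> F \<epsilon> \<subseteq> tame_reps \<Gamma> S A k"
  proof
    fix \<sigma> assume \<sigma>: "\<sigma> \<in> rep_nbhd \<Gamma> S \<rho> F \<epsilon>"
    have "stable_with \<Gamma> S A \<sigma> (real (Suc k)) (real (Suc k)) x"
      using nb[OF \<sigma>] k F(3) stable_with_mono[of A \<sigma> K' C' x "real (Suc k)" "real (Suc k)"] by linarith
    moreover have "\<forall>s\<in>S. dist x (\<sigma> s x) \<le> real (Suc k)" using nb[OF \<sigma>] k(3) by force
    ultimately show "\<sigma> \<in> tame_reps \<Gamma> S A k" using \<sigma> unfolding tame_reps_def rep_nbhd_def by blast
  qed
  moreover have "\<rho> \<in> rep_nbhd \<Gamma> S \<rho> F \<epsilon>" unfolding rep_nbhd_def using \<rho> F by simp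
  ultimately show "\<exists>k. \<rho> \<in> tame_interior \<Gamma> S A k" unfolding tame_interior_def using \<rho> F(1,2) by blast
next
  assume "\<exists>k. \<rho> \<in> tame_interior \<Gamma> S A k"
  then obtain k where "\<rho> \<in> tame_reps \<Gamma> S A k" using tame_interior_subset by blast
  then obtain x where "stable_with \<Gamma> S A \<rho> (real (Suc k)) (real (Suc k)) x" unfolding tame_reps_def by blast
  then show "A_stable \<Gamma> S A \<rho>" unfolding A_stable_iff[OF \<rho> X] by (intro exI[of _ "real (Suc k)"] conjI) auto
qed

lemma stable_set_eq:
  assumes "gromov_hyperbolic_on (UNIV :: 'x::metric_space set) dist" and "geodesic_space (UNIV :: 'x set)"
  shows "(stable_set \<Gamma> S A :: ('g \<Rightarrow> ('x \<Rightarrow> 'x)) set set) = (\<Union>k. conj_class \<Gamma> ` tame_interior \<Gamma> S A k)"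
proof -
  have "{\<rho> \<in> Hom_Isom \<Gamma>. A_stable \<Gamma> S A \<rho>} = (\<Union>k. tame_interior \<Gamma> S A k :: ('g \<Rightarrow> ('x \<Rightarrow> 'x)) set)"
  proof (intro equalityI subsetI)
    fix \<rho> :: "'g \<Rightarrow> ('x \<Rightarrow> 'x)"
    assume "\<rho> \<in> {\<rho> \<in> Hom_Isom \<Gamma>. A_stable \<Gamma> S A \<rho>}"
    then show "\<rho> \<in> (\<Union>k. tame_interior \<Gamma> S A k)" using A_stable_iff_tame_interior[OF assms, of \<rho> A] by simp
  next
    fix \<rho> :: "'g \<Rightarrow> ('x \<Rightarrow> 'x)"
    assume "\<rho> \<in> (\<Union>k. tame_interior \<Gamma> S A k)"
    then obtain k where k: "\<rho> \<in> tame_interior \<Gamma> S A k" by blast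
    then have "\<rho> \<in> Hom_Isom \<Gamma>" by (rule subsetD[OF tame_interior_Hom])
    then show "\<rho> \<in> {\<rho> \<in> Hom_Isom \<Gamma>. A_stable \<Gamma> S A \<rho>}"
      using A_stable_iff_tame_interior[OF assms, of \<rho> A] k by auto
  qed
  then show ?thesis unfolding stable_set_def by (simp add: image_UN)
qed

lemma compact_stable_uniform:
  fixes R :: "('g \<Rightarrow> ('x::metric_space \<Rightarrow> 'x)) set set"
  assumes "gromov_hyperbolic_on (UNIV :: 'x::metric_space set) dist" and "geodesic_space (UNIV :: 'x set)"
    and R: "compactin (char_top \<Gamma> S) R" "R \<subseteq> stable_set \<Gamma> S A"
  obtains k where "R \<subseteq> conj_class \<Gamma> ` tame_interior \<Gamma> S A k"
proof -
  let ?V = "\<lambda>k. conj_class \<Gamma> ` (tame_interior \<Gamma> S A k :: ('g \<Rightarrow> ('x \<Rightarrow> 'x)) set)"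
  have "\<exists>\<F>. finite \<F> \<and> \<F> \<subseteq> range ?V \<and> R \<subseteq> \<Union>\<F>"
    using R(2) openin_char_top_tame unfolding stable_set_eq[OF assms(1,2)]
    by (intro compactinD[OF R(1)]) auto
  then obtain I where I: "finite I" "R \<subseteq> \<Union>(?V ` I)" by (metis finite_subset_image)
  \<comment> \<open>The \<open>0\<close> keeps the maximum meaningful when the subcover is
    empty.\<close>
  have "R \<subseteq> ?V (Max (insert 0 I))"
  proof
    fix r assume "r \<in> R"
    then obtain i where i: "i \<in> I" "r \<in> ?V i" using I by blast
    then have "i \<le> Max (insert 0 I)" using I(1) by simp
    then show "r \<in> ?V (Max (insert 0 I))" using i tame_interior_mono by blast
  qed
  then show ?thesis by (rule that)
qed

section \<open>Outer classes and their action on conjugacy classes\<close>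

lemma outer_classD: "\<phi> \<in> outer_class \<Gamma> \<psi> \<Longrightarrow> \<phi> \<in> iso \<Gamma> \<Gamma>"
  unfolding outer_class_def by simp

lemma outer_equiv_refl: "\<phi> \<in> iso \<Gamma> \<Gamma> \<Longrightarrow> outer_equiv \<Gamma> \<phi> \<phi>"
  unfolding outer_equiv_def by (intro bexI[of _ \<one>]) (auto simp: iso_def hom_def Pi_iff)

lemma outer_equiv_sym:
  assumes "outer_equiv \<Gamma> \<phi> \<psi>" "\<psi> \<in> iso \<Gamma> \<Gamma>"
  shows "outer_equiv \<Gamma> \<psi> \<phi>"
proof -
  obtain g where g: "g \<in> carrier \<Gamma>" "\<forall>x\<in>carrier \<Gamma>. \<phi> x = g \<otimes> \<psi> x \<otimes> inv g"
    using assms(1) unfolding outer_equiv_def by blast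
  have "\<psi> x = inv g \<otimes> \<phi> x \<otimes> inv (inv g)" if "x \<in> carrier \<Gamma>" for x
  proof -
    have "\<psi> x \<in> carrier \<Gamma>" using assms(2) that by (auto simp: iso_def hom_def)
    then show ?thesis using g that by (simp add: m_assoc mult_inv_cancel)
  qed
  then show ?thesis unfolding outer_equiv_def using g(1) by blast
qed

lemma outer_equiv_trans:
  assumes "outer_equiv \<Gamma> \<phi> \<psi>" "outer_equiv \<Gamma> \<psi> \<theta>" "\<theta> \<in> iso \<Gamma> \<Gamma>"
  shows "outer_equiv \<Gamma> \<phi> \<theta>"
proof -
  obtain g where g: "g \<in> carrier \<Gamma>" "\<forall>x\<in>carrier \<Gamma>. \<phi> x = g \<otimes> \<psi> x \<otimes> inv g"
    using assms(1) unfolding outer_equiv_def by blast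
  obtain h where h: "h \<in> carrier \<Gamma>" "\<forall>x\<in>carrier \<Gamma>. \<psi> x = h \<otimes> \<theta> x \<otimes> inv h"
    using assms(2) unfolding outer_equiv_def by blast
  have "\<phi> x = (g \<otimes> h) \<otimes> \<theta> x \<otimes> inv (g \<otimes> h)" if "x \<in> carrier \<Gamma>" for x
  proof -
    have "\<theta> x \<in> carrier \<Gamma>" using assms(3) that by (auto simp: iso_def hom_def)
    then show ?thesis using g h that by (simp add: m_assoc inv_mult_group)
  qed
  then show ?thesis unfolding outer_equiv_def using g(1) h(1) by (meson m_closed)
qed

lemma outer_class_eqI:
  assumes "\<phi> \<in> outer_class \<Gamma> \<psi>" "\<psi> \<in> iso \<Gamma> \<Gamma>"
  shows "outer_class \<Gamma> \<phi> = outer_class \<Gamma> \<psi>"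
  using assms outer_equiv_sym outer_equiv_trans unfolding outer_class_def by blast

end

context hyp_group
begin

text \<open>Conjugation by \<open>g\<close> between the inverses becomes conjugation by
  \<open>\<phi> g\<close> between the automorphisms, in the opposite order. Inverting a sequence
  with distinct outer classes thus keeps the classes distinct.\<close>

lemma outer_equiv_inv_into:
  assumes \<phi>: "\<phi> \<in> iso \<Gamma> \<Gamma>" and \<psi>: "\<psi> \<in> iso \<Gamma> \<Gamma>"
    and "outer_equiv \<Gamma> (inv_into (carrier \<Gamma>) \<phi>) (inv_into (carrier \<Gamma>) \<psi>)"
  shows "outer_equiv \<Gamma> \<psi> \<phi>"
proof -
  obtain g where g: "g \<in> carrier \<Gamma>"
    "\<forall>x\<in>carrier \<Gamma>. inv_into (carrier \<Gamma>) \<phi> x = g \<otimes> inv_into (carrier \<Gamma>) \<psi> x \<otimes> inv g"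
    using assms(3) unfolding outer_equiv_def by blast
  interpret h: group_hom \<Gamma> \<Gamma> \<phi> using \<phi> by (simp add: iso_def group_hom_def group_hom_axioms_def is_group)
  have "\<psi> y = \<phi> g \<otimes> \<phi> y \<otimes> inv (\<phi> g)" if y: "y \<in> carrier \<Gamma>" for y
  proof -
    have c: "\<psi> y \<in> carrier \<Gamma>" by (rule iso_closed[OF \<psi> y])
    have "\<psi> y = \<phi> (inv_into (carrier \<Gamma>) \<phi> (\<psi> y))" using iso_inv_into(2)[OF \<phi> c] by simp
    also have "\<dots> = \<phi> (g \<otimes> y \<otimes> inv g)" using g(2) c iso_inv_into(1)[OF \<psi> y] by simp
    finally show ?thesis using g(1) y by simp
  qed
  then show ?thesis unfolding outer_equiv_def using g(1) by (meson h.hom_closed)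
qed

definition precompose :: "('g \<Rightarrow> 'g) \<Rightarrow> ('g \<Rightarrow> ('x::metric_space \<Rightarrow> 'x)) \<Rightarrow> 'g \<Rightarrow> ('x \<Rightarrow> 'x)" where
  "precompose \<psi> \<rho> = (\<lambda>g. if g \<in> carrier \<Gamma> then \<rho> (\<psi> g) else undefined)"

lemma precompose_Hom:
  assumes "\<rho> \<in> Hom_Isom \<Gamma>" "\<psi> \<in> iso \<Gamma> \<Gamma>"
  shows "precompose \<psi> \<rho> \<in> Hom_Isom \<Gamma>"
  using assms unfolding Hom_Isom_def precompose_def by (auto simp: iso_def hom_def Pi_iff)

text \<open>\<open>out_act\<close> runs over all representatives of both classes; this shows that
  the outcome is a single conjugacy class, which any one choice of representatives
  determines.\<close>

lemma out_act_conj_class: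
  assumes \<phi>0: "\<phi>0 \<in> iso \<Gamma> \<Gamma>" and \<rho>: "\<rho> \<in> Hom_Isom \<Gamma>"
  shows "out_act \<Gamma> (outer_class \<Gamma> \<phi>0) (conj_class \<Gamma> \<rho>) = conj_class \<Gamma> (precompose (inv_into (carrier \<Gamma>) \<phi>0) \<rho>)"
proof (intro equalityI subsetI)
  let ?\<psi>0 = "inv_into (carrier \<Gamma>) \<phi>0"
  have \<psi>0: "?\<psi>0 \<in> iso \<Gamma> \<Gamma>" by (rule iso_set_sym[OF \<phi>0])
  interpret h: group_hom \<Gamma> \<Gamma> ?\<psi>0 using \<psi>0 by (simp add: iso_def group_hom_def group_hom_axioms_def is_group)
  fix \<sigma>
  {
    assume "\<sigma> \<in> out_act \<Gamma> (outer_class \<Gamma> \<phi>0) (conj_class \<Gamma> \<rho>)"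
    then obtain \<rho>' \<phi> where \<sigma>: "\<sigma> \<in> Hom_Isom \<Gamma>" and \<rho>': "\<rho>' \<in> conj_class \<Gamma> \<rho>" and \<phi>: "\<phi> \<in> outer_class \<Gamma> \<phi>0"
      and eq: "\<forall>g\<in>carrier \<Gamma>. \<sigma> g = \<rho>' (inv_into (carrier \<Gamma>) \<phi> g)"
      unfolding out_act_def by blast
    obtain h where h: "h \<in> Isom" "\<And>g x. g \<in> carrier \<Gamma> \<Longrightarrow> \<rho>' g (h x) = h (\<rho> g x)"
      using \<rho>' unfolding conj_class_iff by blast
    obtain k where k: "k \<in> carrier \<Gamma>" "\<And>x. x \<in> carrier \<Gamma> \<Longrightarrow> \<phi> x = k \<otimes> \<phi>0 x \<otimes> inv k"
      using \<phi> unfolding outer_class_def outer_equiv_def by blast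
    have \<phi>i: "\<phi> \<in> iso \<Gamma> \<Gamma>" using \<phi> by (rule outer_classD)
    \<comment> \<open>Changing \<open>\<phi>0\<close> by conjugation with \<open>k\<close> changes
      its inverse by conjugation with \<open>inv u\<close>, and a representation turns this into
      conjugation by \<open>\<rho> (inv u)\<close>.\<close>
    define u where "u = ?\<psi>0 k"
    have u: "u \<in> carrier \<Gamma>" unfolding u_def using k(1) by simp
    have "\<rho> (inv u) \<in> Isom" using \<rho> u unfolding Hom_Isom_def by simp
    then have h': "h \<circ> \<rho> (inv u) \<in> Isom" by (rule Isom_comp[OF h(1)])
    have "\<sigma> g ((h \<circ> \<rho> (inv u)) x) = (h \<circ> \<rho> (inv u)) (precompose ?\<psi>0 \<rho> g x)" if g: "g \<in> carrier \<Gamma>" for g x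
    proof -
      define y where "y = inv_into (carrier \<Gamma>) \<phi> g"
      have y: "y \<in> carrier \<Gamma>" "\<phi> y = g"
        unfolding y_def using iso_closed[OF iso_set_sym[OF \<phi>i] g] iso_inv_into(2)[OF \<phi>i g] by auto
      have "\<phi>0 y \<in> carrier \<Gamma>" by (rule iso_closed[OF \<phi>0 y(1)])
      then have "?\<psi>0 g = u \<otimes> y \<otimes> inv u"
        using k(2)[OF y(1)] y(2) k(1) iso_inv_into(1)[OF \<phi>0 y(1)] unfolding u_def by simp
      then have "inv u \<otimes> ?\<psi>0 g = y \<otimes> inv u" using u y(1) by (simp add: m_assoc mult_inv_cancel)
      then have "\<rho> (inv u) (\<rho> (?\<psi>0 g) x) = \<rho> y (\<rho> (inv u) x)"
        using rep_mult[OF \<rho>, of "inv u" "?\<psi>0 g" x] rep_mult[OF \<rho> y(1), of "inv u" x] u g by simp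
      then show ?thesis using eq g h(2)[OF y(1)] unfolding precompose_def y_def by simp
    qed
    then show "\<sigma> \<in> conj_class \<Gamma> (precompose ?\<psi>0 \<rho>)" unfolding conj_class_iff using \<sigma> h' by blast
  next
    assume "\<sigma> \<in> conj_class \<Gamma> (precompose ?\<psi>0 \<rho>)"
    then obtain h where \<sigma>: "\<sigma> \<in> Hom_Isom \<Gamma>" and h: "h \<in> Isom" "\<And>g x. g \<in> carrier \<Gamma> \<Longrightarrow> \<sigma> g (h x) = h (precompose ?\<psi>0 \<rho> g x)"
      unfolding conj_class_iff by blast
    define \<rho>' where "\<rho>' = conj_rep \<Gamma> h \<rho>"
    have \<rho>': "\<rho>' \<in> Hom_Isom \<Gamma>" "\<And>g x. g \<in> carrier \<Gamma> \<Longrightarrow> \<rho>' g (h x) = h (\<rho> g x)"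
      unfolding \<rho>'_def using conj_rep[OF \<rho> h(1)] by auto
    then have "\<rho>' \<in> conj_class \<Gamma> \<rho>" unfolding conj_class_iff using h(1) by blast
    moreover have "\<phi>0 \<in> outer_class \<Gamma> \<phi>0" unfolding outer_class_def using \<phi>0 outer_equiv_refl by simp
    moreover have "\<sigma> g = \<rho>' (?\<psi>0 g)" if g: "g \<in> carrier \<Gamma>" for g
    proof
      fix z
      obtain x where "z = h x" using Isom_surj[OF h(1)] by (metis surjD)
      then show "\<sigma> g z = \<rho>' (?\<psi>0 g) z" using h(2)[OF g] \<rho>'(2)[of "?\<psi>0 g"] g unfolding precompose_def by simp
    qed
    ultimately show "\<sigma> \<in> out_act \<Gamma> (outer_class \<Gamma> \<phi>0) (conj_class \<Gamma> \<rho>)"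
      unfolding out_act_def using \<sigma> by blast
  }
qed

lemma A_stable_precompose:
  fixes \<rho> :: "'g \<Rightarrow> ('x::metric_space \<Rightarrow> 'x)"
  assumes "geodesic_space (UNIV :: 'x set)" "\<rho> \<in> Hom_Isom \<Gamma>" "A_stable \<Gamma> S A \<rho>" "\<psi> \<in> iso \<Gamma> \<Gamma>" "\<psi> ` A = A"
  shows "A_stable \<Gamma> S A (precompose \<psi> \<rho>)"
proof -
  obtain K C x where K: "1 \<le> K" "0 \<le> C" "stable_with \<Gamma> S A \<rho> K C x"
    using assms(3) unfolding A_stable_iff[OF assms(2,1)] by blast
  obtain K' C' where "1 \<le> K'" "0 \<le> C'" "stable_with \<Gamma> S A (precompose \<psi> \<rho>) K' C' x"
    using stable_with_iso[OF assms(2) K assms(4,5), of "precompose \<psi> \<rho>"] unfolding precompose_def by auto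
  then show ?thesis unfolding A_stable_iff[OF precompose_Hom[OF assms(2,4)] assms(1)] by blast
qed

lemma out_act_stable_set:
  assumes X: "geodesic_space (UNIV :: 'x::metric_space set)" and A: "\<And>\<phi>. \<phi> \<in> iso \<Gamma> \<Gamma> \<Longrightarrow> \<phi> ` A = A"
    and "\<Phi> \<in> Out \<Gamma>"
  shows "out_act \<Gamma> \<Phi> ` stable_set \<Gamma> S A = (stable_set \<Gamma> S A :: ('g \<Rightarrow> ('x \<Rightarrow> 'x)) set set)"
proof -
  obtain \<phi> where \<phi>: "\<phi> \<in> iso \<Gamma> \<Gamma>" "\<Phi> = outer_class \<Gamma> \<phi>" using assms(3) unfolding Out_def by blast
  define \<psi> where "\<psi> = inv_into (carrier \<Gamma>) \<phi>"
  have \<psi>: "\<psi> \<in> iso \<Gamma> \<Gamma>" unfolding \<psi>_def by (rule iso_set_sym[OF \<phi>(1)])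
  show ?thesis
  proof (intro equalityI subsetI)
    fix r :: "('g \<Rightarrow> ('x \<Rightarrow> 'x)) set" assume "r \<in> out_act \<Gamma> \<Phi> ` stable_set \<Gamma> S A"
    then obtain \<rho> where "\<rho> \<in> Hom_Isom \<Gamma>" "A_stable \<Gamma> S A \<rho>" "r = out_act \<Gamma> \<Phi> (conj_class \<Gamma> \<rho>)"
      unfolding stable_set_def by blast
    then show "r \<in> stable_set \<Gamma> S A"
      unfolding stable_set_def \<phi>(2)
      using out_act_conj_class[OF \<phi>(1)] A_stable_precompose[OF X _ _ \<psi> A[OF \<psi>]] precompose_Hom[OF _ \<psi>] unfolding \<psi>_def by blast
  next
    fix r :: "('g \<Rightarrow> ('x \<Rightarrow> 'x)) set" assume "r \<in> stable_set \<Gamma> S A"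
    then obtain \<rho> where \<rho>: "\<rho> \<in> Hom_Isom \<Gamma>" "A_stable \<Gamma> S A \<rho>" "r = conj_class \<Gamma> \<rho>"
      unfolding stable_set_def by blast
    \<comment> \<open>Precomposing with \<open>\<phi>\<close> itself undoes the action and so
      exhibits a preimage.\<close>
    define \<rho>1 where "\<rho>1 = precompose \<phi> \<rho>"
    have \<rho>1: "\<rho>1 \<in> Hom_Isom \<Gamma>" "A_stable \<Gamma> S A \<rho>1"
      unfolding \<rho>1_def using precompose_Hom[OF \<rho>(1) \<phi>(1)] A_stable_precompose[OF X \<rho>(1,2) \<phi>(1) A[OF \<phi>(1)]] by auto
    have "precompose \<psi> \<rho>1 = \<rho>"
    proof
      fix g show "precompose \<psi> \<rho>1 g = \<rho> g"
        using \<rho>(1) iso_closed[OF \<psi>, of g] iso_inv_into(2)[OF \<phi>(1), of g]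
        unfolding precompose_def \<rho>1_def Hom_Isom_def \<psi>_def by simp
    qed
    then have "r = out_act \<Gamma> \<Phi> (conj_class \<Gamma> \<rho>1)"
      unfolding \<phi>(2) out_act_conj_class[OF \<phi>(1) \<rho>1(1)] \<rho>(3) \<psi>_def by simp
    then show "r \<in> out_act \<Gamma> \<Phi> ` stable_set \<Gamma> S A" unfolding stable_set_def using \<rho>1 by blast
  qed
qed

text \<open>The element \<open>\<psi> a\<close> acts through \<open>\<rho>\<close> as
  \<open>a\<close> does through \<open>\<tau>\<close>. Above the threshold, stability of
  \<open>\<rho>\<close> bounds the growth rate of its orbits below by
  \<open>\<alpha> / \<kappa>\<close>, and the displacement bound of \<open>\<tau>\<close> bounds it
  above by \<open>\<kappa> * len a\<close>. The basepoints \<open>x\<close> and \<open>y\<close> are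
  unrelated, but their distance is constant in \<open>n\<close> and disappears from the
  rate.\<close>

lemma transl_len_bound:
  assumes \<rho>: "\<rho> \<in> tame_reps \<Gamma> S A k" and \<tau>: "\<tau> \<in> tame_reps \<Gamma> S A k"
    and \<psi>: "\<psi> \<in> iso \<Gamma> \<Gamma>" and eq: "\<And>g. g \<in> carrier \<Gamma> \<Longrightarrow> \<tau> g = \<rho> (\<psi> g)"
    and a: "a \<in> carrier \<Gamma>" "\<psi> a \<in> A"
  shows "transl_len \<Gamma> S (\<psi> a) \<le> 6 * \<delta> + 3 + real (Suc k) * real (Suc k) * real (len a)"
proof (cases "transl_len \<Gamma> S (\<psi> a) \<le> 6 * \<delta> + 3")
  case True
  have "0 \<le> real (Suc k) * real (Suc k) * real (len a)" by simp
  then show ?thesis using True by linarith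
next
  case False
  define \<kappa> where "\<kappa> = real (Suc k)"
  have \<kappa>: "1 \<le> \<kappa>" unfolding \<kappa>_def by simp
  define \<alpha> where "\<alpha> = transl_len \<Gamma> S (\<psi> a) - (6 * \<delta> + 3)"
  have \<alpha>: "0 < \<alpha>" using False unfolding \<alpha>_def by simp
  interpret h: group_hom \<Gamma> \<Gamma> \<psi> using \<psi> by (simp add: iso_def group_hom_def group_hom_axioms_def is_group)
  have b: "\<psi> a \<in> carrier \<Gamma>" using a by simp
  obtain B where B: "\<And>n::nat. \<alpha> * real n - B \<le> dS \<one> (\<psi> a [^] n)"
    using powers_escape[OF b] False unfolding \<alpha>_def by auto
  have \<rho>H: "\<rho> \<in> Hom_Isom \<Gamma>" and \<tau>H: "\<tau> \<in> Hom_Isom \<Gamma>" using \<rho> \<tau> unfolding tame_reps_def by auto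
  obtain x where x: "stable_with \<Gamma> S A \<rho> \<kappa> \<kappa> x" using \<rho> unfolding tame_reps_def \<kappa>_def by blast
  obtain y where y: "\<And>s. s \<in> S \<Longrightarrow> dist y (\<tau> s y) \<le> \<kappa>" using \<tau> unfolding tame_reps_def \<kappa>_def by blast
  obtain E where E: "\<And>n::nat. dS \<one> (\<psi> a [^] n) / \<kappa> - E \<le> dist x (\<rho> (\<psi> a [^] n) x)"
    using stable_with_escaping_powers[OF \<rho>H \<kappa> x a(2) b \<alpha> B] by metis
  have "\<alpha> * real n - (B + \<kappa> * (E + 2 * dist x y)) \<le> (\<kappa> * \<kappa> * real (len a)) * real n" for n :: nat
  proof -
    have bc: "\<psi> a [^] n \<in> carrier \<Gamma>" and ac: "a [^] n \<in> carrier \<Gamma>" using a b by auto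
    have "dist y (\<rho> (\<psi> a [^] n) y) = dist (\<tau> \<one> y) (\<tau> (a [^] n) y)"
      using eq[OF ac] rep_one[OF \<tau>H] a by (simp add: h.hom_nat_pow)
    also have "\<dots> \<le> \<kappa> * dS \<one> (a [^] n)"
      using \<kappa> y ac by (intro rep_lipschitz[OF \<tau>H]) auto
    also have "\<dots> \<le> \<kappa> * (real (len a) * real n)"
      using \<kappa> dS_one_pow_le[OF a(1)] by (intro mult_left_mono) auto
    finally have 1: "dist y (\<rho> (\<psi> a [^] n) y) \<le> \<kappa> * (real (len a) * real n)" .
    have "dist x (\<rho> (\<psi> a [^] n) x) \<le> 2 * dist x y + dist y (\<rho> (\<psi> a [^] n) y)"
      using dist_triangle[of x "\<rho> (\<psi> a [^] n) x" y] dist_triangle[of y "\<rho> (\<psi> a [^] n) x" "\<rho> (\<psi> a [^] n) y"]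
        rep_dist[OF \<rho>H bc, of y x] by (simp add: dist_commute)
    then have "dS \<one> (\<psi> a [^] n) / \<kappa> \<le> E + 2 * dist x y + \<kappa> * (real (len a) * real n)" using E[of n] 1 by linarith
    then have "dS \<one> (\<psi> a [^] n) \<le> (E + 2 * dist x y + \<kappa> * (real (len a) * real n)) * \<kappa>"
      using \<kappa> by (simp add: divide_le_eq)
    then show ?thesis using B[of n] by (simp add: algebra_simps)
  qed
  then have "\<alpha> \<le> \<kappa> * \<kappa> * real (len a)" by (rule linear_growth_le)
  then show ?thesis unfolding \<alpha>_def \<kappa>_def by simp
qed

text \<open>The bound \<open>b\<close> on the translation lengths involves \<open>a\<close>,
  \<open>k\<close> and \<open>\<delta>\<close> but not \<open>n\<close>; this is where uniformity
  over \<open>R\<close> enters. It keeps the limsup finite for every \<open>a\<close> in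
  \<open>A\<close>, whereas infinitely many returning classes would force it to be infinite for some
  \<open>a\<close>.\<close>

lemma finite_out_return:
  fixes R :: "('g \<Rightarrow> ('x::metric_space \<Rightarrow> 'x)) set set"
  assumes test: "testable \<Gamma> S A" and R: "R \<subseteq> conj_class \<Gamma> ` tame_interior \<Gamma> S A k"
  shows "finite {\<Phi> \<in> Out \<Gamma>. out_act \<Gamma> \<Phi> ` R \<inter> R \<noteq> {}}"
proof (rule ccontr)
  have A: "A \<subseteq> carrier \<Gamma>" "\<And>\<phi>. \<phi> \<in> iso \<Gamma> \<Gamma> \<Longrightarrow> \<phi> ` A = A" using test unfolding testable_def by auto
  assume "infinite {\<Phi> \<in> Out \<Gamma>. out_act \<Gamma> \<Phi> ` R \<inter> R \<noteq> {}}"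
  from infinite_countable_subset[OF this] obtain \<Phi> :: "nat \<Rightarrow> ('g \<Rightarrow> 'g) set" where inj: "inj \<Phi>"
    and "range \<Phi> \<subseteq> {\<Phi> \<in> Out \<Gamma>. out_act \<Gamma> \<Phi> ` R \<inter> R \<noteq> {}}" by blast
  then have \<Phi>: "\<Phi> n \<in> Out \<Gamma>" "out_act \<Gamma> (\<Phi> n) ` R \<inter> R \<noteq> {}" for n by blast+
  have "\<exists>\<phi>\<in>\<Phi> n. \<exists>\<rho>\<in>tame_reps \<Gamma> S A k. \<exists>\<tau>\<in>tame_reps \<Gamma> S A k. \<forall>g\<in>carrier \<Gamma>.
      (\<tau> :: 'g \<Rightarrow> ('x \<Rightarrow> 'x)) g = \<rho> (inv_into (carrier \<Gamma>) \<phi> g)" for n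
  proof -
    obtain r where r: "r \<in> R" "out_act \<Gamma> (\<Phi> n) r \<in> R" using \<Phi>(2) by blast
    obtain \<rho>0 where \<rho>0: "\<rho>0 \<in> tame_interior \<Gamma> S A k" "r = conj_class \<Gamma> \<rho>0" using R r by blast
    obtain \<tau> where \<tau>: "\<tau> \<in> tame_interior \<Gamma> S A k" "out_act \<Gamma> (\<Phi> n) r = conj_class \<Gamma> \<tau>" using R r by blast
    \<comment> \<open>Classes are sets of representations, so \<open>\<tau>\<close> itself belongs
      to \<open>out_act \<Gamma> (\<Phi> n) r\<close>; this gives an equality of representations on
      the carrier, not just an equality up to conjugation.\<close>
    have "\<tau> \<in> out_act \<Gamma> (\<Phi> n) r" unfolding \<tau>(2) using \<tau>(1) tame_interior_Hom by (blast intro: conj_class_refl)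
    then obtain \<rho> \<phi> where "\<rho> \<in> r" "\<phi> \<in> \<Phi> n" "\<forall>g\<in>carrier \<Gamma>. \<tau> g = \<rho> (inv_into (carrier \<Gamma>) \<phi> g)"
      unfolding out_act_def by blast
    moreover have "\<rho> \<in> tame_interior \<Gamma> S A k" using tame_interior_conj \<rho>0 \<open>\<rho> \<in> r\<close> by blast
    ultimately show ?thesis using \<tau>(1) tame_interior_subset by blast
  qed
  then obtain \<phi> where \<phi>: "\<And>n. \<phi> n \<in> \<Phi> n" and bd: "\<And>n. \<exists>\<rho>\<in>tame_reps \<Gamma> S A k. \<exists>\<tau>\<in>tame_reps \<Gamma> S A k. \<forall>g\<in>carrier \<Gamma>.
      (\<tau> :: 'g \<Rightarrow> ('x \<Rightarrow> 'x)) g = \<rho> (inv_into (carrier \<Gamma>) (\<phi> n) g)" by metis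
  have \<phi>i: "\<phi> n \<in> iso \<Gamma> \<Gamma>" and \<Phi>eq: "\<Phi> n = outer_class \<Gamma> (\<phi> n)" for n
  proof -
    obtain \<theta> where \<theta>: "\<theta> \<in> iso \<Gamma> \<Gamma>" "\<Phi> n = outer_class \<Gamma> \<theta>" using \<Phi>(1)[of n] unfolding Out_def by blast
    have \<phi>\<theta>: "\<phi> n \<in> outer_class \<Gamma> \<theta>" using \<phi>[of n] \<theta>(2) by simp
    show "\<phi> n \<in> iso \<Gamma> \<Gamma>" using \<phi>\<theta> by (rule outer_classD)
    show "\<Phi> n = outer_class \<Gamma> (\<phi> n)" unfolding \<theta>(2) using outer_class_eqI[OF \<phi>\<theta> \<theta>(1)] by simp
  qed
  define \<psi> where "\<psi> n = inv_into (carrier \<Gamma>) (\<phi> n)" for n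
  have \<psi>: "\<psi> n \<in> iso \<Gamma> \<Gamma>" for n unfolding \<psi>_def by (rule iso_set_sym[OF \<phi>i])
  have distinct: "outer_class \<Gamma> (\<psi> m) \<noteq> outer_class \<Gamma> (\<psi> n)" if "m \<noteq> n" for m n
  proof
    assume "outer_class \<Gamma> (\<psi> m) = outer_class \<Gamma> (\<psi> n)"
    then have "outer_equiv \<Gamma> (\<psi> m) (\<psi> n)" using \<psi>[of m] outer_equiv_refl[OF \<psi>, of m] unfolding outer_class_def by blast
    then have "outer_equiv \<Gamma> (\<phi> n) (\<phi> m)" unfolding \<psi>_def by (rule outer_equiv_inv_into[OF \<phi>i \<phi>i])
    then have "\<phi> n \<in> outer_class \<Gamma> (\<phi> m)" unfolding outer_class_def using \<phi>i by simp
    then have "\<Phi> n = \<Phi> m" unfolding \<Phi>eq by (rule outer_class_eqI[OF _ \<phi>i])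
    then show False using inj that by (auto dest: injD)
  qed
  obtain a where a: "a \<in> A" "limsup (\<lambda>n. ereal (transl_len \<Gamma> S (\<psi> n a))) = \<infinity>"
  proof -
    have "\<forall>m n. m \<noteq> n \<longrightarrow> outer_class \<Gamma> (\<psi> m) \<noteq> outer_class \<Gamma> (\<psi> n)" using distinct by blast
    with \<psi> test show ?thesis unfolding testable_def by (elim conjE allE[of _ \<psi>] impE bexE) (auto intro: that)
  qed
  define b where "b = 6 * \<delta> + 3 + real (Suc k) * real (Suc k) * real (len a)"
  have "transl_len \<Gamma> S (\<psi> n a) \<le> b" for n
  proof -
    obtain \<rho> \<tau> :: "'g \<Rightarrow> ('x \<Rightarrow> 'x)" where "\<rho> \<in> tame_reps \<Gamma> S A k" "\<tau> \<in> tame_reps \<Gamma> S A k"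
      "\<And>g. g \<in> carrier \<Gamma> \<Longrightarrow> \<tau> g = \<rho> (\<psi> n g)" using bd[of n] unfolding \<psi>_def by blast
    then show ?thesis unfolding b_def
      using transl_len_bound[of \<rho> A k \<tau> "\<psi> n" a] \<psi> A a(1) by blast
  qed
  then have "limsup (\<lambda>n. ereal (transl_len \<Gamma> S (\<psi> n a))) \<le> ereal b"
    by (intro Limsup_bounded) auto
  then show False using a(2) by simp
qed

end

theorem mainTheorem4:
  fixes \<Gamma> :: "('g, 'b) monoid_scheme" and S A :: "'g set"
  assumes "hyperbolic_group \<Gamma> S"
    and "gromov_hyperbolic_on (UNIV :: 'x::metric_space set) dist"
    and "proper_space (UNIV :: 'x set)"
    and "geodesic_space (UNIV :: 'x set)"
    and "testable \<Gamma> S A"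
  shows "openin (char_top \<Gamma> S) (stable_set \<Gamma> S A :: ('g \<Rightarrow> ('x \<Rightarrow> 'x)) set set)
     \<and> (\<forall>\<Phi>\<in>Out \<Gamma>. out_act \<Gamma> \<Phi> ` stable_set \<Gamma> S A = (stable_set \<Gamma> S A :: ('g \<Rightarrow> ('x \<Rightarrow> 'x)) set set))
     \<and> (\<forall>R :: ('g \<Rightarrow> ('x \<Rightarrow> 'x)) set set. compactin (char_top \<Gamma> S) R \<and> R \<subseteq> stable_set \<Gamma> S A \<longrightarrow>
          finite {\<Phi> \<in> Out \<Gamma>. out_act \<Gamma> \<Phi> ` R \<inter> R \<noteq> {}})"
proof -
  obtain \<delta> where "hyp_group \<Gamma> S \<delta>"
    using assms(1)
    unfolding hyperbolic_group_def gromov_hyperbolic_on_def hyp_group_def hyp_group_axioms_def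
      fin_gen_group_def fin_gen_group_axioms_def gprod_def by blast
  then interpret hyp_group \<Gamma> S \<delta> .
  have "openin (char_top \<Gamma> S) (stable_set \<Gamma> S A :: ('g \<Rightarrow> ('x \<Rightarrow> 'x)) set set)"
    unfolding stable_set_eq[OF assms(2,4)] using openin_char_top_tame by (intro openin_Union) auto
  moreover have "out_act \<Gamma> \<Phi> ` stable_set \<Gamma> S A = (stable_set \<Gamma> S A :: ('g \<Rightarrow> ('x \<Rightarrow> 'x)) set set)"
    if "\<Phi> \<in> Out \<Gamma>" for \<Phi>
    using that assms(5) by (intro out_act_stable_set[OF assms(4)]) (auto simp: testable_def)
  moreover have "finite {\<Phi> \<in> Out \<Gamma>. out_act \<Gamma> \<Phi> ` R \<inter> R \<noteq> {}}"
    if R: "compactin (char_top \<Gamma> S) R" "R \<subseteq> stable_set \<Gamma> S A" for R :: "('g \<Rightarrow> ('x \<Rightarrow> 'x)) set set"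
  proof -
    obtain k where "R \<subseteq> conj_class \<Gamma> ` tame_interior \<Gamma> S A k" by (rule compact_stable_uniform[OF assms(2,4) R])
    then show ?thesis by (rule finite_out_return[OF assms(5)])
  qed
  ultimately show ?thesis by blast
qed

end
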